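(* There is a randomized algorithm that, given a positive integer $m$ and a multiset $X=\{x_1,\dots,x_n\}$ of integers in $\mathbb{Z}_m$, solves Modular Subset Sum (in fact computes the whole set $X^*$ of attainable subset sums modulo $m$, from which membership of any target $t$ can be read off) in time $\mathcal{O}(m \log^2 m)$, and is correct with high probability (probability at least $1 - 1/\mathrm{poly}(m)$).
   Context: Modular Subset Sum: given a positive integer $m$, a multiset $X = \{x_1,\dots,x_n\}$ of integers in $\mathbb{Z}_m$ and a target $t \in \mathbb{Z}_m$, decide whether some sub-multiset of $X$ has sum congruent to $t$ modulo $m$. $X^*$ denotes the set of all $s \in \mathbb{Z}_m$ attained as the sum modulo $m$ of some sub-multiset of $X$. Model of computation: the usual arithmetic operations on $\mathcal{O}(\log m)$-bit numbers take constant time. Convention: the stated running time ignores an initial $\mathcal{O}(n+m)$-time preprocessing step (which reduces to the case $n = \mathcal{O}(m)$); i.e. the bound hides an additive $\mathcal{O}(n)$ term for handling the input. *)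

theory Defs
  imports
    "HOL-Probability.Probability"
    "HOL-Number_Theory.Cong"
    "HOL-Library.Multiset"
    "HOL-Library.Log_Nat"
begin

section \<open>Modular subset sum\<close>

text \<open>The residues modulo \<open>m\<close> are represented by \<open>{..<m}\<close>.\<close>

definition modular_subset_sum :: "nat \<Rightarrow> nat multiset \<Rightarrow> nat \<Rightarrow> bool" where
  "modular_subset_sum m X t \<longleftrightarrow> (\<exists>Y. Y \<subseteq># X \<and> [sum_mset Y = t] (mod m))"

definition subset_sums :: "nat \<Rightarrow> nat multiset \<Rightarrow> nat set" where
  "subset_sums m X = {sum_mset Y mod m | Y. Y \<subseteq># X}"


section \<open>A randomized word RAM\<close>

text \<open>
  Programs are while-programs over word-valued registers, a random-access memory of words,
  and an input tape read once from left to right. Every word has \<open>w\<close> bits, and arithmetic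
  is modulo \<open>2 ^ w\<close>. A program may depend neither on \<open>w\<close> nor on the input. Each small step
  costs one time unit; it evaluates at most two expressions, whose sizes are fixed by the
  program, so it stands for a constant number of elementary RAM instructions.
\<close>

datatype binop = Add | Sub | Mul | Div | Rem | Less | Equal

datatype expr =
    Const nat
  | Reg nat
  | Load expr                      \<comment> \<open>memory cell at the given address\<close>
  | More                           \<comment> \<open>1 if unread input is left, otherwise 0\<close>
  | Bin binop expr expr

datatype com =
    Skip
  | Assign nat expr
  | Store expr expr                \<comment> \<open>address, value\<close>
  | Read nat
  | Random nat expr                \<comment> \<open>\<open>Random r e\<close> sets \<open>r\<close> to a uniform element of \<open>{0..e}\<close>\<close>
  | Seq com com
  | Cond expr com com
  | While expr com

record state =
  regs :: "nat \<Rightarrow> nat"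
  mem :: "nat \<Rightarrow> nat"
  tape :: "nat list"

text \<open>Subtraction wraps around; division and remainder by 0 follow the HOL conventions
  \<open>a div 0 = 0\<close> and \<open>a mod 0 = a\<close>.\<close>

fun eval_binop :: "nat \<Rightarrow> binop \<Rightarrow> nat \<Rightarrow> nat \<Rightarrow> nat" where
  "eval_binop w Add a b = take_bit w (a + b)"
| "eval_binop w Sub a b = nat (take_bit w (int a - int b))"
| "eval_binop w Mul a b = take_bit w (a * b)"
| "eval_binop w Div a b = take_bit w (a div b)"
| "eval_binop w Rem a b = take_bit w (a mod b)"
| "eval_binop w Less a b = take_bit w (of_bool (a < b))"
| "eval_binop w Equal a b = take_bit w (of_bool (a = b))"

fun eval_expr :: "nat \<Rightarrow> state \<Rightarrow> expr \<Rightarrow> nat" where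
  "eval_expr w s (Const k) = take_bit w k"
| "eval_expr w s (Reg r) = regs s r"
| "eval_expr w s (Load e) = mem s (eval_expr w s e)"
| "eval_expr w s More = take_bit w (of_bool (tape s \<noteq> []))"
| "eval_expr w s (Bin f e1 e2) = eval_binop w f (eval_expr w s e1) (eval_expr w s e2)"

definition set_reg :: "nat \<Rightarrow> nat \<Rightarrow> state \<Rightarrow> state" where
  "set_reg r v s = s\<lparr>regs := (regs s)(r := v)\<rparr>"

text \<open>\<open>Skip\<close> on its own is the halted program. Reading from an exhausted tape yields 0.\<close>

fun step :: "nat \<Rightarrow> com \<Rightarrow> state \<Rightarrow> (com \<times> state) pmf" where
  "step w Skip s = return_pmf (Skip, s)"
| "step w (Assign r e) s = return_pmf (Skip, set_reg r (eval_expr w s e) s)"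
| "step w (Store e1 e2) s =
     return_pmf (Skip, s\<lparr>mem := (mem s)(eval_expr w s e1 := eval_expr w s e2)\<rparr>)"
| "step w (Read r) s =
     return_pmf (Skip, case tape s of
                         [] \<Rightarrow> set_reg r 0 s
                       | x # xs \<Rightarrow> set_reg r (take_bit w x) (s\<lparr>tape := xs\<rparr>))"
| "step w (Random r e) s =
     map_pmf (\<lambda>v. (Skip, set_reg r v s)) (pmf_of_set {0..eval_expr w s e})"
| "step w (Seq c1 c2) s =
     (if c1 = Skip then return_pmf (c2, s)
      else map_pmf (\<lambda>(c, s'). (Seq c c2, s')) (step w c1 s))"
| "step w (Cond e c1 c2) s = return_pmf (if eval_expr w s e \<noteq> 0 then c1 else c2, s)"
| "step w (While e c) s =
     return_pmf (if eval_expr w s e \<noteq> 0 then Seq c (While e c) else Skip, s)"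

fun run :: "nat \<Rightarrow> nat \<Rightarrow> com \<times> state \<Rightarrow> (com \<times> state) pmf" where
  "run w 0 cfg = return_pmf cfg"
| "run w (Suc T) cfg = bind_pmf (step w (fst cfg) (snd cfg)) (run w T)"

text \<open>Worst-case time: \<open>Skip\<close> is absorbing, so this says that every computation path,
  whatever the random choices, has halted after at most \<open>T\<close> steps.\<close>

definition halts_within :: "nat \<Rightarrow> nat \<Rightarrow> com \<times> state \<Rightarrow> bool" where
  "halts_within w T cfg \<longleftrightarrow> (\<forall>cfg' \<in> set_pmf (run w T cfg). fst cfg' = Skip)"

definition init_state :: "nat list \<Rightarrow> state" where
  "init_state xs = \<lparr>regs = (\<lambda>_. 0), mem = (\<lambda>_. 0), tape = xs\<rparr>"

text \<open>\<open>floorlog 2 m\<close> is the length of the binary representation of \<open>m\<close>, so words have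
  \<open>O(log m)\<close> bits, independently of the number of input items.\<close>

definition word_bits :: "nat \<Rightarrow> nat \<Rightarrow> nat" where
  "word_bits K m = K * floorlog 2 m"

text \<open>The output is the characteristic vector stored in the memory cells \<open>0, \<dots>, m - 1\<close>,
  so membership of a single target is read off with one memory access.\<close>

definition output_set :: "nat \<Rightarrow> state \<Rightarrow> nat set" where
  "output_set m s = {t. t < m \<and> mem s t = 1}"

end

(*
The set S of sums attained so far is updated item by item. For an item x, S and its translate by x
are compared on intervals by the hash sum_{i in S} b^i mod N, whose prefix sums are kept in a
segment tree: one comparison takes O(log m) steps and locating one difference by binary search
O(log^2 m). The number of differences is twice the number of new sums, so at most 2m differences
are located over the whole run, and an item that once yields no new sum never yields one later, so
it is skipped from then on.

N is a product of k random primes p of order at least m^2 / log m, found by trial division among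
O(log^2 m) random numbers of order m^2. Two different intervals give a polynomial in b of degree
below 2m with coefficients in {-1, 0, 1}, not all 0. It has at most 2m roots modulo each p, hence at
most (2m)^k roots modulo N, which is a fraction of order (log m / m)^k. In an error-free run only m
sets S, m items and m^2 intervals occur, so a union bound finishes the argument.

Enough primes exist because 2^n <= (n+1) max_k C(n,k) <= lcm(1, ..., n+1) <= (n+1)^pi(n+1).
*)
theory Submission
  imports Defs "HOL-Computational_Algebra.Polynomial"
begin

section \<open>Running programs\<close>

text \<open>A single prime modulus does not fit the time bound. After a union bound over about m^4
  cases with up to 2m roots each, an error of m^(-d) calls for a modulus of order m^(d + 5), and
  trial division up to its square root is too slow. Candidates are therefore drawn below
  \<open>Q\<close>, the square of a number of order m, so that one test takes O(m) steps, and the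
  error is driven down by multiplying \<open>k\<close> accepted primes. One candidate succeeds with
  probability of order 1 / log m; a second factor log m in the number of candidates makes failing to
  collect \<open>k\<close> primes polynomially unlikely, and O(log^2 m) tests of O(m) steps just
  fit.

  Time is a worst case over all random choices, so it must not rely on the absence of collisions,
  nor on having found \<open>k\<close> primes. Invariants therefore have an unconditional part that
  yields the time and a conditional part, guarded by \<open>good\<close> or \<open>all_good\<close>,
  that yields correctness. The error probability is carried through the randomized phases as a
  potential that bounds the expected failure.\<close>

lemma run_Skip [simp]: "run w t (Skip, s) = return_pmf (Skip, s)"
  by (induction t) (simp_all add: bind_return_pmf)

lemma run_add: "run w (t1 + t2) cfg = bind_pmf (run w t1 cfg) (run w t2)"
proof (induction t1 arbitrary: cfg)
  case (Suc t1)
  have "run w (t1 + t2) = (\<lambda>cfg. bind_pmf (run w t1 cfg) (run w t2))"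
    by (rule ext) (rule Suc.IH)
  then show ?case by (simp add: bind_assoc_pmf)
qed (simp add: bind_return_pmf)


text \<open>On paths where \<open>c1\<close> halts early, \<open>c2\<close> starts early; it still
  halts within \<open>t2\<close> steps and then idles, since \<open>Skip\<close> is absorbing. So
  padding to worst-case times does not change the final distribution. The summand 1 is the step that
  drops the finished \<open>Skip\<close>.\<close>

lemma run_Seq_absorb:
  assumes "\<forall>cfg \<in> set_pmf (run w t1 (c1, s)). fst cfg = Skip"
    and "\<And>s'. (Skip, s') \<in> set_pmf (run w t1 (c1, s)) \<Longrightarrow>
           \<forall>cfg \<in> set_pmf (run w t2 (c2, s')). fst cfg = Skip"
  shows "run w (t1 + t2 + 1) (Seq c1 c2, s) =
           bind_pmf (run w t1 (c1, s)) (\<lambda>cfg. run w t2 (c2, snd cfg))"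
  using assms
proof (induction t1 arbitrary: c1 s)
  case 0
  then show ?case by (simp add: bind_return_pmf)
next
  case (Suc t1)
  show ?case
  proof (cases "c1 = Skip")
    case True
    have h: "\<forall>cfg \<in> set_pmf (run w t2 (c2, s)). fst cfg = Skip"
      using Suc.prems(2)[of s] True by simp
    have "run w (Suc t1 + t2 + 1) (Seq c1 c2, s) = run w (t2 + Suc t1) (c2, s)"
      by (simp add: True bind_return_pmf add.commute)
    also have "\<dots> = bind_pmf (run w t2 (c2, s)) (\<lambda>cfg. return_pmf cfg)"
      unfolding run_add
    proof (intro bind_pmf_cong refl)
      fix cfg assume "cfg \<in> set_pmf (run w t2 (c2, s))"
      with h have "cfg = (Skip, snd cfg)" by (metis prod.collapse)
      then show "run w (Suc t1) cfg = return_pmf cfg" by (metis run_Skip)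
    qed
    also have "\<dots> = bind_pmf (run w (Suc t1) (c1, s)) (\<lambda>cfg. run w t2 (c2, snd cfg))"
      by (simp add: True bind_return_pmf bind_return_pmf' del: run.simps)
    finally show ?thesis .
  next
    case False
    have "run w (Suc t1 + t2 + 1) (Seq c1 c2, s) =
      bind_pmf (step w c1 s) (\<lambda>cfg. run w (t1 + t2 + 1) (Seq (fst cfg) c2, snd cfg))"
      using False by (simp add: bind_map_pmf case_prod_beta)
    also have "\<dots> = bind_pmf (step w c1 s)
        (\<lambda>cfg. bind_pmf (run w t1 (fst cfg, snd cfg)) (\<lambda>cfg. run w t2 (c2, snd cfg)))"
    proof (intro bind_pmf_cong refl)
      fix cfg assume "cfg \<in> set_pmf (step w c1 s)"
      then show "run w (t1 + t2 + 1) (Seq (fst cfg) c2, snd cfg) =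
          bind_pmf (run w t1 (fst cfg, snd cfg)) (\<lambda>cfg. run w t2 (c2, snd cfg))"
        using Suc.prems by (intro Suc.IH) (force simp: set_bind_pmf)+
    qed
    finally show ?thesis by (simp add: bind_assoc_pmf)
  qed
qed

section \<open>Total correctness with exact step counts for deterministic programs\<close>

definition det :: "nat \<Rightarrow> com \<Rightarrow> state \<Rightarrow> (nat \<Rightarrow> state \<Rightarrow> bool) \<Rightarrow> bool" where
  "det w c s Q \<longleftrightarrow> (\<exists>t s'. run w t (c, s) = return_pmf (Skip, s') \<and> Q t s')"

lemma detI: "run w t (c, s) = return_pmf (Skip, s') \<Longrightarrow> Q t s' \<Longrightarrow> det w c s Q"
  unfolding det_def by blast

lemma det_mono: "det w c s Q \<Longrightarrow> (\<And>t s'. Q t s' \<Longrightarrow> Q' t s') \<Longrightarrow> det w c s Q'"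
  unfolding det_def by blast

lemma det_Assign: "Q 1 (set_reg r (eval_expr w s e) s) \<Longrightarrow> det w (Assign r e) s Q"
  by (rule detI[where t = 1]) (simp_all add: bind_return_pmf)

lemma det_Store:
  "Q 1 (s\<lparr>mem := (mem s)(eval_expr w s e1 := eval_expr w s e2)\<rparr>) \<Longrightarrow> det w (Store e1 e2) s Q"
  by (rule detI[where t = 1]) (simp_all add: bind_return_pmf)

lemma det_Read:
  "tape s = x # xs \<Longrightarrow> Q 1 (set_reg r (take_bit w x) (s\<lparr>tape := xs\<rparr>)) \<Longrightarrow> det w (Read r) s Q"
  by (rule detI[where t = 1]) (simp_all add: bind_return_pmf)

lemma det_Skip: "Q 0 s \<Longrightarrow> det w Skip s Q"
  by (rule detI[where t = 0]) (simp_all add: bind_return_pmf)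

lemma det_Seq:
  assumes "det w c1 s (\<lambda>t1 s1. det w c2 s1 (\<lambda>t2. Q (t1 + t2 + 1)))"
  shows "det w (Seq c1 c2) s Q"
proof -
  obtain t1 s1 where 1: "run w t1 (c1, s) = return_pmf (Skip, s1)"
    and "det w c2 s1 (\<lambda>t2. Q (t1 + t2 + 1))"
    using assms unfolding det_def[of w c1] by blast
  then obtain t2 s2 where 2: "run w t2 (c2, s1) = return_pmf (Skip, s2)" "Q (t1 + t2 + 1) s2"
    unfolding det_def by blast
  show ?thesis
    by (rule detI[where t = "t1 + t2 + 1" and s' = s2], subst run_Seq_absorb)
      (use 1 2 in \<open>simp_all add: bind_return_pmf\<close>)
qed

lemma det_Seq_post:
  assumes "det w c1 s R" and "\<And>t1 s1. R t1 s1 \<Longrightarrow> det w c2 s1 (\<lambda>t2. Q (t1 + t2 + 1))"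
  shows "det w (Seq c1 c2) s Q"
  using assms by (blast intro: det_Seq det_mono)

lemma det_Cond:
  assumes "eval_expr w s e \<noteq> 0 \<Longrightarrow> det w c1 s (\<lambda>t. Q (Suc t))"
    and "eval_expr w s e = 0 \<Longrightarrow> det w c2 s (\<lambda>t. Q (Suc t))"
  shows "det w (Cond e c1 c2) s Q"
proof -
  obtain t s' where "run w t (if eval_expr w s e \<noteq> 0 then c1 else c2, s) = return_pmf (Skip, s')"
    "Q (Suc t) s'"
    using assms unfolding det_def by (cases "eval_expr w s e = 0") auto
  then show ?thesis
    by (intro detI[where t = "Suc t"]) (auto simp: bind_return_pmf)
qed

lemma det_While_unfold:
  assumes "eval_expr w s e \<noteq> 0 \<Longrightarrow> det w (Seq c (While e c)) s (\<lambda>t. Q (Suc t))"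
    and "eval_expr w s e = 0 \<Longrightarrow> Q 1 s"
  shows "det w (While e c) s Q"
proof (cases "eval_expr w s e = 0")
  case True
  then show ?thesis using assms(2)
    by (intro detI[where t = 1]) (simp_all add: bind_return_pmf)
next
  case False
  with assms(1) obtain t s' where "run w t (Seq c (While e c), s) = return_pmf (Skip, s')" "Q (Suc t) s'"
    unfolding det_def by blast
  then show ?thesis using False by (intro detI[where t = "Suc t"]) (simp_all add: bind_return_pmf)
qed

text \<open>The index of \<open>I\<close> is a budget of time rather than a number of rounds: 2 of
  it pay for the loop test and the removal of \<open>Skip\<close>, and its strict decrease gives
  termination. The unspent budget \<open>n'\<close> stays in the conclusion so that amortized bounds
  can be read off.\<close>

lemma det_While:
  assumes step: "\<And>n s. I n s \<Longrightarrow> eval_expr w s e \<noteq> 0 \<Longrightarrow>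
      det w c s (\<lambda>t s'. \<exists>n'. I n' s' \<and> t + n' + 2 \<le> n)"
    and "I n s"
  shows "det w (While e c) s (\<lambda>t s'. \<exists>n'. I n' s' \<and> eval_expr w s' e = 0 \<and> t + n' \<le> n + 1)"
  using \<open>I n s\<close>
proof (induction n arbitrary: s rule: less_induct)
  case (less n)
  show ?case
  proof (rule det_While_unfold)
    assume "eval_expr w s e \<noteq> 0"
    from step[OF less.prems this]
    show "det w (Seq c (While e c)) s
        (\<lambda>t s'. \<exists>n'. I n' s' \<and> eval_expr w s' e = 0 \<and> Suc t + n' \<le> n + 1)"
    proof (intro det_Seq, elim det_mono exE conjE)
      fix t s' n' assume *: "I n' s'" "t + n' + 2 \<le> n"
      show "det w (While e c) s' (\<lambda>t2 s'. \<exists>n'. I n' s' \<and> eval_expr w s' e = 0 \<and> Suc (t + t2 + 1) + n' \<le> n + 1)"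
        by (rule det_mono[OF less.IH[OF _ *(1)]]) (use * in force)+
    qed
  qed (use less.prems in auto)
qed

section \<open>Expected values for randomized programs\<close>

text \<open>The value \<open>\<infinity>\<close> of \<open>F\<close> marks states that must not be reached; nothing is claimed for \<open>e = \<infinity>\<close>.\<close>

definition expect :: "nat \<Rightarrow> com \<Rightarrow> state \<Rightarrow> nat \<Rightarrow> (state \<Rightarrow> ennreal) \<Rightarrow> ennreal \<Rightarrow> bool" where
  "expect w c s t F e \<longleftrightarrow> (e < \<infinity> \<longrightarrow> halts_within w t (c, s) \<and>
     (\<integral>\<^sup>+cfg. F (snd cfg) \<partial>measure_pmf (run w t (c, s))) \<le> e)"

lemma expect_det:
  assumes "e < \<infinity> \<Longrightarrow> det w c s (\<lambda>t' s'. t' \<le> t \<and> F s' \<le> e)"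
  shows "expect w c s t F e"
  unfolding expect_def
proof
  assume "e < \<infinity>"
  from assms[OF this] obtain t' s' where
    *: "run w t' (c, s) = return_pmf (Skip, s')" "t' \<le> t" "F s' \<le> e"
    unfolding det_def by blast
  then have "run w t (c, s) = return_pmf (Skip, s')"
    using run_add[of w t' "t - t'" "(c, s)"] by (simp add: bind_return_pmf)
  then show "halts_within w t (c, s) \<and> (\<integral>\<^sup>+cfg. F (snd cfg) \<partial>measure_pmf (run w t (c, s))) \<le> e"
    using * by (simp add: halts_within_def)
qed

text \<open>A finite expectation excludes the value \<infinity> on the support, because a pmf has no
  null points there. Hence the second hypothesis applies, and with it halting, at every state in
  which \<open>c1\<close> can end.\<close>

lemma expect_Seq:
  assumes 1: "expect w c1 s t1 G e" and 2: "\<And>s'. expect w c2 s' t2 F (G s')"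
    and t: "t1 + t2 + 1 = t"
  shows "expect w (Seq c1 c2) s t F e"
  unfolding expect_def
proof
  assume "e < \<infinity>"
  with 1 have h1: "\<forall>cfg \<in> set_pmf (run w t1 (c1, s)). fst cfg = Skip"
    and i1: "(\<integral>\<^sup>+cfg. G (snd cfg) \<partial>measure_pmf (run w t1 (c1, s))) \<le> e"
    unfolding expect_def halts_within_def by auto
  have fin: "G (snd cfg) < \<infinity>" if "cfg \<in> set_pmf (run w t1 (c1, s))" for cfg
  proof -
    have "AE cfg in run w t1 (c1, s). G (snd cfg) \<noteq> \<infinity>"
      using i1 \<open>e < \<infinity>\<close> by (intro nn_integral_PInf_AE) auto
    then show ?thesis using that by (auto simp: AE_measure_pmf_iff top.not_eq_extremum)
  qed
  have h2: "\<forall>cfg \<in> set_pmf (run w t2 (c2, s')). fst cfg = Skip"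
    if "(Skip, s') \<in> set_pmf (run w t1 (c1, s))" for s'
    using fin[OF that] 2[of s'] unfolding expect_def halts_within_def by auto
  have eq: "run w t (Seq c1 c2, s) =
           bind_pmf (run w t1 (c1, s)) (\<lambda>cfg. run w t2 (c2, snd cfg))"
    unfolding t[symmetric] by (rule run_Seq_absorb[OF h1 h2])
  have "halts_within w t (Seq c1 c2, s)"
    unfolding halts_within_def eq using h1 h2 by (fastforce simp: set_bind_pmf)
  moreover have "(\<integral>\<^sup>+cfg. F (snd cfg) \<partial>measure_pmf (run w t (Seq c1 c2, s))) =
    (\<integral>\<^sup>+cfg. (\<integral>\<^sup>+cfg'. F (snd cfg') \<partial>measure_pmf (run w t2 (c2, snd cfg))) \<partial>measure_pmf (run w t1 (c1, s)))"
    unfolding eq by (subst nn_integral_bind_pmf) auto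
  moreover have "\<dots> \<le> (\<integral>\<^sup>+cfg. G (snd cfg) \<partial>measure_pmf (run w t1 (c1, s)))"
    using fin 2 unfolding expect_def by (intro nn_integral_mono_AE) (auto simp: AE_measure_pmf_iff)
  ultimately show "halts_within w t (Seq c1 c2, s) \<and>
      (\<integral>\<^sup>+cfg. F (snd cfg) \<partial>measure_pmf (run w t (Seq c1 c2, s))) \<le> e"
    using i1 by auto
qed

lemma expect_Random:
  assumes "e < \<infinity> \<Longrightarrow>
    (\<integral>\<^sup>+v. F (set_reg r v s) \<partial>measure_pmf (pmf_of_set {0..eval_expr w s ex})) \<le> e"
  shows "expect w (Random r ex) s 1 F e"
  using assms unfolding expect_def halts_within_def
  by (auto simp: bind_return_pmf' simp flip: One_nat_def)
     (auto simp: bind_return_pmf')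

text \<open>With \<open>n\<close> rounds to go, \<open>\<Phi> n\<close> bounds the expected final
  value, so a round only has to satisfy a supermartingale inequality. Finiteness of
  \<open>\<Phi> n\<close> also decides the loop test, which fixes the number of rounds.\<close>

lemma expect_While:
  assumes step: "\<And>n s. \<Phi> (Suc n) s < \<infinity> \<Longrightarrow> eval_expr w s e \<noteq> 0 \<and> expect w c s t (\<Phi> n) (\<Phi> (Suc n) s)"
    and stop: "\<And>s. \<Phi> 0 s < \<infinity> \<Longrightarrow> eval_expr w s e = 0"
  shows "expect w (While e c) s (n * (t + 2) + 1) (\<Phi> 0) (\<Phi> n s)"
proof (induction n arbitrary: s)
  case 0
  show ?case by (rule expect_det) (use stop in \<open>auto intro!: det_While_unfold\<close>)
next
  case (Suc n)
  show ?case
  proof (cases "\<Phi> (Suc n) s < \<infinity>")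
    case True
    have "expect w (Seq c (While e c)) s (t + (n * (t + 2) + 1) + 1) (\<Phi> 0) (\<Phi> (Suc n) s)"
      using step[OF True] Suc.IH by (blast intro: expect_Seq)
    with step[OF True] show ?thesis
      by (auto simp: expect_def halts_within_def bind_return_pmf algebra_simps)
  qed (simp add: expect_def)
qed

section \<open>Prefix sums in a segment tree\<close>

lemma eval_binop_exact:
  "a + b < 2 ^ w \<Longrightarrow> eval_binop w Add a b = a + b"
  "b \<le> a \<Longrightarrow> a < 2 ^ w \<Longrightarrow> eval_binop w Sub a b = a - b"
  "a * b < 2 ^ w \<Longrightarrow> eval_binop w Mul a b = a * b"
  "a < 2 ^ w \<Longrightarrow> eval_binop w Div a b = a div b"
  "a < 2 ^ w \<Longrightarrow> eval_binop w Rem a b = a mod b"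
  "0 < w \<Longrightarrow> eval_binop w Less a b = of_bool (a < b)"
  "0 < w \<Longrightarrow> eval_binop w Equal a b = of_bool (a = b)"
  "c < 2 ^ w \<Longrightarrow> eval_expr w s (Const c) = c"
proof -
  assume "b \<le> a" "a < 2 ^ w"
  moreover from this have "int a - int b = int (a - b)" "a - b < 2 ^ w" by auto
  ultimately show "eval_binop w Sub a b = a - b"
    by (simp add: take_bit_nat_eq_self del: of_nat_diff flip: of_nat_take_bit)
next
  assume "a < 2 ^ w"
  then have "a div b < 2 ^ w" "a mod b < 2 ^ w"
    using div_le_dividend[of a b] mod_less_eq_dividend[of a b] by linarith+
  then show "eval_binop w Div a b = a div b" "eval_binop w Rem a b = a mod b"
    by (simp_all add: take_bit_nat_eq_self)
qed (auto simp: take_bit_nat_eq_self)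

declare eval_binop.simps [simp del] eval_expr.simps(1) [simp del]

lemma regs_set_reg [simp]: "regs (set_reg r v s) = (regs s)(r := v)"
  and mem_set_reg [simp]: "mem (set_reg r v s) = mem s"
  and tape_set_reg [simp]: "tape (set_reg r v s) = tape s"
  by (simp_all add: set_reg_def)

abbreviation add_expr (infixl "+\<^sub>e" 65) where "a +\<^sub>e b \<equiv> Bin Add a b"
abbreviation sub_expr (infixl "-\<^sub>e" 65) where "a -\<^sub>e b \<equiv> Bin Sub a b"
abbreviation mul_expr (infixl "*\<^sub>e" 70) where "a *\<^sub>e b \<equiv> Bin Mul a b"
abbreviation div_expr (infixl "div\<^sub>e" 70) where "a div\<^sub>e b \<equiv> Bin Div a b"
abbreviation mod_expr (infixl "mod\<^sub>e" 70) where "a mod\<^sub>e b \<equiv> Bin Rem a b"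
abbreviation less_expr (infix "<\<^sub>e" 50) where "a <\<^sub>e b \<equiv> Bin Less a b"
abbreviation eq_expr (infix "=\<^sub>e" 50) where "a =\<^sub>e b \<equiv> Bin Equal a b"
abbreviation seq_com (infixr ";;" 40) where "a ;; b \<equiv> Seq a b"
abbreviation assign_com (infix "::=" 45) where "r ::= e \<equiv> Assign r e"

abbreviation (input) rm :: nat where "rm \<equiv> 10"
abbreviation (input) rM :: nat where "rM \<equiv> 11"
abbreviation (input) rL :: nat where "rL \<equiv> 12"
abbreviation (input) rN :: nat where "rN \<equiv> 13"
abbreviation (input) rcnt :: nat where "rcnt \<equiv> 14"
abbreviation (input) rt :: nat where "rt \<equiv> 15"
abbreviation (input) rv :: nat where "rv \<equiv> 16"
abbreviation (input) rok :: nat where "rok \<equiv> 17"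
abbreviation (input) ri :: nat where "ri \<equiv> 18"
abbreviation (input) rb :: nat where "rb \<equiv> 19"
abbreviation (input) rx :: nat where "rx \<equiv> 20"
abbreviation (input) rhx :: nat where "rhx \<equiv> 21"
abbreviation (input) rq :: nat where "rq \<equiv> 22"
abbreviation (input) re :: nat where "re \<equiv> 23"
abbreviation (input) racc :: nat where "racc \<equiv> 24"
abbreviation (input) rnode :: nat where "rnode \<equiv> 25"
abbreviation (input) rEm :: nat where "rEm \<equiv> 26"
abbreviation (input) rEa :: nat where "rEa \<equiv> 27"
abbreviation (input) rpos :: nat where "rpos \<equiv> 28"
abbreviation (input) rlo :: nat where "rlo \<equiv> 29"
abbreviation (input) rhi :: nat where "rhi \<equiv> 30"
abbreviation (input) ry :: nat where "ry \<equiv> 31"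
abbreviation (input) rsp :: nat where "rsp \<equiv> 32"
abbreviation (input) rany :: nat where "rany \<equiv> 33"
abbreviation (input) rfuel :: nat where "rfuel \<equiv> 34"
abbreviation (input) rz :: nat where "rz \<equiv> 35"

definition same_but :: "nat set \<Rightarrow> state \<Rightarrow> state \<Rightarrow> bool" where
  "same_but A s s' \<longleftrightarrow> tape s' = tape s \<and> (\<forall>r. r \<notin> A \<longrightarrow> regs s' r = regs s r)"

lemma same_but_regs: "same_but A s s' \<Longrightarrow> r \<notin> A \<Longrightarrow> regs s' r = regs s r"
  and same_but_tape: "same_but A s s' \<Longrightarrow> tape s' = tape s"
  and same_but_refl [simp]: "same_but A s s"
  and same_but_trans: "same_but A s s' \<Longrightarrow> same_but B s' s'' \<Longrightarrow> A \<union> B \<subseteq> C \<Longrightarrow> same_but C s s''"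
  unfolding same_but_def by (auto, metis UnCI subsetD)

text \<open>Memory layout: the characteristic vector of the current set in \<open>{0..<M}\<close>, flags of the items
  to be skipped in \<open>{M..<2 * M}\<close>, the powers of \<open>b\<close> modulo \<open>N\<close> in \<open>{2 * M..<4 * M}\<close>, tree node \<open>u\<close> in
  cell \<open>4 * M + u\<close> (node \<open>u\<close> has children \<open>2 * u\<close> and \<open>2 * u + 1\<close>, leaf \<open>i\<close> is node \<open>2 * M + i\<close>), and from
  \<open>8 * M\<close> on a stack of the sums to be inserted. Tree nodes are not reduced modulo \<open>N\<close>.\<close>

locale segment_tree =
  fixes w m M L N b :: nat
  assumes M: "M = 2 ^ L" and m: "0 < m" "m < M" and N: "0 < N"
    and word: "N * N < 2 ^ w" "4 * M * N < 2 ^ w" "16 * M < 2 ^ w"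
begin

definition h :: "nat \<Rightarrow> nat" where "h i = b ^ i mod N"

lemma h_less: "h i < N" using N by (simp add: h_def)

lemma w: "0 < w"
  using word(3) m by (cases w) auto

lemma eval_Const [simp]: "c \<le> 16 \<Longrightarrow> eval_expr w s (Const c) = c"
  using word(3) m by (intro eval_binop_exact) linarith

lemma eval_compare [simp]:
  "eval_binop w Less i j = of_bool (i < j)" "eval_binop w Equal i j = of_bool (i = j)"
  using w by (rule eval_binop_exact)+

lemma Nw: "N < 2 ^ w"
  using word(1) N by (meson le_less_trans le_square)

text \<open>In heap numbering, climbing \<open>j\<close> levels from leaf \<open>i\<close> is a
  division by a power of 2. The root 1 is reached at \<open>j = L + 1\<close>, and above it the
  value is 0.\<close>

definition anc :: "nat \<Rightarrow> nat \<Rightarrow> nat" where "anc i j = (2 * M + i) div 2 ^ j"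

lemma anc_0 [simp]: "anc i 0 = 2 * M + i" by (simp add: anc_def)

lemma anc_Suc: "anc i (Suc j) = anc i j div 2"
  unfolding anc_def power_Suc2 by (rule div_mult2_eq)

lemma anc_mono: "i \<le> r \<Longrightarrow> anc i j \<le> anc r j"
  by (simp add: anc_def div_le_mono)

lemma anc_bounds:
  assumes "i < 2 * M" "j \<le> Suc L"
  shows "2 ^ (Suc L - j) \<le> anc i j" "anc i j < 2 * 2 ^ (Suc L - j)"
proof -
  have *: "2 * M = 2 ^ (Suc L - j) * 2 ^ j" using assms by (simp add: M flip: power_add power_Suc)
  show "2 ^ (Suc L - j) \<le> anc i j"
    unfolding anc_def by (simp add: less_eq_div_iff_mult_less_eq *)
  show "anc i j < 2 * 2 ^ (Suc L - j)"
    unfolding anc_def using assms * by (simp add: div_less_iff_less_mult)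
qed

lemma anc_eq_0: "i < 2 * M \<Longrightarrow> Suc L < j \<Longrightarrow> anc i j = 0"
proof -
  assume "i < 2 * M" "Suc L < j"
  then have "(2::nat) ^ (L + 2) \<le> 2 ^ j" by (intro power_increasing) auto
  with \<open>i < 2 * M\<close> show ?thesis unfolding anc_def by (simp add: M)
qed

text \<open>Each level occupies the numbers between two consecutive powers of 2, so a node
  determines its level. This turns the existential over levels in \<open>node_sum\<close> into one
  fixed level.\<close>

lemma anc_level:
  assumes "i < 2 * M" "j \<le> Suc L" "2 ^ (Suc L - j) \<le> u" "u < 2 * 2 ^ (Suc L - j)" "anc i j' = u"
  shows "j' = j"
proof (rule ccontr)
  assume "j' \<noteq> j"
  have "0 < u" using assms(3) by (meson less_le_trans zero_less_numeral zero_less_power)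
  then have j': "j' \<le> Suc L" using anc_eq_0[of i j'] assms by (cases "j' \<le> Suc L") auto
  note b = anc_bounds[OF assms(1) this]
  show False
  proof (cases "j' < j")
    case True
    then have "(2::nat) * 2 ^ (Suc L - j) \<le> 2 ^ (Suc L - j')"
      using assms(2) j' unfolding power_Suc[symmetric] by (intro power_increasing) auto
    with b assms show False by linarith
  next
    case False
    then have "(2::nat) * 2 ^ (Suc L - j') \<le> 2 ^ (Suc L - j)"
      using assms(2) j' \<open>j' \<noteq> j\<close> unfolding power_Suc[symmetric] by (intro power_increasing) auto
    with b assms show False by linarith
  qed
qed

definition node_sum :: "nat set \<Rightarrow> nat \<Rightarrow> nat" where
  "node_sum A u = (\<Sum>i | i \<in> A \<and> (\<exists>j. anc i j = u). h i)"

definition psum :: "nat set \<Rightarrow> nat \<Rightarrow> nat" where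
  "psum A r = (\<Sum>i | i \<in> A \<and> i < r. h i)"

lemma psum_less: "psum A r \<le> r * N"
proof -
  have "psum A r \<le> (\<Sum>i | i \<in> A \<and> i < r. N)"
    unfolding psum_def by (intro sum_mono) (simp add: h_less less_imp_le)
  also have "\<dots> \<le> r * N"
    using card_mono[of "{..<r}" "{i. i \<in> A \<and> i < r}"] by auto
  finally show ?thesis .
qed

text \<open>The accumulated value of a query for \<open>r\<close> after climbing \<open>j\<close> levels.\<close>

definition part :: "nat set \<Rightarrow> nat \<Rightarrow> nat \<Rightarrow> nat" where
  "part A r j = (\<Sum>i | i \<in> A \<and> i < r \<and> anc i j = anc r j. h i)"

lemma part_0 [simp]: "part A r 0 = 0" by (auto simp: part_def)

lemma part_le: "part A r j \<le> psum A r"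
  unfolding part_def psum_def by (intro sum_mono2) auto

lemma part_top: "r < 2 * M \<Longrightarrow> anc r j \<le> 1 \<Longrightarrow> j \<le> Suc L \<Longrightarrow> part A r j = psum A r"
proof -
  assume *: "r < 2 * M" "anc r j \<le> 1" "j \<le> Suc L"
  have "anc i j = anc r j" if "i < r" for i
  proof -
    have "(1::nat) \<le> 2 ^ (Suc L - j)" by simp
    also have "\<dots> \<le> anc i j" using anc_bounds(1)[of i j] that * by simp
    finally have "1 \<le> anc i j" .
    with * anc_mono[of i r j] that show ?thesis by simp
  qed
  then show ?thesis unfolding part_def psum_def by (intro sum.cong) auto
qed

text \<open>Among the indices below \<open>r\<close>, those that join the subtree of the current
  ancestor on climbing one level lie under its left sibling. There is one exactly if the ancestor is
  a right child, that is, has an odd number.\<close>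

lemma part_Suc:
  assumes r: "r < 2 * M" "A \<subseteq> {..<2 * M}" and j: "j \<le> Suc L" "1 < anc r j"
  shows "part A r (Suc j) = part A r j + (anc r j mod 2) * node_sum A (anc r j - 1)"
proof -
  have half: "u div 2 = v div 2 \<longleftrightarrow> u = v \<or> odd v \<and> u = v - 1" if "u \<le> v" for u v :: nat
  proof -
    have "u div 2 = v div 2 \<longleftrightarrow> 2 * (v div 2) \<le> u"
      using that by linarith
    moreover have "v = 2 * (v div 2) + v mod 2" by simp
    moreover have "v mod 2 = (if odd v then 1 else 0)" by (simp add: odd_iff_mod_2_eq_one)
    ultimately show ?thesis using that by (cases "odd v") auto
  qed
  have step: "anc i (Suc j) = anc r (Suc j) \<longleftrightarrow>
      anc i j = anc r j \<or> odd (anc r j) \<and> anc i j = anc r j - 1" if "i < r" for i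
    using half[OF anc_mono[of i r j]] that by (simp add: anc_Suc)
  have set_eq: "{i \<in> A. i < r \<and> anc i (Suc j) = anc r (Suc j)} =
      {i \<in> A. i < r \<and> anc i j = anc r j} \<union> {i \<in> A. i < r \<and> odd (anc r j) \<and> anc i j = anc r j - 1}"
    by (auto simp: step simp del: One_nat_def)
  have fin: "finite A" using r(2) finite_subset by blast
  have "part A r (Suc j) = part A r j + (\<Sum>i | i \<in> A \<and> i < r \<and> odd (anc r j) \<and> anc i j = anc r j - 1. h i)"
    unfolding part_def set_eq
  proof (rule sum.union_disjoint)
    show "{i \<in> A. i < r \<and> anc i j = anc r j} \<inter>
      {i \<in> A. i < r \<and> odd (anc r j) \<and> anc i j = anc r j - 1} = {}" using j(2) by auto
  qed (use fin in auto)
  also have "(\<Sum>i | i \<in> A \<and> i < r \<and> odd (anc r j) \<and> anc i j = anc r j - 1. h i) =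
      (anc r j mod 2) * node_sum A (anc r j - 1)"
  proof (cases "odd (anc r j)")
    case True
    \<comment> \<open>The leftmost node of a level is a power of 2 and, below the root, even. So the
      left neighbour of an odd node stays on the same level.\<close>
    have "Suc L - j \<noteq> 0"
      using anc_bounds[OF r(1) j(1)] j(2) True by (intro notI) simp
    then have "even ((2::nat) ^ (Suc L - j))" by simp
    with True have "2 ^ (Suc L - j) \<noteq> anc r j" by metis
    then have lv: "2 ^ (Suc L - j) \<le> anc r j - 1" "anc r j - 1 < 2 * 2 ^ (Suc L - j)"
      using anc_bounds[OF r(1) j(1)] by linarith+
    have "i < r" if "anc i j = anc r j - 1" for i
      using anc_mono[of r i j] that j by (cases "i < r") simp_all
    moreover have "j' = j" if "i \<in> A" "anc i j' = anc r j - 1" for i j'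
    proof (rule anc_level[OF _ j(1) lv that(2)])
      show "i < 2 * M" using that(1) r(2) by auto
    qed
    ultimately have "{i \<in> A. i < r \<and> odd (anc r j) \<and> anc i j = anc r j - 1} =
      {i \<in> A. \<exists>j'. anc i j' = anc r j - 1}" using True by blast
    with True show ?thesis by (simp add: node_sum_def odd_iff_mod_2_eq_one)
  qed (simp add: even_iff_mod_2_eq_zero)
  finally show ?thesis .
qed

definition base :: "state \<Rightarrow> bool" where
  "base s \<longleftrightarrow> regs s rm = m \<and> regs s rM = M \<and> regs s rN = N"

definition tree_ok :: "nat set \<Rightarrow> state \<Rightarrow> bool" where
  "tree_ok A s \<longleftrightarrow> (\<forall>u. 1 \<le> u \<longrightarrow> u < 4 * M \<longrightarrow> mem s (4 * M + u) = node_sum A u)"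

end

text \<open>Multiplying by the parity bit replaces a branch: at an even node the neighbouring cell
  is read with weight 0.\<close>

definition prefix_prog :: com where
  "prefix_prog =
     (rnode ::= Const 2 *\<^sub>e Reg rM +\<^sub>e Reg rq;;
      racc ::= Const 0;;
      While (Const 1 <\<^sub>e Reg rnode)
        (racc ::= Reg racc +\<^sub>e (Reg rnode mod\<^sub>e Const 2) *\<^sub>e
                   Load (Const 4 *\<^sub>e Reg rM +\<^sub>e Reg rnode -\<^sub>e Const 1);;
         rnode ::= Reg rnode div\<^sub>e Const 2))"

context segment_tree
begin

lemma prefix_prog:
  assumes s: "base s" "tree_ok A s" "A \<subseteq> {..<2 * M}" "regs s rq = r" "r < 2 * M"
  shows "det w prefix_prog s (\<lambda>t s'. t \<le> 5 * L + 10 \<and> mem s' = mem s \<and>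
           same_but {rnode, racc} s s' \<and> regs s' racc = psum A r)"
proof -
  \<comment> \<open>Each level costs 5: two assignments with the step that joins them, and 2 steps
    of the loop.\<close>
  define I where "I n s' \<longleftrightarrow> (\<exists>j \<le> Suc L. n = 5 * (Suc L - j) \<and> regs s' rnode = anc r j \<and>
    regs s' racc = part A r j \<and> mem s' = mem s \<and> same_but {rnode, racc} s s')" for n s'
  have c: "M < 2 ^ w" using word(3) m by auto
  have rN: "r * N \<le> 2 * M * N" using s(5) by simp
  have bd: "part A r j < 2 ^ w" for j
    using part_le[of A r j] psum_less[of A r] rN word(2) by linarith
  have bd2: "anc r j < 4 * M" for j
  proof -
    have "anc r j \<le> 2 * M + r" unfolding anc_def by simp
    then show ?thesis using s(5) by simp
  qed
  let ?b = "racc ::= Reg racc +\<^sub>e (Reg rnode mod\<^sub>e Const 2) *\<^sub>e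
                   Load (Const 4 *\<^sub>e Reg rM +\<^sub>e Reg rnode -\<^sub>e Const 1);;
         rnode ::= Reg rnode div\<^sub>e Const 2"
  have loop: "det w ?b s' (\<lambda>t s''. \<exists>n'. I n' s'' \<and> t + n' + 2 \<le> n)"
    if I: "I n s'" and g: "eval_expr w s' (Const 1 <\<^sub>e Reg rnode) \<noteq> 0" for n s'
  proof -
    from I obtain j where j: "j \<le> Suc L" "n = 5 * (Suc L - j)" "regs s' rnode = anc r j"
      "regs s' racc = part A r j" "mem s' = mem s" and same: "same_but {rnode, racc} s s'"
      unfolding I_def by blast
    have rM: "regs s' rM = M" using same_but_regs[OF same] s(1) by (simp add: base_def)
    have gt: "1 < anc r j" using g by (simp add: eval_binop_exact j(3) split: if_splits)
    with anc_bounds[OF s(5) j(1)] have "j \<noteq> Suc L" by (intro notI) simp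
    then have jl: "Suc j \<le> Suc L" using j(1) by simp
    have mm: "mem s (4 * M + anc r j - 1) = node_sum A (anc r j - 1)"
      using s(2)[unfolded tree_ok_def, rule_format, of "anc r j - 1"] gt bd2[of j] by simp
    have P: "part A r j + anc r j mod 2 * node_sum A (anc r j - 1) = part A r (Suc j)"
      using part_Suc[OF s(5,3) j(1) gt] by simp
    have a1: "anc r j < 2 ^ w" "4 * M + anc r j < 2 ^ w" "4 * M < 2 ^ w"
      using bd2[of j] word(3) by linarith+
    have a2: "anc r j mod 2 * node_sum A (anc r j - 1) < 2 ^ w"
      using P bd[of "Suc j"] by linarith
    have e1: "eval_expr w s' (Reg racc +\<^sub>e (Reg rnode mod\<^sub>e Const 2) *\<^sub>e
                   Load (Const 4 *\<^sub>e Reg rM +\<^sub>e Reg rnode -\<^sub>e Const 1)) = part A r (Suc j)"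
      using c a1 a2 bd[of "Suc j"] gt
      by (simp add: eval_binop_exact j rM mm P del: One_nat_def)
    show ?thesis
      apply (intro det_Seq det_Assign)
      apply (rule exI[where x = "5 * (Suc L - Suc j)"])
      using jl e1 c a1 same
      by (auto simp: I_def eval_binop_exact j anc_Suc same_but_def intro!: exI[where x = "Suc j"])
  qed
  have start: "I (5 * Suc L) (set_reg racc (eval_expr w s0 (Const 0)) s0)"
    if "s0 = set_reg rnode (eval_expr w s (Const 2 *\<^sub>e Reg rM +\<^sub>e Reg rq)) s" for s0
    unfolding I_def that using s word(3) c
    by (intro exI[where x = 0]) (auto simp: eval_binop_exact base_def same_but_def)
  show ?thesis
    unfolding prefix_prog_def
    apply (intro det_Seq det_Assign)
    apply (rule det_mono[OF det_While[where I = I, OF loop start[OF refl]]])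
      apply assumption+
    by (clarsimp simp: I_def not_less part_top[OF s(5)])
qed

end

section \<open>Primes and roots modulo primes\<close>

text \<open>Induction along the Leibniz harmonic triangle,
  \<open>1 / ((n + 1) * (n choose (k + 1))) = 1 / (n * ((n - 1) choose k)) - 1 / ((n + 1) * (n choose k))\<close>.\<close>

lemma binomial_dvd_Lcm:
  "k \<le> n \<Longrightarrow> Suc n * (n choose k) dvd Lcm {1..Suc n}"
proof (induction k arbitrary: n)
  case 0
  then show ?case by (auto intro!: dvd_Lcm)
next
  case (Suc k)
  then obtain n' where n: "n = Suc n'" by (cases n) auto
  \<comment> \<open>The harmonic entries are 1/a, 1/b and 1/c with 1/a = 1/b - 1/c. For \<Lambda> =
    b u = c v this says \<Lambda>/a = u - v, an integer.\<close>
  define a where "a = int (Suc n * (n choose Suc k))"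
  define b where "b = int (n * (n' choose k))"
  define c where "c = int (Suc n * (n choose k))"
  define \<Lambda> where "\<Lambda> = int (Lcm {1..Suc n})"
  have "n * (n' choose k) dvd Lcm {1..n}" using Suc n by simp
  also have "Lcm {1..n} dvd Lcm {1..Suc n}" by (intro Lcm_subset) auto
  finally have "b dvd \<Lambda>" unfolding \<Lambda>_def b_def by (simp only: of_nat_dvd_iff)
  then obtain u where u: "\<Lambda> = b * u" by blast
  have "Suc n * (n choose k) dvd Lcm {1..Suc n}" using Suc by simp
  then have "c dvd \<Lambda>" unfolding \<Lambda>_def c_def by (simp only: of_nat_dvd_iff)
  then obtain v where v: "\<Lambda> = c * v" by blast
  have 1: "int (Suc k) * a = int (Suc n) * b"
    using Suc_times_binomial[of k n'] unfolding a_def b_def n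
    by (simp only: of_nat_mult[symmetric] mult.assoc mult.left_commute[of "Suc k"])
  have 2: "int (n - k) * c = int (Suc k) * a"
    using binomial_absorb_comp[of n k] Suc_times_binomial[of k n'] unfolding a_def c_def n
    by (simp only: of_nat_mult[symmetric] mult.left_commute[of _ "Suc (Suc n')"]) simp
  have "int (Suc k) * \<Lambda> = int (Suc n) * \<Lambda> - int (n - k) * \<Lambda>"
    using Suc.prems by (simp add: of_nat_diff algebra_simps)
  also have "int (Suc n) * \<Lambda> = int (Suc k) * (a * u)"
    unfolding u using 1 by (metis mult.assoc)
  also have "int (n - k) * \<Lambda> = int (Suc k) * (a * v)"
    unfolding v using 2 by (metis mult.assoc)
  also have "int (Suc k) * (a * u) - int (Suc k) * (a * v) = int (Suc k) * (a * (u - v))"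
    by (simp add: algebra_simps)
  finally have "\<Lambda> = a * (u - v)" unfolding mult_cancel_left by simp
  then have "a dvd \<Lambda>" by simp
  then show ?case unfolding a_def \<Lambda>_def by (simp only: of_nat_dvd_iff)
qed

text \<open>The exponent of \<open>p\<close> in an lcm is a maximum of exponents, so the whole power
  already divides one of the numbers 1, ..., n.\<close>

lemma prime_power_dvd_Lcm:
  assumes "prime (p::nat)" "p ^ e dvd Lcm {1..n}" "0 < e"
  shows "p ^ e \<le> n"
  using assms(2)
proof (induction n)
  case 0
  then show ?case using assms(1,3) by (simp add: prime_nat_iff)
next
  case (Suc n)
  have nz: "Lcm {1..n} \<noteq> 0" by (auto simp: Lcm_0_iff)
  have "{1..Suc n} = insert (Suc n) {1..n}" by auto
  then have "p ^ e dvd lcm (Suc n) (Lcm {1..n})" using Suc.prems by simp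
  then have "e \<le> multiplicity p (lcm (Suc n) (Lcm {1..n}))"
    using assms(1) nz by (subst (asm) power_dvd_iff_le_multiplicity) (auto simp: prime_nat_iff)
  also have "\<dots> = max (multiplicity p (Suc n)) (multiplicity p (Lcm {1..n}))"
    using nz assms(1) by (intro multiplicity_lcm) auto
  finally have "p ^ e dvd Suc n \<or> p ^ e dvd Lcm {1..n}"
    using nz by (auto simp: le_max_iff_disj intro: multiplicity_dvd')
  then show ?case using Suc.IH dvd_imp_le[of "p ^ e" "Suc n"] by auto
qed

definition primes_upto :: "nat \<Rightarrow> nat set" where "primes_upto n = {p. prime p \<and> p \<le> n}"

lemma finite_primes_upto [simp]: "finite (primes_upto n)"
  by (simp add: primes_upto_def)

text \<open>In the factorization of the lcm every full prime power is at most \<open>n\<close>, and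
  only primes up to \<open>n\<close> occur.\<close>

lemma Lcm_le_power_primes:
  assumes "n \<noteq> 0"
  shows "Lcm {1..n} \<le> n ^ card (primes_upto n)"
proof -
  define \<Lambda> where "\<Lambda> = Lcm {1..n}"
  have nz: "\<Lambda> \<noteq> 0" unfolding \<Lambda>_def by (auto simp: Lcm_0_iff)
  have mult: "p ^ multiplicity p \<Lambda> \<le> n" if "p \<in> prime_factors \<Lambda>" for p
    using that nz unfolding \<Lambda>_def
    by (intro prime_power_dvd_Lcm multiplicity_dvd) (auto simp: prime_factors_multiplicity)
  have sub: "prime_factors \<Lambda> \<subseteq> primes_upto n"
  proof
    fix p assume p: "p \<in> prime_factors \<Lambda>"
    then have "prime p" "p ^ 1 dvd Lcm {1..n}" by (auto simp: \<Lambda>_def)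
    then show "p \<in> primes_upto n" using prime_power_dvd_Lcm[of p 1 n] by (simp add: primes_upto_def)
  qed
  have "\<Lambda> = (\<Prod>p\<in>prime_factors \<Lambda>. p ^ multiplicity p \<Lambda>)"
    using nz by (rule prime_factorization_nat[OF neq0_conv[THEN iffD1]])
  also have "\<dots> \<le> (\<Prod>p\<in>prime_factors \<Lambda>. n)"
    using mult by (intro prod_mono) auto
  also have "\<dots> \<le> n ^ card (primes_upto n)"
    using assms card_mono[OF _ sub] by (simp add: power_increasing)
  finally show ?thesis unfolding \<Lambda>_def .
qed

lemma two_power_le_power_primes: "2 ^ n \<le> Suc n ^ card (primes_upto (Suc n))"
proof -
  have "\<exists>k \<le> n. 2 ^ n \<le> Suc n * (n choose k)"
  proof (rule ccontr)
    assume *: "\<not> ?thesis"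
    have "Suc n * 2 ^ n = (\<Sum>k\<le>n. Suc n * (n choose k))"
      unfolding choose_row_sum[symmetric] by (simp add: sum_distrib_left)
    also have "\<dots> < (\<Sum>k\<le>n. 2 ^ n)"
      using * by (intro sum_strict_mono) auto
    finally show False by simp
  qed
  then obtain k where k: "k \<le> n" "2 ^ n \<le> Suc n * (n choose k)" by blast
  have "Lcm {1..Suc n} \<noteq> 0" by (auto simp: Lcm_0_iff)
  then have "Suc n * (n choose k) \<le> Lcm {1..Suc n}"
    using binomial_dvd_Lcm[OF k(1)] by (intro dvd_imp_le) (simp_all only: neq0_conv)
  with k(2) Lcm_le_power_primes[of "Suc n"] show ?thesis by linarith
qed

text \<open>For n + 1 = 2^c both sides of the preceding estimate are powers of 2, and comparing
  exponents gives the prime count without logarithms.\<close>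

lemma card_primes_lower_bound:
  assumes "0 < c"
  shows "2 ^ c - 1 \<le> c * card (primes_upto (2 ^ c))"
proof -
  have "(2::nat) ^ (2 ^ c - 1) \<le> (2 ^ c) ^ card (primes_upto (2 ^ c))"
    using two_power_le_power_primes[of "2 ^ c - 1"] by simp
  then show ?thesis unfolding power_mult[symmetric] by (subst (asm) power_increasing_iff) auto
qed

text \<open>Lagrange's theorem for Z/p, phrased with integer polynomials. Synthetic division at a
  root \<open>a\<close> modulo \<open>p\<close> leaves the remainder f(a), a multiple of
  \<open>p\<close>, so the quotient cannot vanish modulo \<open>p\<close> either.\<close>

lemma card_poly_roots_mod:
  fixes f :: "int poly" and p :: nat
  assumes "prime p" "\<not> (\<forall>i. int p dvd coeff f i)"
  shows "card {x. x < p \<and> int p dvd poly f (int x)} \<le> degree f"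
  using assms(2)
proof (induction "degree f" arbitrary: f)
  case 0
  then obtain c where f: "f = [:c:]" by (metis degree_eq_zeroE)
  with 0 have "\<not> int p dvd c"
    by (metis coeff_pCons_0 coeff_pCons_Suc coeff_0 dvd_0_right not0_implies_Suc)
  then show ?case by (simp add: f)
next
  case (Suc n)
  show ?case
  proof (cases "\<exists>a < p. int p dvd poly f (int a)")
    case True
    then obtain a where a: "a < p" "int p dvd poly f (int a)" by blast
    define g where "g = synthetic_div f (int a)"
    have f: "f = [:poly f (int a):] + [:- int a, 1:] * g"
      using synthetic_div_correct'[of "int a" f] by (simp add: g_def add.commute)
    have dg: "n = degree g" using Suc(2) by (simp add: g_def degree_synthetic_div)
    have "\<not> (\<forall>i. int p dvd coeff g i)"
    proof
      assume g: "\<forall>i. int p dvd coeff g i"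
      have "int p dvd coeff f i" for i
        using a(2) g by (subst f, cases i) (auto simp: coeff_pCons intro!: dvd_add dvd_mult dvd_diff)
      with Suc.prems show False by blast
    qed
    from Suc.hyps(1)[OF dg this] have IH: "card {x. x < p \<and> int p dvd poly g (int x)} \<le> n" using dg by simp
    have "{x. x < p \<and> int p dvd poly f (int x)} \<subseteq> insert a {x. x < p \<and> int p dvd poly g (int x)}"
    proof
      fix x assume "x \<in> {x. x < p \<and> int p dvd poly f (int x)}"
      then have x: "x < p" "int p dvd poly f (int x)" by auto
      have "poly f (int x) = poly f (int a) + (int x - int a) * poly g (int x)"
        by (subst f) (simp add: algebra_simps)
      with x(2) a(2) have "int p dvd (int x - int a) * poly g (int x)"
        by (metis dvd_add_right_iff)
      then have "int p dvd int x - int a \<or> int p dvd poly g (int x)"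
        using assms(1) by (simp add: prime_dvd_mult_iff)
      moreover have "x = a" if "int p dvd int x - int a"
      proof (rule ccontr)
        assume "x \<noteq> a"
        with that have "int p \<le> \<bar>int x - int a\<bar>" by (intro zdvd_imp_le) auto
        with x(1) a(1) show False by linarith
      qed
      ultimately show "x \<in> insert a {x. x < p \<and> int p dvd poly g (int x)}" using x(1) by auto
    qed
    then have "card {x. x < p \<and> int p dvd poly f (int x)} \<le> card (insert a {x. x < p \<and> int p dvd poly g (int x)})"
      by (intro card_mono) auto
    also have "\<dots> \<le> Suc (card {x. x < p \<and> int p dvd poly g (int x)})" by (simp add: card_insert_if)
    finally show ?thesis using IH Suc(2) by linarith
  next
    case False
    then have "{x. x < p \<and> int p dvd poly f (int x)} = {}" by auto
    then show ?thesis by (metis card.empty zero_le)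
  qed
qed

lemma poly_mod_cong: "[int x = int y] (mod int q) \<Longrightarrow> [poly f (int x) = poly f (int y)] (mod int q)"
  by (induction f) (auto intro!: cong_add cong_mult)

text \<open>By the Chinese remainder theorem a root modulo the product is determined by its residues
  modulo the factors, which are roots there; so root counts multiply.\<close>

lemma card_poly_roots_mod_prod:
  fixes f :: "int poly" and A :: "nat set"
  assumes "finite A" "\<forall>p \<in> A. prime p" "\<forall>p \<in> A. \<not> (\<forall>i. int p dvd coeff f i)"
  shows "card {x. x < \<Prod>A \<and> int (\<Prod>A) dvd poly f (int x)} \<le> degree f ^ card A"
  using assms
proof (induction A rule: finite_induct)
  case empty
  have "{x::nat. x < 1 \<and> int 1 dvd poly f (int x)} \<subseteq> {0}" by auto
  then have "card {x::nat. x < 1 \<and> int 1 dvd poly f (int x)} \<le> card {0::nat}" by (intro card_mono) auto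
  then show ?case by simp
next
  case (insert p A)
  let ?R = "\<lambda>q. {x. x < q \<and> int q dvd poly f (int x)}"
  define P where "P = \<Prod>A"
  have pos: "0 < p" "0 < P" using insert by (auto simp: P_def prime_gt_0_nat intro!: prod_pos)
  have cop: "coprime p P"
    unfolding P_def using insert by (intro prod_coprime_right) (auto intro: primes_coprime)
  have dvd: "int q dvd poly f (int (x mod q))" if "int q dvd poly f (int x)" for q x
    using poly_mod_cong[of "x mod q" x q f] that
    by (metis cong_def cong_dvd_iff of_nat_mod mod_mod_trivial)
  have "inj_on (\<lambda>x. (x mod p, x mod P)) (?R (p * P))"
  proof (rule inj_onI)
    fix x y assume "x \<in> ?R (p * P)" "y \<in> ?R (p * P)" "(x mod p, x mod P) = (y mod p, y mod P)"
    then have "[x = y] (mod p)" "[x = y] (mod P)" "x < p * P" "y < p * P" by (auto simp: cong_def)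
    then show "x = y"
      using coprime_cong_mult_nat[OF _ _ cop] by (metis cong_less_modulus_unique_nat)
  qed
  moreover have "(\<lambda>x. (x mod p, x mod P)) ` ?R (p * P) \<subseteq> ?R p \<times> ?R P"
    using pos dvd by (auto intro: dvd_mult_left dvd_mult_right)
  ultimately have "card (?R (p * P)) \<le> card (?R p \<times> ?R P)"
    by (intro card_inj_on_le) auto
  also have "\<dots> \<le> degree f * degree f ^ card A"
    unfolding card_cartesian_product using insert
    by (intro mult_le_mono card_poly_roots_mod) (auto simp: P_def)
  finally show ?case using insert by (simp add: P_def)
qed

section \<open>Updating the tree and evaluating hashes\<close>

definition update_prog :: com where
  "update_prog =
     (rz ::= Load (Const 2 *\<^sub>e Reg rM +\<^sub>e Reg rq);;
      rnode ::= Const 2 *\<^sub>e Reg rM +\<^sub>e Reg rq;;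
      While (Const 0 <\<^sub>e Reg rnode)
        (Store (Const 4 *\<^sub>e Reg rM +\<^sub>e Reg rnode)
           (Load (Const 4 *\<^sub>e Reg rM +\<^sub>e Reg rnode) +\<^sub>e Reg rz);;
         rnode ::= Reg rnode div\<^sub>e Const 2))"

context segment_tree
begin

lemma anc_less: "q < 2 * M \<Longrightarrow> anc q j < 4 * M"
proof -
  assume "q < 2 * M"
  moreover have "anc q j \<le> 2 * M + q" unfolding anc_def by simp
  ultimately show ?thesis by linarith
qed

text \<open>Guarantees that an update visits each node once, so that no cell receives
  \<open>h q\<close> twice.\<close>

lemma anc_decreasing: "0 < anc q j \<Longrightarrow> j' < j \<Longrightarrow> anc q j < anc q j'"
proof (induction j)
  case (Suc j)
  then have "0 < anc q j" "anc q (Suc j) < anc q j" by (auto simp: anc_Suc)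
  with Suc show ?case by (cases "j' = j") auto
qed simp

definition table_ok :: "state \<Rightarrow> bool" where
  "table_ok s \<longleftrightarrow> (\<forall>i < 2 * m. mem s (2 * M + i) = h i)"

lemma node_sum_insert:
  assumes "q \<notin> A" "finite A"
  shows "node_sum (insert q A) u = (if \<exists>j. anc q j = u then node_sum A u + h q else node_sum A u)"
proof -
  have "{i \<in> insert q A. \<exists>j. anc i j = u} = (if \<exists>j. anc q j = u then insert q {i \<in> A. \<exists>j. anc i j = u}
     else {i \<in> A. \<exists>j. anc i j = u})" by auto
  then show ?thesis unfolding node_sum_def using assms by auto
qed

lemma node_sum_bound: "A \<subseteq> {..<2 * M} \<Longrightarrow> node_sum A u \<le> 2 * M * N"
proof -
  assume A: "A \<subseteq> {..<2 * M}"
  then have fin: "finite A" using finite_subset by blast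
  have "node_sum A u \<le> (\<Sum>i\<in>A. N)"
    unfolding node_sum_def using fin h_less
    by (intro order_trans[OF sum_mono2 sum_mono]) (auto intro: less_imp_le)
  also have "\<dots> \<le> 2 * M * N" using card_mono[OF _ A] by simp
  finally show ?thesis .
qed

lemma update_prog:
  assumes s: "base s" "table_ok s" "tree_ok A s" "A \<subseteq> {..<2 * m}" "regs s rq = q" "q < 2 * m" "q \<notin> A"
  shows "det w update_prog s (\<lambda>t s'. t \<le> 5 * L + 15 \<and> tree_ok (insert q A) s' \<and>
           (\<forall>a. a < 4 * M \<or> 8 * M \<le> a \<longrightarrow> mem s' a = mem s a) \<and> same_but {rz, rnode} s s')"
proof -
  have q: "q < 2 * M" and A: "A \<subseteq> {..<2 * M}" "insert q A \<subseteq> {..<2 * M}" using s(4,6) m by auto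
  have finA: "finite A" using A(1) finite_subset by blast
  \<comment> \<open>The memory after the lowest \<open>j\<close> nodes on the path from leaf
    \<open>q\<close> have been updated.\<close>
  define up where "up j a = (if \<exists>j' < j. a = 4 * M + anc q j' then mem s a + h q else mem s a)" for j a
  define I where "I n s' \<longleftrightarrow> (\<exists>j \<le> L + 2. n = 5 * (L + 2 - j) \<and> regs s' rnode = anc q j \<and>
    regs s' rz = h q \<and> mem s' = up j \<and> same_but {rz, rnode} s s')" for n s'
  have c: "M < 2 ^ w" using word(3) m by auto
  \<comment> \<open>An update includes the root, unlike a query, and so climbs one level further, to
    the number 0.\<close>
  have top: "anc q (L + 2) = 0" by (rule anc_eq_0[OF q]) simp
  let ?a = "Const 4 *\<^sub>e Reg rM +\<^sub>e Reg rnode"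
  let ?b = "Store ?a (Load ?a +\<^sub>e Reg rz);; rnode ::= Reg rnode div\<^sub>e Const 2"
  have loop: "det w ?b s' (\<lambda>t s''. \<exists>n'. I n' s'' \<and> t + n' + 2 \<le> n)"
    if I: "I n s'" and g: "eval_expr w s' (Const 0 <\<^sub>e Reg rnode) \<noteq> 0" for n s'
  proof -
    from I obtain j where j: "j \<le> L + 2" "n = 5 * (L + 2 - j)" "regs s' rnode = anc q j"
      "regs s' rz = h q" "mem s' = up j" and same: "same_but {rz, rnode} s s'"
      unfolding I_def by blast
    have rM: "regs s' rM = M" using same_but_regs[OF same] s(1) by (simp add: base_def)
    have gt: "0 < anc q j" using g by (simp add: j(3) split: if_splits)
    then have jl: "Suc j \<le> L + 2" using top j(1) by (cases "j = L + 2") auto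
    have a1: "4 * M + anc q j < 2 ^ w" "4 * M < 2 ^ w" "anc q j < 2 ^ w"
      using anc_less[OF q, of j] word(3) by linarith+
    have ne: "\<not> (\<exists>j' < j. anc q j = anc q j')"
      using anc_decreasing[OF gt] by fastforce
    have mem: "mem s (4 * M + anc q j) = node_sum A (anc q j)"
      using s(3) gt anc_less[OF q, of j] by (simp add: tree_ok_def)
    have old: "up j (4 * M + anc q j) = node_sum A (anc q j)"
      using ne mem by (auto simp: up_def)
    have "node_sum A (anc q j) + h q < 2 ^ w"
    proof -
      have "node_sum A (anc q j) + h q = node_sum (insert q A) (anc q j)"
        using node_sum_insert[OF s(7) finA] by auto
      also have "\<dots> \<le> 2 * M * N" by (rule node_sum_bound[OF A(2)])
      also have "\<dots> < 2 ^ w" using word(2) by linarith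
      finally show ?thesis .
    qed
    then have e: "eval_expr w s' ?a = 4 * M + anc q j"
      "eval_expr w s' (Load ?a +\<^sub>e Reg rz) = node_sum A (anc q j) + h q"
      using a1 by (simp_all add: eval_binop_exact rM j old)
    have new: "(up j)(4 * M + anc q j := node_sum A (anc q j) + h q) = up (Suc j)"
      using ne mem unfolding up_def by (auto simp: fun_eq_iff less_Suc_eq)
    show ?thesis
      apply (intro det_Seq det_Store det_Assign)
      apply (rule exI[where x = "5 * (L + 2 - Suc j)"])
      unfolding e using jl a1 same new
      by (auto simp: I_def eval_binop_exact j anc_Suc same_but_def intro!: exI[where x = "Suc j"])
  qed
  have start: "I (5 * (L + 2)) (set_reg rnode (eval_expr w s0 (Const 2 *\<^sub>e Reg rM +\<^sub>e Reg rq)) s0)"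
    if "s0 = set_reg rz (eval_expr w s (Load (Const 2 *\<^sub>e Reg rM +\<^sub>e Reg rq))) s" for s0
    unfolding I_def that using s q word(3) c
    by (intro exI[where x = 0]) (auto simp: eval_binop_exact base_def same_but_def table_ok_def up_def)
  have fin: "tree_ok (insert q A) s' \<and> (\<forall>a. a < 4 * M \<or> 8 * M \<le> a \<longrightarrow> mem s' a = mem s a)"
    if mem: "mem s' = up j" and j: "anc q j = 0" for s' j
  proof (intro conjI allI impI)
    show "tree_ok (insert q A) s'"
      unfolding tree_ok_def mem
    proof (intro allI impI)
      fix u assume u: "1 \<le> u" "u < 4 * M"
      have "j' < j" if "anc q j' = u" for j'
      proof (rule ccontr)
        assume "\<not> j' < j"
        then have "anc q j' \<le> anc q j"
          unfolding anc_def by (intro div_le_mono2 power_increasing) auto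
        then show False using that u j by simp
      qed
      then have "(\<exists>j'<j. 4 * M + u = 4 * M + anc q j') \<longleftrightarrow> (\<exists>j'. anc q j' = u)" by auto
      then show "up j (4 * M + u) = node_sum (insert q A) u"
        using node_sum_insert[OF s(7) finA] s(3) u unfolding up_def tree_ok_def by simp
    qed
    fix a assume "a < 4 * M \<or> 8 * M \<le> a"
    moreover have "4 * M + anc q j' < 8 * M" for j' using anc_less[OF q, of j'] by simp
    ultimately have "a \<noteq> 4 * M + anc q j'" for j'
      by (metis le_add1 not_less)
    then show "mem s' a = mem s a" unfolding mem up_def by auto
  qed
  show ?thesis
    unfolding update_prog_def
    apply (intro det_Seq det_Assign)
    apply (rule det_mono[OF det_While[where I = I, OF loop start[OF refl]]])
      apply assumption+
    using fin by (fastforce simp: I_def)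
qed

text \<open>Two periods of the set are stored, so that the translated interval never wraps around.\<close>

definition ext :: "nat set \<Rightarrow> nat set" where
  "ext S = {i. i < 2 * m \<and> i mod m \<in> S}"

lemma ext_subset: "ext S \<subseteq> {..<2 * m}" "ext S \<subseteq> {..<2 * M}"
  using m by (auto simp: ext_def)

lemma ext_insert: "y < m \<Longrightarrow> ext (insert y S) = insert (y + m) (insert y (ext S))"
proof -
  assume y: "y < m"
  have "i mod m = y \<longleftrightarrow> i = y \<or> i = y + m" if "i < 2 * m" for i
  proof (cases "i < m")
    case False
    then have "i mod m = i - m" using that by (simp add: mod_if)
    then show ?thesis using False y by auto
  qed (use y in auto)
  then show ?thesis unfolding ext_def using y by auto
qed

definition set_ok :: "nat set \<Rightarrow> state \<Rightarrow> bool" where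
  "set_ok S s \<longleftrightarrow> S \<subseteq> {..<m} \<and> (\<forall>i < m. mem s i = of_bool (i \<in> S)) \<and> tree_ok (ext S) s"

end

definition insert_prog :: com where
  "insert_prog =
     (Store (Reg ry) (Const 1);; rq ::= Reg ry;; update_prog;;
      rq ::= Reg ry +\<^sub>e Reg rm;; update_prog)"

context segment_tree
begin

lemma insert_prog:
  assumes s: "base s" "table_ok s" "set_ok S s" "regs s ry = y" "y < m" "y \<notin> S"
  shows "det w insert_prog s (\<lambda>t s'. t \<le> 10 * L + 40 \<and> set_ok (insert y S) s' \<and>
     (\<forall>a. M \<le> a \<and> a < 4 * M \<or> 8 * M \<le> a \<longrightarrow> mem s' a = mem s a) \<and> same_but {rz, rnode, rq} s s')"
proof -
  have c: "M < 2 ^ w" using word(3) m by auto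
  define s1 where "s1 = set_reg rq y (s\<lparr>mem := (mem s)(y := 1)\<rparr>)"
  have s1: "base s1" "table_ok s1" "tree_ok (ext S) s1" "regs s1 rq = y" "same_but {rq} s s1"
    using s m by (auto simp: s1_def base_def table_ok_def set_ok_def tree_ok_def same_but_def)
  have yS: "y \<notin> ext S" "y + m \<notin> insert y (ext S)" using s m by (auto simp: ext_def)
  have y2: "y < 2 * m" "y + m < 2 * m" using s by auto
  show ?thesis
    unfolding insert_prog_def
    apply (intro det_Seq det_Store det_Assign)
    apply (subgoal_tac "eval_expr w (s\<lparr>mem := (mem s)(eval_expr w s (Reg ry) := eval_expr w s (Const 1))\<rparr>) (Reg ry) = y")
     prefer 2 subgoal by (simp add: s)
    apply (simp only:)
    apply (subgoal_tac "eval_expr w s (Reg ry) = y \<and> eval_expr w s (Const 1) = 1")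
     prefer 2 subgoal by (simp add: s)
    apply (simp only: s1_def[symmetric])
    apply (rule det_mono[OF update_prog[OF s1(1-3) ext_subset(1) s1(4) y2(1) yS(1)]])
    apply (elim conjE)
  proof (intro det_Seq det_Assign)
    fix t s2
    assume s2: "t \<le> 5 * L + 15" "tree_ok (insert y (ext S)) s2"
      "\<forall>a. a < 4 * M \<or> 8 * M \<le> a \<longrightarrow> mem s2 a = mem s1 a" "same_but {rz, rnode} s1 s2"
    have e: "eval_expr w s2 (Reg ry +\<^sub>e Reg rm) = y + m"
      using same_but_regs[OF s2(4)] s y2 m word(3) by (simp add: eval_binop_exact s1_def base_def)
    define s3 where "s3 = set_reg rq (y + m) s2"
    have s3: "base s3" "table_ok s3" "tree_ok (insert y (ext S)) s3" "regs s3 rq = y + m"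
      "same_but {rz, rnode, rq} s s3"
      using same_but_regs[OF s2(4)] s2 s1(1,2,5) m
      by (auto simp: s3_def base_def table_ok_def tree_ok_def same_but_def)
    have sub: "insert y (ext S) \<subseteq> {..<2 * m}" using ext_subset y2 by auto
    show "det w update_prog (set_reg rq (eval_expr w s2 (Reg ry +\<^sub>e Reg rm)) s2)
        (\<lambda>ta s'. 1 + (1 + (t + (1 + ta + 1) + 1) + 1) + 1 \<le> 10 * L + 40 \<and> set_ok (insert y S) s' \<and>
     (\<forall>a. M \<le> a \<and> a < 4 * M \<or> 8 * M \<le> a \<longrightarrow> mem s' a = mem s a) \<and> same_but {rz, rnode, rq} s s')"
      unfolding e s3_def[symmetric]
    proof (rule det_mono[OF update_prog[OF s3(1-3) sub s3(4) y2(2) yS(2)]], elim conjE, intro conjI)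
      fix t' s4 assume s4: "t' \<le> 5 * L + 15" "tree_ok (insert (y + m) (insert y (ext S))) s4"
        "\<forall>a. a < 4 * M \<or> 8 * M \<le> a \<longrightarrow> mem s4 a = mem s3 a" "same_but {rz, rnode} s3 s4"
      have mem: "mem s4 a = (if a = y then 1 else mem s a)" if "a < 4 * M \<or> 8 * M \<le> a" for a
        using s4(3)[rule_format, OF that] s2(3)[rule_format, OF that] by (simp add: s3_def s1_def)
      show "set_ok (insert y S) s4"
        using s4(2) s m mem by (auto simp: set_ok_def ext_insert)
      show "\<forall>a. M \<le> a \<and> a < 4 * M \<or> 8 * M \<le> a \<longrightarrow> mem s4 a = mem s a"
        using mem s m by auto
      show "same_but {rz, rnode, rq} s s4"
        by (rule same_but_trans[OF s3(5) s4(4)]) auto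
    qed (use s2 in auto)
  qed
qed

text \<open>Up to an additive constant that depends on \<open>S\<close> and \<open>x\<close> only,
  this is the hash of the difference between \<open>S\<close> and its translate on [0, r). Equal
  values at a and c thus compare the two on [a, c), since the constant cancels. Multiplying by b^x
  instead of dividing works for every \<open>b\<close>, also one sharing a factor with
  \<open>N\<close>; adding \<open>N\<close> before the subtraction keeps the value
  nonnegative.\<close>

definition E :: "nat set \<Rightarrow> nat \<Rightarrow> nat \<Rightarrow> nat" where
  "E S x r = (h x * (psum (ext S) r mod N) + (N - psum (ext S) (r + x) mod N)) mod N"

end

definition eval_prog :: com where
  "eval_prog =
     (prefix_prog;; re ::= Reg rhx *\<^sub>e (Reg racc mod\<^sub>e Reg rN);;
      rq ::= Reg rq +\<^sub>e Reg rx;; prefix_prog;;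
      re ::= (Reg re +\<^sub>e (Reg rN -\<^sub>e Reg racc mod\<^sub>e Reg rN)) mod\<^sub>e Reg rN)"

context segment_tree
begin

lemma eval_prog:
  assumes s: "base s" "set_ok S s" "regs s rq = r" "r \<le> m" "regs s rx = x" "x < m" "regs s rhx = h x"
  shows "det w eval_prog s (\<lambda>t s'. t \<le> 10 * L + 30 \<and> mem s' = mem s \<and>
     same_but {rnode, racc, rq, re} s s' \<and> regs s' re = E S x r)"
proof -
  have t: "tree_ok (ext S) s" using s by (simp add: set_ok_def)
  have r: "r < 2 * M" "r + x < 2 * M" using s m by auto
  have pb: "psum (ext S) q < 2 ^ w" if "q < 2 * M" for q
  proof -
    have "q * N \<le> 2 * M * N" using that by simp
    with psum_less[of "ext S" q] word(2) show ?thesis by linarith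
  qed
  \<comment> \<open>Before the final reduction the value is at most (N - 1)^2 + N \<le> N^2, so it
    fits into a word by the assumption on \<open>N * N\<close>.\<close>
  have hb: "h x * (a mod N) + N \<le> N * N" for a
  proof -
    have "h x \<le> N - 1" "a mod N \<le> N - 1" using h_less[of x] mod_less_divisor[OF N, of a] by linarith+
    then have "h x * (a mod N) \<le> (N - 1) * (N - 1)" by (rule mult_le_mono)
    moreover obtain N' where "N = Suc N'" using N by (cases N) auto
    ultimately show ?thesis by (simp add: algebra_simps)
  qed
  show ?thesis
    unfolding eval_prog_def
    apply (rule det_Seq_post[OF prefix_prog[OF s(1) t ext_subset(2) s(3) r(1)]])
    subgoal premises s1 for t1 s1
    proof -
      note s1_regs = same_but_regs[OF s1[THEN conjunct2, THEN conjunct2, THEN conjunct1]]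
      define s2 where "s2 = set_reg rq (r + x) (set_reg re (h x * (psum (ext S) r mod N)) s1)"
      have e: "eval_expr w s1 (Reg rhx *\<^sub>e (Reg racc mod\<^sub>e Reg rN)) = h x * (psum (ext S) r mod N)"
        using s1 s1_regs s pb[OF r(1)] hb[of "psum (ext S) r"] word(1)
        by (simp add: eval_binop_exact base_def)
      have e2: "eval_expr w (set_reg re (h x * (psum (ext S) r mod N)) s1) (Reg rq +\<^sub>e Reg rx) = r + x"
        using s1_regs s r word(3) by (simp add: eval_binop_exact)
      have s2: "base s2" "tree_ok (ext S) s2" "regs s2 rq = r + x"
        using s1 s1_regs s(1) t by (simp_all add: s2_def base_def tree_ok_def)
      show ?thesis
        apply (intro det_Seq det_Assign)
        unfolding e e2 s2_def[symmetric]
        apply (rule det_mono[OF prefix_prog[OF s2(1,2) ext_subset(2) s2(3) r(2)]])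
        subgoal premises s3 for t3 s3
        proof -
          note s3_regs = same_but_regs[OF s3[THEN conjunct2, THEN conjunct2, THEN conjunct1]]
          have "h x * (psum (ext S) r mod N) + (N - psum (ext S) (r + x) mod N) < 2 ^ w"
            using hb[of "psum (ext S) r"] word(1) by linarith
          then have e3: "eval_expr w s3 ((Reg re +\<^sub>e (Reg rN -\<^sub>e Reg racc mod\<^sub>e Reg rN)) mod\<^sub>e Reg rN) = E S x r"
            using s3 s3_regs s1_regs s(1) pb[OF r(2)] Nw N
            by (simp add: eval_binop_exact s2_def base_def E_def less_imp_le)
          have "same_but {rnode, racc, rq, re} s s3"
            using s1 s3 unfolding s2_def by (simp add: same_but_def)
          with s1 s3 show ?thesis
            apply (intro det_Assign)
            unfolding e3 by (simp add: s2_def same_but_def)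
        qed
        done
    qed
    done
qed

end

section \<open>Comparing shifted sets by hashes\<close>

context segment_tree
begin

definition dead_ok :: "nat set \<Rightarrow> state \<Rightarrow> bool" where
  "dead_ok D s \<longleftrightarrow> D \<subseteq> {..<m} \<and> (\<forall>x < m. mem s (M + x) = of_bool (x \<in> D))"

definition inv :: "nat set \<Rightarrow> nat set \<Rightarrow> state \<Rightarrow> bool" where
  "inv S D s \<longleftrightarrow> base s \<and> table_ok s \<and> set_ok S s \<and> dead_ok D s"

lemma set_ok_cong: "set_ok S s \<Longrightarrow> (\<And>a. a < 8 * M \<Longrightarrow> mem s' a = mem s a) \<Longrightarrow> set_ok S s'"
  using m by (auto simp: set_ok_def tree_ok_def)

lemma inv_cong:
  assumes "inv S D s" "\<And>a. a < 8 * M \<Longrightarrow> mem s' a = mem s a" "same_but A s s'" "A \<inter> {rm, rM, rN} = {}"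
  shows "inv S D s'"
  unfolding inv_def
proof (intro conjI)
  show "set_ok S s'" using assms(1,2) unfolding inv_def by (blast intro: set_ok_cong)
qed (use assms same_but_regs[OF assms(3)] m in \<open>auto simp: inv_def base_def table_ok_def dead_ok_def\<close>)

definition shift :: "nat \<Rightarrow> nat \<Rightarrow> nat" where "shift x i = (i + x) mod m"

definition diff :: "nat set \<Rightarrow> nat \<Rightarrow> nat \<Rightarrow> bool" where
  "diff S x i \<longleftrightarrow> (i \<in> S) \<noteq> (shift x i \<in> S)"

lemma shift_less: "shift x i < m"
  using m by (simp add: shift_def)

lemma inj_shift: "inj_on (shift x) {..<m}"
proof (rule inj_onI)
  fix i j assume "i \<in> {..<m}" "j \<in> {..<m}" "shift x i = shift x j"
  then have "[i + x = j + x] (mod m)" "i < m" "j < m" by (auto simp: shift_def cong_def)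
  then show "i = j" by (metis cong_add_rcancel_nat cong_def mod_less)
qed

lemma psum_split: "psum (ext S) (r + x) = psum (ext S) x + (\<Sum>i<r. of_bool (i + x \<in> ext S) * h (i + x))"
proof -
  have "psum A r' = (\<Sum>i<r'. of_bool (i \<in> A) * h i)" for A r'
    unfolding psum_def by (intro sum.mono_neutral_cong_left) auto
  then show ?thesis
    by (induction r) (simp_all add: add.commute del: sum_of_bool_mult_eq)
qed

lemma int_h: "[int (h i) = int b ^ i] (mod int N)"
  by (simp add: h_def cong_def zmod_int of_nat_mod)

lemma E_cong:
  assumes "r \<le> m" "x < m"
  shows "[int (E S x r) = (\<Sum>i<r. (of_bool (i \<in> S) - of_bool (shift x i \<in> S)) * int b ^ (i + x))
            - int (psum (ext S) x)] (mod int N)"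
proof -
  have mem1: "i \<in> ext S \<longleftrightarrow> i \<in> S" if "i < r" for i
    using that assms by (simp add: ext_def)
  \<comment> \<open>Here \<open>i + x < 2 * m\<close>, so a position that would wrap around is found
    in the second period.\<close>
  have mem2: "i + x \<in> ext S \<longleftrightarrow> shift x i \<in> S" if "i < r" for i
    using that assms by (simp add: ext_def shift_def)
  have p1: "psum (ext S) r = (\<Sum>i<r. of_bool (i \<in> S) * h i)"
  proof -
    have "psum (ext S) r = (\<Sum>i<r. of_bool (i \<in> ext S) * h i)"
      using psum_split[of S r 0] by (simp add: psum_def del: sum_of_bool_mult_eq)
    also have "\<dots> = (\<Sum>i<r. of_bool (i \<in> S) * h i)" using mem1 by (intro sum.cong) auto
    finally show ?thesis .
  qed
  have p2: "psum (ext S) (r + x) = psum (ext S) x + (\<Sum>i<r. of_bool (shift x i \<in> S) * h (i + x))"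
    unfolding psum_split using mem2 by (intro arg_cong2[of _ _ _ _ "(+)"] sum.cong) auto
  have less: "psum (ext S) (r + x) mod N \<le> N" using N by (simp add: less_imp_le)
  have "[int (E S x r) = int (h x) * int (psum (ext S) r) - int (psum (ext S) (r + x))] (mod int N)"
  proof -
    have "(u * (p mod n) + (n - q mod n)) mod n = (u * p - q) mod n" for u p q n :: int
    proof -
      have "u * (p mod n) + (n - q mod n) = (u * p - q) + n * (1 + q div n - u * (p div n))"
        by (simp add: algebra_simps flip: minus_mult_div_eq_mod)
      then show ?thesis by simp
    qed
    moreover have "int (N - psum (ext S) (r + x) mod N) = int N - int (psum (ext S) (r + x)) mod int N"
      using less by (simp add: of_nat_diff zmod_int)
    ultimately show ?thesis
      unfolding E_def cong_def by (simp add: zmod_int del: of_nat_diff)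
  qed
  also have "[int (h x) * int (psum (ext S) r) - int (psum (ext S) (r + x)) =
    int b ^ x * (\<Sum>i<r. of_bool (i \<in> S) * int b ^ i) -
    (int (psum (ext S) x) + (\<Sum>i<r. of_bool (shift x i \<in> S) * int b ^ (i + x)))] (mod int N)"
    unfolding p1 p2 of_nat_add of_nat_sum of_nat_mult of_nat_of_bool
    by (intro cong_diff cong_mult cong_add cong_sum cong_refl int_h)
  also have "int b ^ x * (\<Sum>i<r. of_bool (i \<in> S) * int b ^ i) -
    (int (psum (ext S) x) + (\<Sum>i<r. of_bool (shift x i \<in> S) * int b ^ (i + x))) =
    (\<Sum>i<r. (of_bool (i \<in> S) - of_bool (shift x i \<in> S)) * int b ^ (i + x)) - int (psum (ext S) x)"
    by (simp add: sum_distrib_left sum_subtractf algebra_simps power_add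
        del: sum_of_bool_mult_eq sum_mult_of_bool_eq)
  finally show ?thesis .
qed

lemma E_eq_iff:
  assumes "a \<le> c" "c \<le> m" "x < m"
  shows "E S x a = E S x c \<longleftrightarrow>
    int N dvd (\<Sum>i\<in>{a..<c}. (of_bool (i \<in> S) - of_bool (shift x i \<in> S)) * int b ^ (i + x))"
proof -
  let ?f = "\<lambda>i. (of_bool (i \<in> S) - of_bool (shift x i \<in> S)) * int b ^ (i + x)"
  have "E S x a = E S x c \<longleftrightarrow> [int (E S x a) = int (E S x c)] (mod int N)"
  proof -
    have "E S x r < N" for r using N by (simp add: E_def)
    then show ?thesis by (simp add: cong_int_iff) (simp add: cong_def)
  qed
  also have "\<dots> \<longleftrightarrow> [sum ?f {..<a} - int (psum (ext S) x) = sum ?f {..<c} - int (psum (ext S) x)] (mod int N)"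
    using E_cong[of a x S] E_cong[of c x S] assms by (simp add: cong_def)
  also have "sum ?f {..<c} = sum ?f {..<a} + sum ?f {a..<c}"
    using sum.atLeastLessThan_concat[of 0 a c ?f] assms(1) by (simp only: lessThan_atLeast0)
  finally show ?thesis
    by (simp add: cong_iff_dvd_diff)
qed

text \<open>Absence of collisions. The converse implication, \<open>E_agree\<close>, holds for every
  base, so this direction alone depends on chance.\<close>

definition good :: "nat set \<Rightarrow> nat \<Rightarrow> bool" where
  "good S x \<longleftrightarrow> (\<forall>a c. a \<le> c \<longrightarrow> c \<le> m \<longrightarrow> E S x a = E S x c \<longrightarrow> (\<forall>i. a \<le> i \<longrightarrow> i < c \<longrightarrow> \<not> diff S x i))"

lemma E_agree:
  assumes "a \<le> c" "c \<le> m" "x < m" "\<And>i. a \<le> i \<Longrightarrow> i < c \<Longrightarrow> \<not> diff S x i"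
  shows "E S x a = E S x c"
proof -
  have "(\<Sum>i\<in>{a..<c}. (of_bool (i \<in> S) - of_bool (shift x i \<in> S)) * int b ^ (i + x)) = 0"
    using assms(4) by (intro sum.neutral) (auto simp: diff_def)
  then show ?thesis unfolding E_eq_iff[OF assms(1-3)] by simp
qed

end

definition search_prog :: com where
  "search_prog =
     (rlo ::= Reg rpos;; rhi ::= Reg rm;;
      While (Const 1 <\<^sub>e Reg rhi -\<^sub>e Reg rlo)
        (rq ::= (Reg rlo +\<^sub>e Reg rhi) div\<^sub>e Const 2;; eval_prog;;
         Cond (Reg re =\<^sub>e Reg rEa)
           (rlo ::= (Reg rlo +\<^sub>e Reg rhi) div\<^sub>e Const 2)
           (rhi ::= (Reg rlo +\<^sub>e Reg rhi) div\<^sub>e Const 2)))"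

context segment_tree
begin

text \<open>Bisection keeps the value of \<open>E\<close> at \<open>pos\<close> on the left end and
  a different value on the right end. It therefore ends at neighbouring positions whatever the base
  is; under \<open>good\<close> the left one is the first difference.\<close>

lemma search_prog:
  assumes s: "base s" "set_ok S s" "regs s rx = x" "x < m" "regs s rhx = h x" "regs s rpos = pos" "pos < m"
    "regs s rEa = E S x pos" "E S x pos \<noteq> E S x m"
  shows "det w search_prog s (\<lambda>t s'. t \<le> L * (10 * L + 40) + 10 \<and> mem s' = mem s \<and>
     same_but {rnode, racc, rq, re, rlo, rhi} s s' \<and>
     (\<exists>lo. pos \<le> lo \<and> lo < m \<and> regs s' rlo = lo \<and> regs s' rhi = Suc lo \<and>
        E S x lo = E S x pos \<and> E S x (Suc lo) \<noteq> E S x pos))"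
proof -
  define I where "I n s' \<longleftrightarrow> (\<exists>lo hi k. k \<le> L \<and> n = k * (10 * L + 40) \<and> hi - lo \<le> 2 ^ k \<and>
      pos \<le> lo \<and> lo < hi \<and> hi \<le> m \<and> E S x lo = E S x pos \<and> E S x hi \<noteq> E S x pos \<and>
      regs s' rlo = lo \<and> regs s' rhi = hi \<and> mem s' = mem s \<and>
      same_but {rnode, racc, rq, re, rlo, rhi} s s')" for n s'
  let ?mid = "(Reg rlo +\<^sub>e Reg rhi) div\<^sub>e Const 2"
  let ?b = "rq ::= ?mid;; eval_prog;; Cond (Reg re =\<^sub>e Reg rEa) (rlo ::= ?mid) (rhi ::= ?mid)"
  have loop: "det w ?b s' (\<lambda>t s''. \<exists>n'. I n' s'' \<and> t + n' + 2 \<le> n)"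
    if I: "I n s'" and g: "eval_expr w s' (Const 1 <\<^sub>e Reg rhi -\<^sub>e Reg rlo) \<noteq> 0" for n s'
  proof -
    from I obtain lo hi k where k: "k \<le> L" "n = k * (10 * L + 40)" "hi - lo \<le> 2 ^ k"
      "pos \<le> lo" "lo < hi" "hi \<le> m" "E S x lo = E S x pos" "E S x hi \<noteq> E S x pos"
      and r: "regs s' rlo = lo" "regs s' rhi = hi" "mem s' = mem s"
      and same: "same_but {rnode, racc, rq, re, rlo, rhi} s s'"
      unfolding I_def by blast
    have gt: "1 < hi - lo"
      using g k m word(3) by (simp add: r eval_binop_exact split: if_splits)
    define mid where "mid = (lo + hi) div 2"
    have mid: "lo < mid" "mid < hi" using gt by (auto simp: mid_def)
    obtain k' where k': "k = Suc k'" using gt k(3) by (cases k) auto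
    have half: "mid - lo \<le> 2 ^ k'" "hi - mid \<le> 2 ^ k'"
      using k(3) k' unfolding mid_def by auto
    have ev: "eval_expr w u ?mid = mid" if "regs u rlo = lo" "regs u rhi = hi" for u
      using that k m word(3) by (simp add: eval_binop_exact mid_def)
    define s1 where "s1 = set_reg rq mid s'"
    have s1: "base s1" "set_ok S s1" "regs s1 rq = mid" "regs s1 rx = x" "regs s1 rhx = h x"
      "regs s1 rEa = E S x pos"
      using same_but_regs[OF same] s r(3) by (auto simp: s1_def base_def set_ok_def tree_ok_def)
    have mm: "mid \<le> m" using mid k by simp
    show ?thesis
      apply (intro det_Seq det_Assign)
      unfolding ev[OF r(1,2)] s1_def[symmetric]
      apply (rule det_mono[OF eval_prog[OF s1(1-3) mm s1(4) s(4) s1(5)]])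
      subgoal premises s2 for t2 s2
      proof -
        note s2r = same_but_regs[OF s2[THEN conjunct2, THEN conjunct2, THEN conjunct1]]
        have r2: "regs s2 rlo = lo" "regs s2 rhi = hi" "regs s2 rEa = E S x pos" "mem s2 = mem s"
          "same_but {rnode, racc, rq, re, rlo, rhi} s s2"
          using s2 s2r s1(6) r same unfolding s1_def by (auto simp: same_but_def)
        show ?thesis
          apply (intro det_Cond det_Assign)
          subgoal
            unfolding I_def ev[OF r2(1,2)]
            apply (rule exI[where x = "k' * (10 * L + 40)"], rule conjI,
                rule exI[where x = mid], rule exI[where x = hi], rule exI[where x = k'])
            using s2 r2 k k' mid half mm by (simp_all add: same_but_def)
          subgoal
            unfolding I_def ev[OF r2(1,2)]
            apply (rule exI[where x = "k' * (10 * L + 40)"], rule conjI,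
                rule exI[where x = lo], rule exI[where x = mid], rule exI[where x = k'])
            using s2 r2 k k' mid half mm by (simp_all add: same_but_def)
          done
      qed
      done
  qed
  have mL: "m - pos \<le> 2 ^ L" using m(2) unfolding M by simp
  have start: "I (L * (10 * L + 40)) (set_reg rhi (eval_expr w s0 (Reg rm)) s0)"
    if "s0 = set_reg rlo (eval_expr w s (Reg rpos)) s" for s0
    unfolding I_def that
    apply (rule exI[where x = pos], rule exI[where x = m], rule exI[where x = L])
    using s mL not_sym[OF s(9)] by (simp add: base_def same_but_def)
  show ?thesis
    unfolding search_prog_def
    apply (intro det_Seq det_Assign)
    apply (rule det_mono[OF det_While[where I = I, OF loop start[OF refl]]])
      apply assumption+
    subgoal premises p for t s'
    proof -
      from p obtain n where p1: "I n s'" "eval_expr w s' (Const 1 <\<^sub>e Reg rhi -\<^sub>e Reg rlo) = 0"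
        "t + n \<le> L * (10 * L + 40) + 1" by blast
      from p1(1) obtain lo hi where *: "pos \<le> lo" "lo < hi" "hi \<le> m" "E S x lo = E S x pos" "E S x hi \<noteq> E S x pos"
        "regs s' rlo = lo" "regs s' rhi = hi" and **: "mem s' = mem s" "same_but {rnode, racc, rq, re, rlo, rhi} s s'"
        unfolding I_def by blast
      have "hi = Suc lo" using p1(2) * m word(3) by (simp add: eval_binop_exact split: if_splits)
      with * ** p1 show ?thesis by auto
    qed
    done
qed

end

section \<open>Adding one item\<close>

text \<open>In a run with hash collisions the number of differences found need not be related to the number
  of new sums; the counter \<open>rfuel\<close>, initially \<open>2 * m\<close>, enforces the time bound in that case. It never
  runs out in a run without collisions.\<close>

definition find_cond :: expr where
  "find_cond = ((Reg rEa =\<^sub>e Reg rEm) <\<^sub>e Const 1) *\<^sub>e (Const 0 <\<^sub>e Reg rfuel)"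

text \<open>The candidate is always written on top of the stack, but the stack grows only if
  \<open>lo\<close> is in the set and its translate is not; a difference of the opposite kind merely
  uses fuel. Insertion is deferred to the end of the round, because the scan compares the old set
  with its translate and the item must not be used twice.\<close>

definition find_body :: com where
  "find_body =
     (search_prog;;
      ry ::= (Reg rlo +\<^sub>e Reg rx) mod\<^sub>e Reg rm;;
      Store (Const 8 *\<^sub>e Reg rM +\<^sub>e Reg rsp) (Reg ry);;
      rsp ::= Reg rsp +\<^sub>e Load (Reg rlo) *\<^sub>e (Const 1 -\<^sub>e Load (Reg ry));;
      rpos ::= Reg rhi;; rq ::= Reg rhi;; eval_prog;; rEa ::= Reg re;;
      rfuel ::= Reg rfuel -\<^sub>e Const 1;; rany ::= Const 1)"

definition pop_body :: com where
  "pop_body = (rsp ::= Reg rsp -\<^sub>e Const 1;; ry ::= Load (Const 8 *\<^sub>e Reg rM +\<^sub>e Reg rsp);; insert_prog)"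

definition round_prog :: com where
  "round_prog =
     (rhx ::= Load (Const 2 *\<^sub>e Reg rM +\<^sub>e Reg rx);;
      rq ::= Reg rm;; eval_prog;; rEm ::= Reg re;;
      rpos ::= Const 0;; rq ::= Const 0;; eval_prog;; rEa ::= Reg re;;
      rsp ::= Const 0;; rany ::= Const 0;;
      While find_cond find_body;;
      Store (Reg rM +\<^sub>e Reg rx) (Reg rany =\<^sub>e Const 0);;
      While (Const 0 <\<^sub>e Reg rsp) pop_body)"

context segment_tree
begin

text \<open>Apart from the final implication everything holds for every base, collisions included.
  The bound on \<open>length ys\<close> lets spent fuel pay for insertions, and the origin of the
  entries from positions before \<open>rpos\<close> keeps them distinct, as \<open>shift x\<close>
  is injective. The final implication identifies the stack with the new sums found so far and the
  spent fuel with the differences passed.\<close>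

definition find_inv :: "nat set \<Rightarrow> nat set \<Rightarrow> nat \<Rightarrow> nat list \<Rightarrow> nat \<Rightarrow> nat list \<Rightarrow> state \<Rightarrow> bool" where
  "find_inv S D x tp F ys s \<longleftrightarrow> inv S D s \<and> tape s = tp \<and> regs s rx = x \<and> regs s rhx = h x \<and>
     regs s rpos \<le> m \<and> regs s rEa = E S x (regs s rpos) \<and> regs s rEm = E S x m \<and>
     regs s rsp = length ys \<and> regs s rfuel < 2 ^ w \<and> length ys + regs s rfuel \<le> F \<and>
     regs s rany = of_bool (regs s rfuel < F) \<and> distinct ys \<and> set ys \<subseteq> {..<m} - S \<and>
     set ys \<subseteq> shift x ` {..<regs s rpos} \<and> (\<forall>i < length ys. mem s (8 * M + i) = ys ! i) \<and>
     (good S x \<longrightarrow> set ys = shift x ` {i. i < regs s rpos \<and> i \<in> S} - S \<and>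
        F = regs s rfuel + card {i. i < regs s rpos \<and> diff S x i})"

text \<open>Without collisions, equal values at \<open>pos\<close> and \<open>lo\<close> exclude
  differences before \<open>lo\<close>. If \<open>lo\<close> were none either,
  \<open>E_agree\<close> would contradict the change from \<open>lo\<close> to
  \<open>Suc lo\<close>.\<close>

lemma find_step:
  assumes g: "good S x" and x: "x < m" and lo: "pos \<le> lo" "lo < m" "E S x lo = E S x pos" "E S x (Suc lo) \<noteq> E S x pos"
  shows "{i. i < Suc lo \<and> diff S x i} = insert lo {i. i < pos \<and> diff S x i}"
    and "shift x ` {i. i < Suc lo \<and> i \<in> S} - S =
      (shift x ` {i. i < pos \<and> i \<in> S} - S) \<union> (if lo \<in> S \<and> shift x lo \<notin> S then {shift x lo} else {})"
proof -
  have nd: "\<not> diff S x i" if "pos \<le> i" "i < lo" for i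
  proof -
    have "lo \<le> m" using lo(2) by simp
    with g lo(1) lo(3)[symmetric] that show ?thesis unfolding good_def by blast
  qed
  have d: "diff S x lo"
  proof (rule ccontr)
    assume "\<not> diff S x lo"
    with nd have "\<not> diff S x i" if "pos \<le> i" "i < Suc lo" for i
      using that by (cases "i = lo") auto
    then have "E S x pos = E S x (Suc lo)"
      using lo(1,2) by (intro E_agree[OF _ _ x]) auto
    with lo(4) show False by simp
  qed
  have cases: "i < Suc lo \<longleftrightarrow> i < pos \<or> pos \<le> i \<and> i < lo \<or> i = lo" for i
    using lo(1) by auto
  show "{i. i < Suc lo \<and> diff S x i} = insert lo {i. i < pos \<and> diff S x i}"
    unfolding cases using nd d by auto
  have "shift x i \<in> S" if "pos \<le> i" "i < lo" "i \<in> S" for i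
    using nd[OF that(1,2)] that(3) by (simp add: diff_def)
  then show "shift x ` {i. i < Suc lo \<and> i \<in> S} - S =
      (shift x ` {i. i < pos \<and> i \<in> S} - S) \<union> (if lo \<in> S \<and> shift x lo \<notin> S then {shift x lo} else {})"
    unfolding cases by auto
qed

lemma find_body:
  assumes fi: "find_inv S D x tp F ys s" and x: "x < m" and g: "eval_expr w s find_cond \<noteq> 0"
  shows "det w find_body s (\<lambda>t s'. t \<le> L * (10 * L + 40) + 10 * L + 90 \<and>
           Suc (regs s' rfuel) = regs s rfuel \<and> (\<exists>ys'. find_inv S D x tp F ys' s'))"
proof -
  have inv: "inv S D s" and b: "base s" and so: "set_ok S s" and S: "S \<subseteq> {..<m}"
    using fi by (auto simp: find_inv_def inv_def set_ok_def)
  note fi' = fi[unfolded find_inv_def]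
  define pos where "pos = regs s rpos"
  have r: "regs s rx = x" "regs s rhx = h x" "regs s rEa = E S x pos" "regs s rEm = E S x m" "pos \<le> m"
    using fi' by (auto simp: pos_def)
  have w1: "1 < (2::nat) ^ w" using word(3) m by linarith
  have ne: "E S x pos \<noteq> E S x m" and fuel: "0 < regs s rfuel"
    using g w1 unfolding find_cond_def by (auto simp: r eval_binop_exact split: if_splits)
  then have pos: "pos < m" using r(5) by (cases "pos = m") auto
  \<comment> \<open>The stack holds distinct residues, so its cells lie below \<open>9 * M\<close>
    and their addresses do not overflow.\<close>
  have lys: "length ys \<le> m"
    using fi' card_mono[of "{..<m}" "set ys"] by (auto simp: distinct_card)
  show ?thesis
    unfolding find_body_def
    apply (rule det_Seq_post[OF search_prog[OF b so r(1) x r(2) pos_def[symmetric] pos r(3) ne]])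
    subgoal premises p for t1 s1
    proof -
      from p obtain lo where lo: "pos \<le> lo" "lo < m" "regs s1 rlo = lo" "regs s1 rhi = Suc lo"
        "E S x lo = E S x pos" "E S x (Suc lo) \<noteq> E S x pos" by blast
      from p have t1: "t1 \<le> L * (10 * L + 40) + 10" and m1: "mem s1 = mem s"
        and sb: "same_but {rnode, racc, rq, re, rlo, rhi} s s1" by auto
      note s1r = same_but_regs[OF sb]
      define y where "y = shift x lo"
      have y: "y < m" by (simp add: y_def shift_less)
      have e1: "eval_expr w s1 ((Reg rlo +\<^sub>e Reg rx) mod\<^sub>e Reg rm) = y"
        using s1r lo x m word(3) r(1) b by (simp add: eval_binop_exact base_def y_def shift_def)
      define s2 where "s2 = set_reg ry y s1"
      have e2: "eval_expr w s2 (Const 8 *\<^sub>e Reg rM +\<^sub>e Reg rsp) = 8 * M + length ys" "eval_expr w s2 (Reg ry) = y"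
        using s1r lys m word(3) b fi' by (simp_all add: eval_binop_exact base_def s2_def)
      define s3 where "s3 = s2\<lparr>mem := (mem s2)(8 * M + length ys := y)\<rparr>"
      define c :: nat where "c = of_bool (lo \<in> S \<and> y \<notin> S)"
      have m3: "mem s3 a = mem s a" if "a < 8 * M" for a
        using that m1 by (simp add: s3_def s2_def)
      have "mem s3 lo = of_bool (lo \<in> S)" "mem s3 y = of_bool (y \<in> S)"
        using m3 lo y m so by (simp_all add: set_ok_def)
      then have e3: "eval_expr w s3 (Reg rsp +\<^sub>e Load (Reg rlo) *\<^sub>e (Const 1 -\<^sub>e Load (Reg ry))) = length ys + c"
        using s1r lo lys m word(3) fi' w1 by (simp add: eval_binop_exact s3_def s2_def c_def)
      define s4 where "s4 = set_reg rq (Suc lo) (set_reg rpos (Suc lo) (set_reg rsp (length ys + c) s3))"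
      have m4: "mem s4 = mem s3" by (simp add: s4_def)
      have s4sb: "same_but {rnode, racc, rq, re, rlo, rhi, ry, rsp, rpos} s s4"
        using sb by (simp add: same_but_def s4_def s3_def s2_def)
      note s4r = same_but_regs[OF s4sb]
      have inv4: "inv S D s4" by (rule inv_cong[OF inv _ s4sb]) (auto simp: m4 m3)
      then have b4: "base s4" and so4: "set_ok S s4" by (auto simp: inv_def)
      have r4: "regs s4 rq = Suc lo" "regs s4 rx = x" "regs s4 rhx = h x" "Suc lo \<le> m"
        using s4r r lo(2) by (simp_all add: s4_def)
      have e5: "eval_expr w (set_reg rsp (length ys + c) s3) (Reg rhi) = Suc lo"
        "eval_expr w (set_reg rpos (Suc lo) (set_reg rsp (length ys + c) s3)) (Reg rhi) = Suc lo"
        by (simp_all add: s3_def s2_def lo)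
      show ?thesis
        apply (intro det_Seq det_Assign)
        unfolding e1 s2_def[symmetric]
        apply (rule det_Store)
        unfolding e2 s3_def[symmetric]
        apply (intro det_Seq det_Assign)
        unfolding e3 e5 s4_def[symmetric]
        apply (rule det_mono[OF eval_prog[OF b4 so4 r4(1) r4(4) r4(2) x r4(3)]])
        subgoal premises q for t5 s5
        proof -
          have sb5: "same_but {rnode, racc, rq, re} s4 s5" and m5: "mem s5 = mem s4"
            and re5: "regs s5 re = E S x (Suc lo)" and t5: "t5 \<le> 10 * L + 30" using q by auto
          note s5r = same_but_regs[OF sb5]
          define F' where "F' = regs s rfuel - 1"
          have f5: "regs s5 rfuel = regs s rfuel" using s5r s4r by simp
          have e6: "eval_expr w s5 (Reg re) = E S x (Suc lo)" "eval_expr w (set_reg rEa (E S x (Suc lo)) s5) (Reg rfuel -\<^sub>e Const 1) = F'"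
            using re5 f5 fuel fi' by (simp_all add: eval_binop_exact F'_def)
          define s6 where "s6 = set_reg rany 1 (set_reg rfuel F' (set_reg rEa (E S x (Suc lo)) s5))"
          define ys' where "ys' = (if lo \<in> S \<and> y \<notin> S then ys @ [y] else ys)"
          have m6: "mem s6 = mem s3" using m5 m4 by (simp add: s6_def)
          have sb6: "same_but {rnode, racc, rq, re, rlo, rhi, ry, rsp, rpos, rany, rfuel, rEa} s s6"
            using s4sb sb5 unfolding s6_def by (simp add: same_but_def)
          note s6r = same_but_regs[OF sb6]
          have inv6: "inv S D s6" by (rule inv_cong[OF inv _ sb6]) (auto simp: m6 m3)
          have ynew: "y \<notin> set ys"
          proof
            assume "y \<in> set ys"
            then obtain i where "i < pos" "shift x i = shift x lo" using fi' by (auto simp: y_def pos_def)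
            with inj_shift[of x] lo(1,2) show False unfolding inj_on_def by fastforce
          qed
          have fi6: "find_inv S D x tp F ys' s6"
            unfolding find_inv_def
          proof (intro conjI impI)
            show "inv S D s6" by (rule inv6)
            show "tape s6 = tp" using same_but_tape[OF sb6] fi' by simp
            show "regs s6 rx = x" "regs s6 rhx = h x" "regs s6 rEm = E S x m" using s6r r by simp_all
            show "regs s6 rpos \<le> m" "regs s6 rEa = E S x (regs s6 rpos)"
              using s5r lo(2) by (simp_all add: s6_def s4_def)
            show "regs s6 rsp = length ys'" using s5r by (simp add: s6_def s4_def ys'_def c_def)
            show "regs s6 rfuel < 2 ^ w" using fi' by (simp add: s6_def F'_def less_imp_diff_less)
            show "length ys' + regs s6 rfuel \<le> F"
              using fi'[THEN conjunct2, THEN conjunct2, THEN conjunct2] fuel by (auto simp: s6_def F'_def ys'_def)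
            show "regs s6 rany = of_bool (regs s6 rfuel < F)" using fi' fuel by (simp add: s6_def F'_def) linarith
            show "distinct ys'" using fi' ynew by (simp add: ys'_def)
            show "set ys' \<subseteq> {..<m} - S" using fi' y by (auto simp: ys'_def)
            have p6: "regs s6 rpos = Suc lo" using s5r by (simp add: s6_def s4_def)
            have "set ys \<subseteq> shift x ` {..<Suc lo}"
              using fi' lo(1) by (fastforce simp: pos_def)
            then show "set ys' \<subseteq> shift x ` {..<regs s6 rpos}" unfolding p6 by (auto simp: ys'_def y_def)
            show "\<forall>i<length ys'. mem s6 (8 * M + i) = ys' ! i"
              unfolding m6 s3_def s2_def using fi' m1 by (auto simp: ys'_def nth_append less_Suc_eq)
            assume gd: "good S x"
            note fs = find_step[OF gd x lo(1,2) lo(5,6)]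
            from gd fi' have "set ys = shift x ` {i. i < pos \<and> i \<in> S} - S"
              and F: "F = regs s rfuel + card {i. i < pos \<and> diff S x i}" unfolding pos_def by blast+
            then show "set ys' = shift x ` {i. i < regs s6 rpos \<and> i \<in> S} - S"
              unfolding p6 fs(2) by (simp add: ys'_def y_def)
            have "card {i. i < Suc lo \<and> diff S x i} = Suc (card {i. i < pos \<and> diff S x i})"
              unfolding fs(1) using lo(1) by (subst card_insert_disjoint) auto
            then show "F = regs s6 rfuel + card {i. i < regs s6 rpos \<and> diff S x i}"
              unfolding p6 F using fuel by (simp add: s6_def F'_def)
          qed
          have "Suc (regs s6 rfuel) = regs s rfuel" using fuel by (simp add: s6_def F'_def)
          with fi6 show ?thesis
            apply (intro det_Seq det_Assign)
            unfolding e6 eval_Const[of 1, OF one_le_numeral] s6_def[symmetric]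
            apply (intro conjI exI[where x = ys'])
            using t1 t5 by simp_all
        qed
        done
    qed
    done
qed

end

context segment_tree
begin

definition find_cost :: nat where "find_cost = L * (10 * L + 40) + 10 * L + 92"

text \<open>Every iteration uses one unit of fuel, so the budget is \<open>find_cost\<close> times
  the fuel; what is left over is kept for later items.\<close>

lemma find_loop:
  assumes "find_inv S D x tp F ys s" "x < m"
  shows "det w (While find_cond find_body) s (\<lambda>t s'. \<exists>ys'. find_inv S D x tp F ys' s' \<and>
    eval_expr w s' find_cond = 0 \<and> t + find_cost * regs s' rfuel \<le> find_cost * regs s rfuel + 1)"
proof -
  define I where "I n s \<longleftrightarrow> (\<exists>ys. find_inv S D x tp F ys s) \<and> n = find_cost * regs s rfuel" for n s
  have step: "det w find_body s (\<lambda>t s'. \<exists>n'. I n' s' \<and> t + n' + 2 \<le> n)"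
    if "I n s" "eval_expr w s find_cond \<noteq> 0" for n s
  proof -
    from that obtain ys where ys: "find_inv S D x tp F ys s" "n = find_cost * regs s rfuel"
      unfolding I_def by blast
    show ?thesis
      apply (rule det_mono[OF find_body[OF ys(1) assms(2) that(2)]])
      subgoal premises p for t s'
      proof -
        have r: "regs s rfuel = Suc (regs s' rfuel)" "t + 2 \<le> find_cost" "\<exists>ys. find_inv S D x tp F ys s'"
          using p by (simp_all add: find_cost_def)
        show ?thesis
          apply (rule exI[where x = "find_cost * regs s' rfuel"])
          unfolding ys(2) r(1) using r(2,3) by (simp add: I_def)
      qed
      done
  qed
  have "I (find_cost * regs s rfuel) s" using assms(1) by (auto simp: I_def)
  from det_While[of I, OF step this] show ?thesis
    by (rule det_mono) (auto simp: I_def)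
qed

lemma insert_prog_inv:
  assumes s: "inv S D s" "regs s ry < m" "regs s ry \<notin> S"
  shows "det w insert_prog s (\<lambda>t s'. t \<le> 10 * L + 40 \<and> inv (insert (regs s ry) S) D s' \<and>
     (\<forall>a \<ge> 8 * M. mem s' a = mem s a) \<and> same_but {rz, rnode, rq} s s')"
proof -
  have i: "base s" "table_ok s" "set_ok S s" "dead_ok D s" using s(1) by (auto simp: inv_def)
  show ?thesis
    apply (rule det_mono[OF insert_prog[OF i(1-3) refl s(2,3)]])
    subgoal premises p for t s'
    proof -
      from p have mem: "\<And>a. M \<le> a \<and> a < 4 * M \<or> 8 * M \<le> a \<Longrightarrow> mem s' a = mem s a"
        and sb: "same_but {rz, rnode, rq} s s'" by auto
      have "base s'" "table_ok s'" "dead_ok D s'"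
        using i mem m same_but_regs[OF sb] by (auto simp: base_def table_ok_def dead_ok_def)
      with p show ?thesis by (auto simp: inv_def)
    qed
    done
qed

lemma pop_loop:
  assumes s: "inv S D s" "regs s rsp = length ys" "distinct ys" "set ys \<subseteq> {..<m} - S"
    "\<forall>i < length ys. mem s (8 * M + i) = ys ! i"
  shows "det w (While (Const 0 <\<^sub>e Reg rsp) pop_body) s (\<lambda>t s'. inv (S \<union> set ys) D s' \<and>
    tape s' = tape s \<and> regs s' rfuel = regs s rfuel \<and> t \<le> length ys * (10 * L + 50) + 1)"
proof -
  have lys: "length ys \<le> m"
    using s(3,4) card_mono[of "{..<m}" "set ys"] by (auto simp: distinct_card)
  \<comment> \<open>The stack is emptied from the top, so \<open>drop k ys\<close> is the part
    already inserted.\<close>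
  define I where "I n s' \<longleftrightarrow> (\<exists>k \<le> length ys. n = k * (10 * L + 50) \<and> regs s' rsp = k \<and>
    inv (S \<union> set (drop k ys)) D s' \<and> tape s' = tape s \<and> regs s' rfuel = regs s rfuel \<and>
    (\<forall>i < k. mem s' (8 * M + i) = ys ! i))" for n s'
  have step: "det w pop_body s1 (\<lambda>t s'. \<exists>n'. I n' s' \<and> t + n' + 2 \<le> n)"
    if I: "I n s1" and g: "eval_expr w s1 (Const 0 <\<^sub>e Reg rsp) \<noteq> 0" for n s1
  proof -
    from I obtain k where k: "k \<le> length ys" "n = k * (10 * L + 50)" "regs s1 rsp = k"
      "inv (S \<union> set (drop k ys)) D s1" "tape s1 = tape s" "regs s1 rfuel = regs s rfuel"
      "\<forall>i < k. mem s1 (8 * M + i) = ys ! i" unfolding I_def by blast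
    obtain k' where k': "k = Suc k'" using g k(3) by (cases k) auto
    have kl: "k' < length ys" using k k' by simp
    have e1: "eval_expr w s1 (Reg rsp -\<^sub>e Const 1) = k'"
      using k k' lys m word(3) by (simp add: eval_binop_exact)
    have e2: "eval_expr w (set_reg rsp k' s1) (Load (Const 8 *\<^sub>e Reg rM +\<^sub>e Reg rsp)) = ys ! k'"
      using k k' lys m word(3) by (simp add: eval_binop_exact inv_def base_def)
    define s2 where "s2 = set_reg ry (ys ! k') (set_reg rsp k' s1)"
    have y: "ys ! k' \<in> set ys" "ys ! k' \<notin> set (drop k ys)"
      using kl id_take_nth_drop[OF kl] s(3) unfolding k'
      by (auto simp del: append_take_drop_id) (metis distinct.simps(2) distinct_append)
    have sb2: "same_but {rsp, ry} s1 s2" by (simp add: s2_def same_but_def)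
    have inv2: "inv (S \<union> set (drop k ys)) D s2"
      by (rule inv_cong[OF k(4) _ sb2]) (auto simp: s2_def)
    have y2: "regs s2 ry < m" "regs s2 ry \<notin> S \<union> set (drop k ys)"
      using y s(4) by (auto simp: s2_def)
    have S': "insert (regs s2 ry) (S \<union> set (drop k ys)) = S \<union> set (drop k' ys)"
      using Cons_nth_drop_Suc[OF kl, symmetric] by (simp add: s2_def k')
    show ?thesis
      unfolding pop_body_def
      apply (intro det_Seq det_Assign)
      unfolding e1 e2 s2_def[symmetric]
      apply (rule det_mono[OF insert_prog_inv[OF inv2 y2]])
      subgoal premises p for t s3
        apply (rule exI[where x = "k' * (10 * L + 50)"])
        using p k kl k' same_but_regs[of _ s2 s3] same_but_tape[of _ s2 s3] unfolding S' I_def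
        by (auto simp: s2_def intro!: exI[where x = k'])
      done
  qed
  have "I (length ys * (10 * L + 50)) s" using s by (auto simp: I_def)
  from det_While[of I, OF step this] show ?thesis
    by (rule det_mono) (auto simp: I_def)
qed

text \<open>One unit of fuel pays for one search and for at most one later insertion.\<close>

definition round_cost :: nat where "round_cost = find_cost + 10 * L + 50"

text \<open>The scan stops either because the rest hashes equally, so that no difference is left, or
  because the fuel is gone. In the second case the differences already passed number
  \<open>F\<close>, which by assumption is all of them.\<close>

lemma find_complete:
  assumes gd: "good S x" and x: "x < m" and S: "S \<subseteq> {..<m}" and fi: "find_inv S D x tp F ys s"
    and stop: "eval_expr w s find_cond = 0" and enough: "card {i. i < m \<and> diff S x i} \<le> F"
  shows "S \<union> set ys = S \<union> shift x ` S" "F = regs s rfuel + card {i. i < m \<and> diff S x i}"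
proof -
  define pos where "pos = regs s rpos"
  note fi' = fi[unfolded find_inv_def, folded pos_def]
  have pm: "pos \<le> m" using fi' by blast
  have ys: "set ys = shift x ` {i. i < pos \<and> i \<in> S} - S"
    and F: "F = regs s rfuel + card {i. i < pos \<and> diff S x i}" using gd fi' by blast+
  have sub: "{i. i < pos \<and> diff S x i} \<subseteq> {i. i < m \<and> diff S x i}" using pm by auto
  have eq: "{i. i < m \<and> diff S x i} = {i. i < pos \<and> diff S x i}"
  proof (cases "E S x pos = E S x m")
    case True
    with gd pm have "\<not> diff S x i" if "pos \<le> i" "i < m" for i
      using that unfolding good_def by blast
    with pm show ?thesis by (auto simp: not_less) (meson not_less)
  next
    case False
    have w1: "1 < (2::nat) ^ w" using word(3) m by linarith
    have "regs s rfuel = 0"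
    proof -
      have "regs s rEa = E S x pos" "regs s rEm = E S x m" using fi' by blast+
      with stop False w1 show ?thesis
        unfolding find_cond_def by (simp add: eval_binop_exact split: if_splits)
    qed
    with F enough have "card {i. i < m \<and> diff S x i} \<le> card {i. i < pos \<and> diff S x i}" by simp
    then show ?thesis using card_seteq[OF _ sub] by simp
  qed
  then show "F = regs s rfuel + card {i. i < m \<and> diff S x i}" using F by simp
  have "shift x i \<in> S \<union> set ys" if "i \<in> S" for i
  proof (cases "i < pos")
    case False
    with eq that S have "\<not> diff S x i" by auto
    with that show ?thesis by (simp add: diff_def)
  qed (use ys that in auto)
  then show "S \<union> set ys = S \<union> shift x ` S" using ys by auto
qed

lemma round_prog:
  assumes s: "inv S D s" "regs s rx = x" "x < m" "x \<notin> D" "regs s rfuel = F" "F < 2 ^ w"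
  shows "det w round_prog s (\<lambda>t s'. \<exists>S' D'. inv S' D' s' \<and> tape s' = tape s \<and> regs s' rfuel \<le> F \<and>
     D' = (if regs s' rfuel = F then insert x D else D) \<and>
     t + round_cost * regs s' rfuel \<le> round_cost * F + 20 * L + 120 \<and>
     (good S x \<longrightarrow> card {i. i < m \<and> diff S x i} \<le> F \<longrightarrow>
        S' = S \<union> shift x ` S \<and> F = regs s' rfuel + card {i. i < m \<and> diff S x i}))"
proof -
  have i: "base s" "table_ok s" "set_ok S s" "dead_ok D s" using s(1) by (auto simp: inv_def)
  have S: "S \<subseteq> {..<m}" using i by (simp add: set_ok_def)
  have e1: "eval_expr w s (Load (Const 2 *\<^sub>e Reg rM +\<^sub>e Reg rx)) = h x"
    using i s m word(3) by (simp add: eval_binop_exact base_def table_ok_def)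
  define s1 where "s1 = set_reg rq m (set_reg rhx (h x) s)"
  have e2: "eval_expr w (set_reg rhx (h x) s) (Reg rm) = m" using i by (simp add: base_def)
  have sb1: "same_but {rq, rhx} s s1" by (simp add: same_but_def s1_def)
  have i1: "inv S D s1" by (rule inv_cong[OF s(1) _ sb1]) (auto simp: s1_def)
  have r1: "base s1" "set_ok S s1" "regs s1 rq = m" "m \<le> m" "regs s1 rx = x" "regs s1 rhx = h x"
    using i1 s by (auto simp: inv_def s1_def)
  show ?thesis
    unfolding round_prog_def
    apply (intro det_Seq det_Assign)
    unfolding e1 e2 s1_def[symmetric]
    apply (rule det_mono[OF eval_prog[OF r1(1-5) s(3) r1(6)]])
    apply (intro det_Seq det_Assign)
    subgoal premises p for t2 s2
    proof -
      have t2: "t2 \<le> 10 * L + 30" and m2: "mem s2 = mem s1" and sb2: "same_but {rnode, racc, rq, re} s1 s2"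
        and re2: "eval_expr w s2 (Reg re) = E S x m" using p by auto
      define s3 where "s3 = set_reg rq 0 (set_reg rpos 0 (set_reg rEm (E S x m) s2))"
      have sb3: "same_but {rnode, racc, rq, re, rhx, rpos, rEm} s s3"
        using sb1 sb2 by (simp add: same_but_def s3_def)
      note s3r = same_but_regs[OF sb3]
      have i3: "inv S D s3" by (rule inv_cong[OF s(1) _ sb3]) (auto simp: s3_def s1_def m2)
      have r3: "base s3" "set_ok S s3" "regs s3 rq = 0" "0 \<le> m" "regs s3 rx = x" "regs s3 rhx = h x"
        using i3 s3r same_but_regs[OF sb2] s r1 by (auto simp: inv_def s3_def)
      show ?thesis
        unfolding re2 eval_Const[of 0, OF zero_le] s3_def[symmetric]
        apply (rule det_mono[OF eval_prog[OF r3(1-5) s(3) r3(6)]])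
        apply (intro det_Seq det_Assign)
        subgoal premises p for t4 s4
        proof -
          have t4: "t4 \<le> 10 * L + 30" and m4: "mem s4 = mem s3" and sb4: "same_but {rnode, racc, rq, re} s3 s4"
            and re4: "eval_expr w s4 (Reg re) = E S x 0" using p by auto
          define s5 where "s5 = set_reg rany 0 (set_reg rsp 0 (set_reg rEa (E S x 0) s4))"
          have sb5: "same_but {rnode, racc, rq, re, rhx, rpos, rEm, rany, rsp, rEa} s s5"
            using sb3 sb4 by (simp add: same_but_def s5_def)
          note s5r = same_but_regs[OF sb5]
          have i5: "inv S D s5" by (rule inv_cong[OF s(1) _ sb5]) (auto simp: s5_def m4 s3_def s1_def m2)
          have fi5: "find_inv S D x (tape s) F [] s5"
            using i5 same_but_tape[OF sb5] s5r s same_but_regs[OF sb4] r3(6) same_but_regs[OF sb2]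
            unfolding find_inv_def by (simp add: s5_def s3_def)
          show ?thesis
            unfolding re4 eval_Const[of 0, OF zero_le] s5_def[symmetric]
            apply (rule det_mono[OF find_loop[OF fi5 s(3)]])
            apply (elim exE conjE)
            apply (intro det_Seq det_Store)
            subgoal premises q for t6 s6 ys
            proof -
              note fi6 = q(1)[unfolded find_inv_def]
              define D' where "D' = (if regs s6 rfuel = F then insert x D else D)"
              have i6: "inv S D s6" and F6: "regs s6 rfuel \<le> F" and len: "length ys + regs s6 rfuel \<le> F"
                using fi6 by auto
              have e7: "eval_expr w s6 (Reg rM +\<^sub>e Reg rx) = M + x"
                using fi6 s(3) m word(3) by (simp add: inv_def base_def eval_binop_exact)
              have e8: "eval_expr w s6 (Reg rany =\<^sub>e Const 0) = of_bool (regs s6 rfuel = F)"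
                using fi6 F6 by auto
              \<comment> \<open>As \<open>x\<close> is not in \<open>D\<close>, writing 0 after a
                round that found a difference leaves the flags as they were.\<close>
              define s7 where "s7 = s6\<lparr>mem := (mem s6)(M + x := of_bool (regs s6 rfuel = F))\<rparr>"
              have i7: "inv S D' s7"
                using i6 s(3,4) m unfolding D'_def
                by (auto simp: inv_def s7_def base_def table_ok_def set_ok_def tree_ok_def dead_ok_def)
              have stk: "regs s7 rsp = length ys" "distinct ys" "set ys \<subseteq> {..<m} - S"
                "\<forall>i<length ys. mem s7 (8 * M + i) = ys ! i"
                using fi6 s(3) m by (auto simp: s7_def)
              have t6: "t6 + find_cost * regs s6 rfuel \<le> find_cost * F + 1"
                using q(3) s5r s(5) by simp
              show ?thesis
                unfolding e7 e8 s7_def[symmetric]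
                apply (rule det_mono[OF pop_loop[OF i7 stk]])
                apply (elim conjE)
                subgoal premises r for t8 s8
                proof (intro exI conjI impI)
                  show "inv (S \<union> set ys) D' s8" by (rule r(1))
                  show "tape s8 = tape s" using r fi6 by (simp add: s7_def)
                  show "regs s8 rfuel \<le> F" using r F6 by (simp add: s7_def)
                  show "D' = (if regs s8 rfuel = F then insert x D else D)"
                    using r by (simp add: D'_def s7_def)
                  have f8: "regs s8 rfuel = regs s6 rfuel" using r by (simp add: s7_def)
                  have "(length ys + regs s6 rfuel) * (10 * L + 50) \<le> F * (10 * L + 50)"
                    using len by (rule mult_le_mono1)
                  then show "1 + (1 + (t2 + (1 + (1 + (1 + (t4 + (1 + (1 + (1 + (t6 + (1 + t8 + 1) + 1) + 1) + 1) + 1) + 1) + 1) + 1) + 1) + 1) + 1) + 1 + round_cost * regs s8 rfuel \<le> round_cost * F + 20 * L + 120"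
                    unfolding f8 round_cost_def using t2 t4 t6 r(4) by (simp add: algebra_simps)
                  assume g: "good S x" "card {i. i < m \<and> diff S x i} \<le> F"
                  note c = find_complete[OF g(1) s(3) S q(1,2) g(2)]
                  show "S \<union> set ys = S \<union> shift x ` S" by (rule c(1))
                  show "F = regs s8 rfuel + card {i. i < m \<and> diff S x i}" unfolding f8 by (rule c(2))
                qed
                done
            qed
            done
        qed
        done
    qed
    done
qed

end

section \<open>Processing the input\<close>

lemma subset_sums_empty: "subset_sums m {#} = {0}"
  by (auto simp: subset_sums_def)

lemma subset_sums_add_mset:
  "subset_sums m (add_mset x X) = subset_sums m X \<union> (\<lambda>i. (i + x) mod m) ` subset_sums m X"
proof -
  have "{Y. Y \<subseteq># add_mset x X} = {Y. Y \<subseteq># X} \<union> add_mset x ` {Y. Y \<subseteq># X}"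
  proof (intro set_eqI iffI)
    fix Y assume "Y \<in> {Y. Y \<subseteq># add_mset x X}"
    then have Y: "Y \<subseteq># add_mset x X" by simp
    show "Y \<in> {Y. Y \<subseteq># X} \<union> add_mset x ` {Y. Y \<subseteq># X}"
    proof (cases "x \<in># Y")
      case True
      then obtain Z where "Y = add_mset x Z" by (metis insert_DiffM)
      with Y show ?thesis by auto
    next
      case False
      with Y have "Y \<subseteq># X"
        by (metis diff_single_trivial subset_eq_diff_conv add_mset_add_single)
      then show ?thesis by simp
    qed
  next
    fix Y assume "Y \<in> {Y. Y \<subseteq># X} \<union> add_mset x ` {Y. Y \<subseteq># X}"
    then show "Y \<in> {Y. Y \<subseteq># add_mset x X}"
      by (auto intro: subset_mset.order_trans[OF _ mset_subset_eq_add_mset_cancel[THEN iffD2]] subset_mset.order_trans[of _ X])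
  qed
  moreover have "subset_sums m X = (\<lambda>Y. sum_mset Y mod m) ` {Y. Y \<subseteq># X}" for X
    by (auto simp: subset_sums_def)
  ultimately show ?thesis
    by (simp add: image_Un image_image mod_add_left_eq add.commute[of x])
qed

lemma subset_sums_less: "0 < m \<Longrightarrow> subset_sums m X \<subseteq> {..<m}"
  by (auto simp: subset_sums_def)

lemma finite_subset_sums: "finite (subset_sums m X)"
proof -
  have "subset_sums m X = (\<lambda>Y. sum_mset Y mod m) ` {Y. Y \<subseteq># X}"
    by (auto simp: subset_sums_def)
  moreover have "finite {Y. Y \<subseteq># X}"
  proof (induction X)
    case (add x X)
    have "{Y. Y \<subseteq># add_mset x X} \<subseteq> {Y. Y \<subseteq># X} \<union> add_mset x ` {Y. Y \<subseteq># X}"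
      by (auto simp: image_iff) (metis diff_single_trivial subset_eq_diff_conv add_mset_add_single insert_DiffM mset_subset_eq_add_mset_cancel)
    with add show ?case by (meson finite_UnI finite_imageI finite_subset)
  qed simp
  ultimately show ?thesis by simp
qed

definition table_body :: com where
  "table_body =
     (Store (Const 2 *\<^sub>e Reg rM +\<^sub>e Reg ri) (Reg rv);;
      rv ::= (Reg rv *\<^sub>e Reg rb) mod\<^sub>e Reg rN;;
      ri ::= Reg ri +\<^sub>e Const 1)"

definition table_prog :: com where
  "table_prog =
     (rv ::= Const 1 mod\<^sub>e Reg rN;; ri ::= Const 0;;
      While (Reg ri <\<^sub>e Const 2 *\<^sub>e Reg rm) table_body)"

definition item_body :: com where
  "item_body = (Read rx;; Cond (Load (Reg rM +\<^sub>e Reg rx)) Skip round_prog)"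

text \<open>Starting empty and inserting 0 initializes the tree through the ordinary update. The
  fuel suffices because each new sum accounts for two differences and fewer than \<open>m\<close>
  sums can be new.\<close>

definition main_prog :: com where
  "main_prog =
     (table_prog;; ry ::= Const 0;; rfuel ::= Const 2 *\<^sub>e Reg rm;; insert_prog;;
      While More item_body)"

context segment_tree
begin

lemma table_prog:
  assumes s: "base s" "regs s rb = b" "b < N"
  shows "det w table_prog s (\<lambda>t s'. t \<le> 14 * m + 5 \<and> same_but {rv, ri} s s' \<and>
     (\<forall>a. mem s' a = (if 2 * M \<le> a \<and> a < 2 * M + 2 * m then h (a - 2 * M) else mem s a)))"
proof -
  define I where "I n s' \<longleftrightarrow> (\<exists>i \<le> 2 * m. n = 7 * (2 * m - i) \<and> regs s' ri = i \<and> regs s' rv = h i \<and>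
    same_but {rv, ri} s s' \<and>
    (\<forall>a. mem s' a = (if 2 * M \<le> a \<and> a < 2 * M + i then h (a - 2 * M) else mem s a)))" for n s'
  have cond: "eval_expr w s' (Reg ri <\<^sub>e Const 2 *\<^sub>e Reg rm) = of_bool (regs s' ri < 2 * m)"
    if "same_but {rv, ri} s s'" for s'
    using same_but_regs[OF that] s m word(3) by (simp add: base_def eval_binop_exact)
  have step: "det w table_body s1 (\<lambda>t s'. \<exists>n'. I n' s' \<and> t + n' + 2 \<le> n)"
    if I: "I n s1" and g: "eval_expr w s1 (Reg ri <\<^sub>e Const 2 *\<^sub>e Reg rm) \<noteq> 0" for n s1
  proof -
    from I obtain i where i: "i \<le> 2 * m" "n = 7 * (2 * m - i)" "regs s1 ri = i" "regs s1 rv = h i"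
      and sb: "same_but {rv, ri} s s1"
      and mem: "\<forall>a. mem s1 a = (if 2 * M \<le> a \<and> a < 2 * M + i then h (a - 2 * M) else mem s a)"
      unfolding I_def by blast
    note s1r = same_but_regs[OF sb]
    have il: "i < 2 * m" using g unfolding cond[OF sb] i(3) by (simp split: if_splits)
    have hb: "h i * b < 2 ^ w"
    proof -
      have "h i * b \<le> N * N" using h_less[of i] s(3) by (intro mult_le_mono) auto
      then show ?thesis using word(1) by linarith
    qed
    have e1: "eval_expr w s1 (Const 2 *\<^sub>e Reg rM +\<^sub>e Reg ri) = 2 * M + i" "eval_expr w s1 (Reg rv) = h i"
      using i il m word(3) s1r s(1) by (simp_all add: eval_binop_exact base_def)
    define s2 where "s2 = s1\<lparr>mem := (mem s1)(2 * M + i := h i)\<rparr>"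
    have hS: "(h i * b) mod N = h (Suc i)" by (simp add: h_def mod_simps mult.commute)
    have e2: "eval_expr w s2 ((Reg rv *\<^sub>e Reg rb) mod\<^sub>e Reg rN) = h (Suc i)"
      using hb s1r s i hS by (simp add: eval_binop_exact base_def s2_def)
    have e3: "eval_expr w (set_reg rv (h (Suc i)) s2) (Reg ri +\<^sub>e Const 1) = Suc i"
      using il i m word(3) by (simp add: eval_binop_exact s2_def)
    show ?thesis
      unfolding table_body_def
      apply (intro det_Seq det_Store det_Assign)
      unfolding e1 s2_def[symmetric] e2 e3
      apply (rule exI[where x = "7 * (2 * m - Suc i)"])
      unfolding I_def
      apply (intro conjI exI[where x = "Suc i"])
      using il i sb mem by (auto simp: same_but_def s2_def)
  qed
  have start: "I (14 * m) (set_reg ri 0 (set_reg rv (h 0) s))"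
    unfolding I_def by (intro exI[where x = 0]) (simp add: same_but_def)
  have e: "eval_expr w s (Const 1 mod\<^sub>e Reg rN) = h 0"
    using s word(3) m by (simp add: base_def eval_binop_exact h_def)
  show ?thesis
    unfolding table_prog_def
    apply (intro det_Seq det_Assign)
    unfolding e eval_Const[of 0, OF zero_le]
    apply (rule det_mono[OF det_While[of I, OF step start]])
      apply assumption+
    subgoal premises p for t s'
    proof -
      from p obtain n' where n': "I n' s'" "eval_expr w s' (Reg ri <\<^sub>e Const 2 *\<^sub>e Reg rm) = 0" "t + n' \<le> 14 * m + 1"
        by blast
      from n'(1) obtain i where i: "i \<le> 2 * m" "regs s' ri = i" and sb: "same_but {rv, ri} s s'"
        and mem: "\<forall>a. mem s' a = (if 2 * M \<le> a \<and> a < 2 * M + i then h (a - 2 * M) else mem s a)"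
        unfolding I_def by blast
      have "i = 2 * m" using n'(2) cond[OF sb] i by simp
      with mem sb n'(3) show ?thesis by simp
    qed
    done
qed

definition step_set :: "nat set \<Rightarrow> nat \<Rightarrow> nat set" where "step_set S x = S \<union> shift x ` S"

text \<open>Translation permutes the residues, so as many positions lead from \<open>S\<close> to
  its complement as from the complement into \<open>S\<close>. Those leading out of \<open>S\<close>
  correspond to the new sums.\<close>

lemma card_diff:
  assumes "S \<subseteq> {..<m}"
  shows "card {i. i < m \<and> diff S x i} = 2 * card (shift x ` S - S)"
    and "card (step_set S x) = card S + card (shift x ` S - S)"
proof -
  have fin: "finite S" using assms finite_subset by blast
  have inj: "inj_on (shift x) S" using inj_shift assms inj_on_subset by blast
  have "shift x ` {..<m} \<subseteq> {..<m}" by (auto simp: shift_less)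
  then have surj: "shift x ` {..<m} = {..<m}"
    by (intro endo_inj_surj inj_shift) auto
  let ?A = "{i \<in> S. shift x i \<notin> S}" let ?B = "{i \<in> S. shift x i \<in> S}" let ?C = "{i. i < m \<and> i \<notin> S \<and> shift x i \<in> S}"
  have A: "card ?A = card (shift x ` S - S)"
  proof -
    have "shift x ` ?A = shift x ` S - S" by auto
    moreover have "card (shift x ` ?A) = card ?A"
      by (rule card_image, rule inj_on_subset[OF inj]) auto
    ultimately show ?thesis by simp
  qed
  have "?A \<union> ?B = S" by auto
  moreover have "card (?A \<union> ?B) = card ?A + card ?B"
    using fin by (intro card_Un_disjoint) auto
  ultimately have AB: "card S = card ?A + card ?B" by simp
  have "shift x ` (?C \<union> ?B) = S"
  proof
    show "S \<subseteq> shift x ` (?C \<union> ?B)"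
    proof
      fix j assume j: "j \<in> S"
      then have "j \<in> shift x ` {..<m}" using surj assms by auto
      with j show "j \<in> shift x ` (?C \<union> ?B)" by auto
    qed
  qed auto
  moreover have "card (shift x ` (?C \<union> ?B)) = card (?C \<union> ?B)"
    by (rule card_image, rule inj_on_subset[OF inj_shift]) (use assms in auto)
  ultimately have "card S = card (?C \<union> ?B)" by simp
  also have "\<dots> = card ?C + card ?B" using fin by (intro card_Un_disjoint) auto
  finally have C: "card S = card ?C + card ?B" .
  have "{i. i < m \<and> diff S x i} = ?A \<union> ?C" using assms by (auto simp: diff_def)
  also have "card \<dots> = card ?A + card ?C" using fin by (intro card_Un_disjoint) auto
  finally show "card {i. i < m \<and> diff S x i} = 2 * card (shift x ` S - S)" using A AB C by simp
  have "step_set S x = S \<union> (shift x ` S - S)" by (auto simp: step_set_def)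
  also have "card \<dots> = card S + card (shift x ` S - S)" using fin by (intro card_Un_disjoint) auto
  finally show "card (step_set S x) = card S + card (shift x ` S - S)" .
qed

text \<open>Translations commute; hence an item that has stopped yielding new sums never yields any
  later.\<close>

lemma step_set_closed:
  assumes "shift x ` S \<subseteq> S"
  shows "shift x ` step_set S y \<subseteq> step_set S y"
proof -
  have "shift x (shift y i) = shift y (shift x i)" for i
    by (simp add: shift_def mod_simps add_ac)
  with assms show ?thesis unfolding step_set_def by auto
qed

text \<open>The sets are the true subset sums of the prefixes and do not depend on \<open>b\<close>.
  So the union bound ranges over polynomials fixed in advance although the algorithm is adaptive:
  inductively, a run without collisions meets only these sets.\<close>

definition all_good :: "nat list \<Rightarrow> bool" where
  "all_good xs \<longleftrightarrow> (\<forall>j \<le> length xs. \<forall>x < m. good (subset_sums m (mset (take j xs))) x)"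

text \<open>\<open>n\<close> bounds the remaining time: a round that leaves \<open>rfuel\<close> unchanged adds an item to \<open>D\<close>.\<close>

definition main_inv :: "nat list \<Rightarrow> nat \<Rightarrow> state \<Rightarrow> bool" where
  "main_inv xs n s \<longleftrightarrow> (\<exists>S D zs. inv S D s \<and> xs = zs @ tape s \<and> regs s rfuel \<le> 2 * m \<and>
     n = round_cost * regs s rfuel + (20 * L + 130) * (regs s rfuel + (m - card D)) + 10 * length (tape s) \<and>
     (all_good xs \<longrightarrow> S = subset_sums m (mset zs) \<and> 2 * (m - card S) \<le> regs s rfuel \<and>
        (\<forall>x \<in> D. shift x ` S \<subseteq> S)))"

lemma subset_sums_snoc: "subset_sums m (mset (zs @ [x])) = step_set (subset_sums m (mset zs)) x"
  by (simp add: subset_sums_add_mset step_set_def shift_def)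

lemma item_body:
  assumes I: "main_inv xs n s" and g: "eval_expr w s More \<noteq> 0" and xs: "\<forall>x \<in> set xs. x < m"
  shows "det w item_body s (\<lambda>t s'. \<exists>n'. main_inv xs n' s' \<and> t + n' + 2 \<le> n)"
proof -
  from I obtain S D zs where S: "inv S D s" "xs = zs @ tape s" "regs s rfuel \<le> 2 * m"
    and n: "n = round_cost * regs s rfuel + (20 * L + 130) * (regs s rfuel + (m - card D)) + 10 * length (tape s)"
    and good: "all_good xs \<Longrightarrow> S = subset_sums m (mset zs)" "all_good xs \<Longrightarrow> 2 * (m - card S) \<le> regs s rfuel"
      "all_good xs \<Longrightarrow> \<forall>x \<in> D. shift x ` S \<subseteq> S"
    unfolding main_inv_def by blast
  from g obtain x tp where tp: "tape s = x # tp" by (cases "tape s") auto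
  have x: "x < m" using xs S(2) tp by auto
  have xw: "take_bit w x = x" using x m word(3) by (simp add: take_bit_nat_eq_self)
  define F where "F = regs s rfuel"
  define s1 where "s1 = set_reg rx x (s\<lparr>tape := tp\<rparr>)"
  have i1: "inv S D s1" using S(1) m
    by (auto simp: s1_def inv_def base_def table_ok_def set_ok_def tree_ok_def dead_ok_def)
  have D: "D \<subseteq> {..<m}" and Sm: "S \<subseteq> {..<m}" using S(1) by (auto simp: inv_def dead_ok_def set_ok_def)
  have finD: "finite D" using D finite_subset by blast
  have e1: "eval_expr w s1 (Load (Reg rM +\<^sub>e Reg rx)) = of_bool (x \<in> D)"
    using i1 x m word(3) by (simp add: inv_def base_def dead_ok_def eval_binop_exact s1_def)
  have r1: "regs s1 rx = x" "regs s1 rfuel = F" "F < 2 ^ w" "tape s1 = tp"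
    using S(3) m word(3) by (simp_all add: s1_def F_def)
  have gd: "good S x" if "all_good xs"
    using that x S(2) unfolding all_good_def good(1)[OF that]
    by (metis append_eq_conv_conj le_add1 length_append)
  have next_set: "subset_sums m (mset (zs @ [x])) = step_set S x" if "all_good xs"
    unfolding subset_sums_snoc good(1)[OF that] ..
  show ?thesis
    unfolding item_body_def
    apply (intro det_Seq det_Read[OF tp])
    unfolding xw s1_def[symmetric]
    apply (rule det_Cond)
    unfolding e1
    subgoal premises p
    proof (rule det_Skip)
      have xD: "x \<in> D" using p by simp
      have "main_inv xs (round_cost * F + (20 * L + 130) * (F + (m - card D)) + 10 * length tp) s1"
        unfolding main_inv_def r1
      proof (intro exI conjI impI)
        show "inv S D s1" by (rule i1)
        show "xs = (zs @ [x]) @ tp" using S(2) tp by simp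
        show "F \<le> 2 * m" using S(3) by (simp add: F_def)
        assume a: "all_good xs"
        then have "step_set S x = S" using good(3) xD by (auto simp: step_set_def)
        with next_set[OF a] show "S = subset_sums m (mset (zs @ [x]))" by simp
        show "2 * (m - card S) \<le> F" "\<forall>x \<in> D. shift x ` S \<subseteq> S"
          using good(2,3)[OF a] by (simp_all add: F_def)
      qed simp
      then show "\<exists>n'. main_inv xs n' s1 \<and> 1 + Suc 0 + 1 + n' + 2 \<le> n"
        unfolding n tp F_def by (intro exI conjI, assumption) simp
    qed
    subgoal premises p
    proof -
      have xD: "x \<notin> D" using p by simp
      show ?thesis
        apply (rule det_mono[OF round_prog[OF i1 r1(1) x xD r1(2,3)]])
        apply (elim exE conjE)
        subgoal premises q for t s2 S' D'
        proof -
          define F' where "F' = regs s2 rfuel"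
          have i2: "inv S' D' s2" and tp2: "tape s2 = tp" and F': "F' \<le> F"
            and D': "D' = (if F' = F then insert x D else D)"
            and t: "t + round_cost * F' \<le> round_cost * F + 20 * L + 120"
            using q r1 by (simp_all add: F'_def)
          have q6: "S' = step_set S x" "F = F' + card {i. i < m \<and> diff S x i}"
            if "good S x" "card {i. i < m \<and> diff S x i} \<le> F"
            using q(6) that by (simp_all add: F'_def step_set_def)
          have dec: "Suc (F' + (m - card D')) \<le> F + (m - card D)"
          proof (cases "F' = F")
            case True
            have "insert x D \<subseteq> {..<m}" using D x by auto
            then have "card (insert x D) \<le> m" using card_mono[of "{..<m}"] by fastforce
            with True D' finD xD show ?thesis by simp
          qed (use F' D' in simp)
          have dec2: "(20 * L + 130) * (F' + (m - card D')) + (20 * L + 130) \<le> (20 * L + 130) * (F + (m - card D))"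
            using mult_le_mono2[OF dec, of "20 * L + 130"] by simp
          have "main_inv xs (round_cost * F' + (20 * L + 130) * (F' + (m - card D')) + 10 * length tp) s2"
            unfolding main_inv_def tp2 F'_def[symmetric]
          proof (intro exI conjI impI)
            show "inv S' D' s2" by (rule i2)
            show "xs = (zs @ [x]) @ tp" using S(2) tp by simp
            show "F' \<le> 2 * m" using F' S(3) by (simp add: F_def)
            assume a: "all_good xs"
            note cd = card_diff[OF Sm, of x]
            have Sm': "step_set S x \<subseteq> {..<m}" using Sm by (auto simp: step_set_def shift_less)
            have "card (step_set S x) \<le> m" using card_mono[OF _ Sm'] by simp
            then have enough: "card {i. i < m \<and> diff S x i} \<le> F"
              using cd good(2)[OF a] by (simp add: F_def)
            note q6' = q6[OF gd[OF a] enough]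
            show "S' = subset_sums m (mset (zs @ [x]))" using q6' next_set[OF a] by simp
            show "2 * (m - card S') \<le> F'"
              unfolding q6'(1) cd(2) using good(2)[OF a] q6'(2) cd(1) by (simp add: F_def)
            \<comment> \<open>Unchanged fuel means that no difference was found, so \<open>x\<close>
              contributes nothing and may be marked.\<close>
            have "shift x ` S \<subseteq> S" if "F' = F"
            proof -
              have "card (shift x ` S - S) = 0" using q6'(2) that cd(1) by simp
              moreover have "finite (shift x ` S - S)" using Sm finite_subset by blast
              ultimately show ?thesis by auto
            qed
            then have "\<forall>y \<in> D'. shift y ` S \<subseteq> S" using D' good(3)[OF a] by (auto split: if_splits)
            then show "\<forall>y \<in> D'. shift y ` S' \<subseteq> S'" unfolding q6'(1) using step_set_closed by blast
          qed simp
          moreover have "1 + Suc t + 1 + (round_cost * F' + (20 * L + 130) * (F' + (m - card D')) + 10 * length tp) + 2 \<le> n"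
            unfolding n tp F_def[symmetric] using t dec2 by simp
          ultimately show ?thesis by blast
        qed
        done
    qed
    done
qed

text \<open>The factor \<open>3 * m\<close> consists of \<open>2 * m\<close> units of fuel and
  \<open>m\<close> residues not yet marked; \<open>10 * length xs\<close> pays for reading and
  testing the items, skipped ones included.\<close>

lemma main_prog:
  assumes s: "base s" "regs s rb = b" "b < N" "\<forall>a. mem s a = 0" "tape s = xs" "\<forall>x \<in> set xs. x < m"
  shows "det w main_prog s (\<lambda>t s'. t \<le> round_cost * (2 * m) + (20 * L + 130) * (3 * m) + 10 * length xs + 14 * m + 10 * L + 60 \<and>
      (all_good xs \<longrightarrow> output_set m s' = subset_sums m (mset xs)))"
  unfolding main_prog_def
  apply (rule det_Seq_post[OF table_prog[OF s(1-3)]])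
  subgoal premises p for t1 s1
  proof -
    have sb1: "same_but {rv, ri} s s1" and t1: "t1 \<le> 14 * m + 5"
      and mem1: "mem s1 a = (if 2 * M \<le> a \<and> a < 2 * M + 2 * m then h (a - 2 * M) else 0)" for a
      using p s(4) by auto
    define s2 where "s2 = set_reg rfuel (2 * m) (set_reg ry 0 s1)"
    have e: "eval_expr w (set_reg ry 0 s1) (Const 2 *\<^sub>e Reg rm) = 2 * m"
      using same_but_regs[OF sb1] s(1) m word(3) by (simp add: base_def eval_binop_exact)
    have i2: "inv {} {} s2"
      using s(1) m same_but_regs[OF sb1] by (auto simp: inv_def base_def table_ok_def set_ok_def tree_ok_def
          dead_ok_def s2_def mem1 ext_def node_sum_def)
    have y2: "regs s2 ry < m" "regs s2 ry \<notin> {}" using m by (simp_all add: s2_def)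
    show ?thesis
      apply (intro det_Seq det_Assign)
      unfolding eval_Const[of 0, OF zero_le] e s2_def[symmetric]
      apply (rule det_mono[OF insert_prog_inv[OF i2 y2]])
      subgoal premises q for t3 s3
      proof -
        have t3: "t3 \<le> 10 * L + 40" and i3: "inv {0} {} s3" and sb3: "same_but {rz, rnode, rq} s2 s3"
          using q by (simp_all add: s2_def)
        have f3: "regs s3 rfuel = 2 * m" and tp3: "tape s3 = xs"
          using same_but_regs[OF sb3] same_but_tape[OF sb3] same_but_tape[OF sb1] s(5) by (simp_all add: s2_def)
        have I: "main_inv xs (round_cost * (2 * m) + (20 * L + 130) * (3 * m) + 10 * length xs) s3"
          unfolding main_inv_def
          by (rule exI[where x = "{0}"], rule exI[where x = "{}"], rule exI[where x = "[]"])
            (use i3 f3 tp3 in \<open>simp add: subset_sums_empty\<close>)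
        have step: "det w item_body s' (\<lambda>t s''. \<exists>n'. main_inv xs n' s'' \<and> t + n' + 2 \<le> n)"
          if "main_inv xs n s'" "eval_expr w s' More \<noteq> 0" for n s'
          by (rule item_body[OF that s(6)])
        show ?thesis
          apply (rule det_mono[OF det_While[of "main_inv xs", OF step I]])
            apply assumption+
          subgoal premises r for t4 s4
          proof -
            from r obtain n' where n': "main_inv xs n' s4" "eval_expr w s4 More = 0"
              "t4 \<le> round_cost * (2 * m) + (20 * L + 130) * (3 * m) + 10 * length xs + 1" by auto
            have "take_bit w (1::nat) = 1"
              using word(3) m by (intro take_bit_nat_eq_self) linarith
            then have tp4: "tape s4 = []"
              using n'(2) by (cases "tape s4 = []") (simp_all del: take_bit_of_1 One_nat_def)
            have out: "output_set m s4 = subset_sums m (mset xs)" if a: "all_good xs"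
            proof -
              from n'(1) obtain S D zs where "inv S D s4" "xs = zs @ tape s4"
                "all_good xs \<longrightarrow> S = subset_sums m (mset zs)"
                unfolding main_inv_def by blast
              with a tp4 have "inv (subset_sums m (mset xs)) D s4" by simp
              then show ?thesis by (auto simp: output_set_def inv_def set_ok_def simp del: One_nat_def)
            qed
            then show ?thesis using t1 t3 n'(3) by auto
          qed
          done
      qed
      done
  qed
  done

end

section \<open>Random primes\<close>

definition size_body :: com where
  "size_body = (rM ::= Reg rM *\<^sub>e Const 2;; rL ::= Reg rL +\<^sub>e Const 1)"

definition size_prog :: com where
  "size_prog = (Read rm;; rM ::= Const 1;; rL ::= Const 0;; While ((Reg rm <\<^sub>e Reg rM) =\<^sub>e Const 0) size_body)"

definition divide_body :: com where
  "divide_body = (rok ::= Reg rok *\<^sub>e (Const 0 <\<^sub>e Reg rv mod\<^sub>e Reg ri);; ri ::= Reg ri +\<^sub>e Const 1)"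

text \<open>The range of candidates ends at a perfect square, so trial divisors below its root
  \<open>2 ^ \<rho> * M\<close> expose every composite candidate.\<close>

abbreviation bound_expr :: "nat \<Rightarrow> expr" where
  "bound_expr \<rho> \<equiv> (Const (2 ^ \<rho>) *\<^sub>e Reg rM) *\<^sub>e (Const (2 ^ \<rho>) *\<^sub>e Reg rM)"

text \<open>The threshold makes the accepted primes large and the divisibility test makes them
  distinct. The flag \<open>rok\<close> enters arithmetically: a rejected candidate contributes the
  factor 1.\<close>

definition trial_prog :: "nat \<Rightarrow> nat \<Rightarrow> com" where
  "trial_prog k \<rho> =
     (rok ::= (Reg rcnt <\<^sub>e Const k) *\<^sub>e
        ((bound_expr \<rho> div\<^sub>e (Const (8 * (\<rho> + 1)) *\<^sub>e Reg rL) <\<^sub>e Reg rv) *\<^sub>e (Const 0 <\<^sub>e Reg rN mod\<^sub>e Reg rv));;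
      ri ::= Const 2;;
      While (Reg ri <\<^sub>e Const (2 ^ \<rho>) *\<^sub>e Reg rM) divide_body;;
      rN ::= Reg rN *\<^sub>e (Reg rok *\<^sub>e Reg rv +\<^sub>e (Const 1 -\<^sub>e Reg rok));;
      rcnt ::= Reg rcnt +\<^sub>e Reg rok;;
      rt ::= Reg rt -\<^sub>e Const 1)"

definition prime_loop :: "nat \<Rightarrow> nat \<Rightarrow> com" where
  "prime_loop k \<rho> =
     While (Const 0 <\<^sub>e Reg rt) (Random rv (bound_expr \<rho> -\<^sub>e Const 1);; trial_prog k \<rho>)"

text \<open>The factor \<open>2 ^ \<rho>\<close> enlarges the range by a constant, to outweigh
  \<open>k\<close> and the constants in the density of primes; 6 is the least exponent with 8
  (\<rho> + 1) \<le> 2^\<rho>. The bound \<open>M \<le> 2 * m\<close> keeps a trial division linear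
  in \<open>m\<close>.\<close>

locale prime_search =
  fixes w m M L k \<rho> \<kappa> :: nat
  assumes M: "M = 2 ^ L" and m: "0 < m" "m < M" "M \<le> 2 * m" and L: "0 < L" and \<rho>: "6 \<le> \<rho>" "k \<le> \<rho>"
    and word: "((2 ^ \<rho> * M) ^ 2) ^ (k + 1) < 2 ^ w" "\<kappa> * L * L < 2 ^ w" "16 < (2::nat) ^ w"
begin

definition Q :: nat where "Q = (2 ^ \<rho> * M) ^ 2"
definition T :: nat where "T = Q div (8 * (\<rho> + 1) * L)"

lemma w: "0 < w" using word(3) by (cases w) auto

lemma eval_Const [simp]: "c \<le> 16 \<Longrightarrow> eval_expr w s (Const c) = c"
  using word(3) by (intro eval_binop_exact) linarith

lemma eval_compare [simp]:
  "eval_binop w Less i j = of_bool (i < j)" "eval_binop w Equal i j = of_bool (i = j)"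
  using w by (rule eval_binop_exact)+

lemma M2: "2 \<le> M" using L unfolding M by (cases L) auto

lemma Q_eq: "Q = 2 ^ (2 * (\<rho> + L))"
  unfolding Q_def by (simp only: M power_add[symmetric] power_mult[symmetric] mult.commute[of 2])

lemma Q_pos: "1 \<le> Q" by (simp add: Q_eq)

lemma Q_word: "j \<le> k + 1 \<Longrightarrow> Q ^ j < 2 ^ w"
  using word(1) Q_pos power_increasing[of j "k + 1" Q] unfolding Q_def by linarith

lemma Q_less: "Q < 2 ^ w" using Q_word[of 1] by simp

lemma L_less_M: "L < M" unfolding M by (rule less_exp)

lemma RM_bounds: "8 * (\<rho> + 1) * L \<le> 2 ^ \<rho> * M" "2 \<le> 2 ^ \<rho> * M" "2 ^ \<rho> * M \<le> Q" "2 ^ \<rho> * M \<le> T"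
proof -
  have *: "8 * (\<rho> + 1) \<le> 2 ^ \<rho>" using \<rho>(1) by (induction \<rho> rule: nat_induct_at_least) simp_all
  show *: "8 * (\<rho> + 1) * L \<le> 2 ^ \<rho> * M"
    by (rule mult_le_mono[OF * less_imp_le[OF L_less_M]])
  show "2 \<le> 2 ^ \<rho> * M" using mult_le_mono[OF _ M2, of 1 "2 ^ \<rho>"] by simp
  show "2 ^ \<rho> * M \<le> Q" unfolding Q_def power2_eq_square by (rule le_square)
  have "2 ^ \<rho> * M * (8 * (\<rho> + 1) * L) \<le> Q"
    unfolding Q_def power2_eq_square by (rule mult_le_mono[OF le_refl *])
  then show "2 ^ \<rho> * M \<le> T" unfolding T_def using L by (subst less_eq_div_iff_mult_less_eq) auto
qed

lemma k_word: "k < 2 ^ w" "2 ^ \<rho> < (2::nat) ^ w" "8 * (\<rho> + 1) < 2 ^ w" "8 * (\<rho> + 1) * L < 2 ^ w"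
  "2 ^ \<rho> * M < 2 ^ w" "M < 2 ^ w"
proof -
  have "\<rho> < 2 ^ \<rho>" by (rule less_exp)
  moreover have "2 ^ \<rho> \<le> 2 ^ \<rho> * M" "M \<le> 2 ^ \<rho> * M" using M2 by auto
  moreover have "8 * (\<rho> + 1) \<le> 8 * (\<rho> + 1) * L" using L by simp
  ultimately show "k < 2 ^ w" "2 ^ \<rho> < (2::nat) ^ w" "8 * (\<rho> + 1) < 2 ^ w" "8 * (\<rho> + 1) * L < 2 ^ w"
      "2 ^ \<rho> * M < 2 ^ w" "M < 2 ^ w"
    using RM_bounds Q_less \<rho>(2) by linarith+
qed

lemma eval_RM: "regs s rM = M \<Longrightarrow> eval_expr w s (Const (2 ^ \<rho>) *\<^sub>e Reg rM) = 2 ^ \<rho> * M"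
  using k_word by (simp add: eval_binop_exact)

lemma eval_bound: "regs s rM = M \<Longrightarrow> eval_expr w s (bound_expr \<rho>) = Q"
  using Q_less eval_RM[of s] by (simp add: eval_binop_exact(3) Q_def power2_eq_square)

lemma size_prog:
  assumes s: "tape s = m # xs" "regs s = (\<lambda>_. 0)"
  shows "det w size_prog s (\<lambda>t s'. t \<le> 5 * L + 10 \<and> mem s' = mem s \<and> tape s' = xs \<and>
     regs s' rm = m \<and> regs s' rM = M \<and> regs s' rL = L)"
proof -
  have mw: "take_bit w m = m" using k_word m by (simp add: take_bit_nat_eq_self)
  define I where "I n s' \<longleftrightarrow> (\<exists>l \<le> L. n = 5 * (L - l) \<and> regs s' rm = m \<and> regs s' rM = 2 ^ l \<and> regs s' rL = l \<and>
    mem s' = mem s \<and> tape s' = xs)" for n and s' :: state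
  have low: "2 ^ l \<le> m" if "l < L" for l
  proof -
    have "2 * 2 ^ l \<le> M" unfolding M power_Suc[symmetric] using that by (intro power_increasing) auto
    then show ?thesis using m by simp
  qed
  have step: "det w size_body s1 (\<lambda>t s'. \<exists>n'. I n' s' \<and> t + n' + 2 \<le> n)"
    if I: "I n s1" and g: "eval_expr w s1 ((Reg rm <\<^sub>e Reg rM) =\<^sub>e Const 0) \<noteq> 0" for n s1
  proof -
    from I obtain l where l: "l \<le> L" "n = 5 * (L - l)" "regs s1 rm = m" "regs s1 rM = 2 ^ l" "regs s1 rL = l"
      "mem s1 = mem s" "tape s1 = xs" unfolding I_def by blast
    have "l \<noteq> L" using g l m by (auto simp: M split: if_splits)
    then have lL: "Suc l \<le> L" using l by simp
    have p: "2 ^ l * 2 \<le> M" unfolding M power_Suc2[symmetric] using lL by (intro power_increasing) auto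
    have e1: "eval_expr w s1 (Reg rM *\<^sub>e Const 2) = 2 ^ Suc l"
      using p k_word(6) by (simp add: eval_binop_exact l)
    have e2: "eval_expr w (set_reg rM (2 ^ Suc l) s1) (Reg rL +\<^sub>e Const 1) = Suc l"
      using lL L_less_M k_word(6) by (simp add: eval_binop_exact l)
    show ?thesis
      unfolding size_body_def
      apply (intro det_Seq det_Assign)
      unfolding e1 e2
      apply (rule exI[where x = "5 * (L - Suc l)"])
      unfolding I_def
      apply (intro conjI exI[where x = "Suc l"])
      using lL l by simp_all
  qed
  have start: "I (5 * L) (set_reg rL 0 (set_reg rM 1 (set_reg rm m (s\<lparr>tape := xs\<rparr>))))"
    unfolding I_def by (intro exI[where x = 0]) simp
  show ?thesis
    unfolding size_prog_def
    apply (intro det_Seq det_Read[OF s(1)] det_Assign)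
    unfolding mw eval_Const[of 0, OF zero_le] eval_Const[of 1, OF one_le_numeral]
    apply (rule det_mono[OF det_While[of I, OF step start]])
      apply assumption+
    subgoal premises p for t s'
    proof -
      from p obtain n' where n': "I n' s'" "eval_expr w s' ((Reg rm <\<^sub>e Reg rM) =\<^sub>e Const 0) = 0" "t + n' \<le> 5 * L + 1"
        by blast
      from n'(1) obtain l where l: "l \<le> L" "regs s' rm = m" "regs s' rM = 2 ^ l" "regs s' rL = l"
      "mem s' = mem s" "tape s' = xs" unfolding I_def by blast
      have "l = L" using n'(2) l low[of l] by (cases "l < L") auto
      with l n'(3) show ?thesis by (simp add: M)
    qed
    done
qed

definition accept :: "nat \<Rightarrow> nat \<Rightarrow> nat \<Rightarrow> bool" where
  "accept cnt n v \<longleftrightarrow> cnt < k \<and> T < v \<and> prime v \<and> \<not> v dvd n"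

text \<open>Two factors that are both at least the root of \<open>Q\<close> have a product of at
  least \<open>Q\<close>. Conversely, as \<open>T\<close> is at least that root, all trial divisors
  are smaller than \<open>v\<close>, and a prime \<open>v\<close> passes.\<close>

lemma prime_trial:
  assumes "T < v" "v < Q"
  shows "prime v \<longleftrightarrow> (\<forall>i. 2 \<le> i \<longrightarrow> i < 2 ^ \<rho> * M \<longrightarrow> 0 < v mod i)"
proof
  assume p: "prime v"
  show "\<forall>i. 2 \<le> i \<longrightarrow> i < 2 ^ \<rho> * M \<longrightarrow> 0 < v mod i"
  proof (intro allI impI)
    fix i assume i: "2 \<le> i" "i < 2 ^ \<rho> * M"
    then have "i < v" using RM_bounds assms by linarith
    with p i have "\<not> i dvd v" by (auto simp: prime_nat_iff)
    then show "0 < v mod i" by (simp add: mod_greater_zero_iff_not_dvd)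
  qed
next
  assume *: "\<forall>i. 2 \<le> i \<longrightarrow> i < 2 ^ \<rho> * M \<longrightarrow> 0 < v mod i"
  have v: "2 \<le> v" using RM_bounds assms by linarith
  show "prime v"
  proof (rule ccontr)
    assume "\<not> prime v"
    with v obtain a where a: "a dvd v" "a \<noteq> 1" "a \<noteq> v" by (auto simp: prime_nat_iff)
    then obtain c where c: "v = a * c" by blast
    have "a \<noteq> 0" "c \<noteq> 0" "c \<noteq> 1" using a c v by (auto intro!: Nat.gr0I)
    with a(2) have nz: "2 \<le> a" "2 \<le> c" by linarith+
    have big: "2 ^ \<rho> * M \<le> i" if "2 \<le> i" "v mod i = 0" for i
    proof (rule ccontr)
      assume "\<not> 2 ^ \<rho> * M \<le> i"
      then have "0 < v mod i" using *[rule_format, OF that(1)] by simp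
      with that(2) show False by simp
    qed
    have "2 ^ \<rho> * M \<le> a" using nz(1) by (rule big) (simp add: c)
    moreover have "2 ^ \<rho> * M \<le> c" using nz(2) by (rule big) (simp add: c)
    ultimately have "Q \<le> v" unfolding c Q_def power2_eq_square by (rule mult_le_mono)
    with assms show False by simp
  qed
qed

definition search_inv :: "nat list \<Rightarrow> nat \<Rightarrow> state \<Rightarrow> bool" where
  "search_inv xs n s \<longleftrightarrow> regs s rm = m \<and> regs s rM = M \<and> regs s rL = L \<and> regs s rt = n \<and> n < 2 ^ w \<and>
     tape s = xs \<and> mem s = (\<lambda>_. 0) \<and>
     (\<exists>A. finite A \<and> (\<forall>p \<in> A. prime p \<and> T < p \<and> p < Q) \<and> card A = regs s rcnt \<and> regs s rcnt \<le> k \<and> regs s rN = \<Prod>A)"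

lemma trial_prog:
  assumes I: "search_inv xs (Suc n) s" and v: "v < Q" "regs s0 = (regs s)(rv := v)" "mem s0 = mem s" "tape s0 = tape s"
  shows "det w (trial_prog k \<rho>) s0 (\<lambda>t s'. t \<le> 5 * (2 ^ \<rho> * M) + 12 \<and> search_inv xs n s' \<and>
      regs s' rcnt = regs s rcnt + of_bool (accept (regs s rcnt) (regs s rN) v))"
proof -
  from I obtain A where r: "regs s rm = m" "regs s rM = M" "regs s rL = L" "regs s rt = Suc n" "Suc n < 2 ^ w"
    "tape s = xs" "mem s = (\<lambda>_. 0)" and A: "finite A" "\<forall>p \<in> A. prime p \<and> T < p \<and> p < Q" "card A = regs s rcnt"
    "regs s rcnt \<le> k" "regs s rN = \<Prod>A" unfolding search_inv_def by blast
  define cnt where "cnt = regs s rcnt"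
  define n0 where "n0 = regs s rN"
  have n0: "n0 \<le> Q ^ cnt"
    using prod_mono[of A "\<lambda>x. x" "\<lambda>_. Q"] A by (auto simp: n0_def cnt_def less_imp_le)
  have n0w: "n0 < 2 ^ w" using n0 Q_word[of cnt] A(4) by (simp add: cnt_def)
  have n0_pos: "0 < n0" using A by (auto simp: n0_def prime_gt_0_nat intro!: prod_pos)
  have w1: "1 < (2::nat) ^ w" using word(3) by linarith
  define ok0 where "ok0 \<longleftrightarrow> cnt < k \<and> T < v \<and> 0 < n0 mod v"
  let ?e = "(Reg rcnt <\<^sub>e Const k) *\<^sub>e
        ((bound_expr \<rho> div\<^sub>e (Const (8 * (\<rho> + 1)) *\<^sub>e Reg rL) <\<^sub>e Reg rv) *\<^sub>e (Const 0 <\<^sub>e Reg rN mod\<^sub>e Reg rv))"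
  have eT: "eval_expr w s0 (bound_expr \<rho> div\<^sub>e (Const (8 * (\<rho> + 1)) *\<^sub>e Reg rL)) = T"
  proof -
    have "eval_expr w s0 (bound_expr \<rho>) = Q" using v(2) r(2) by (intro eval_bound) simp
    moreover have "eval_expr w s0 (Const (8 * (\<rho> + 1)) *\<^sub>e Reg rL) = 8 * (\<rho> + 1) * L"
      using v(2) r(3) k_word(3,4) by (simp add: eval_binop_exact(3,8))
    ultimately show ?thesis using Q_less by (simp only: eval_expr.simps(5) eval_binop_exact(4) T_def)
  qed
  have e1: "eval_expr w s0 ?e = of_bool ok0"
  proof -
    have "eval_expr w s0 (Reg rN mod\<^sub>e Reg rv) = n0 mod v" "eval_expr w s0 (Const k) = k"
      using v(2) n0w k_word(1) by (simp_all add: eval_binop_exact n0_def)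
    then show ?thesis unfolding eval_expr.simps(5)[of w s0 Mul] eval_expr.simps(5)[of w s0 Less] eT
      using w1 v(2) by (simp add: eval_binop_exact(3) ok0_def cnt_def)
  qed
  have c2: "eval_expr w s' (Const 2) = 2" for s' by simp
  define s1 where "s1 = set_reg ri 2 (set_reg rok (of_bool ok0) s0)"
  define J where "J l s' \<longleftrightarrow> (\<exists>i. 2 \<le> i \<and> i \<le> 2 ^ \<rho> * M \<and> l = 5 * (2 ^ \<rho> * M - i) \<and> regs s' ri = i \<and>
     regs s' rok = of_bool (ok0 \<and> (\<forall>i'. 2 \<le> i' \<longrightarrow> i' < i \<longrightarrow> 0 < v mod i')) \<and> mem s' = mem s \<and> same_but {rok, ri} s0 s')" for l s'
  have cond: "eval_expr w s' (Reg ri <\<^sub>e Const (2 ^ \<rho>) *\<^sub>e Reg rM) = of_bool (regs s' ri < 2 ^ \<rho> * M)"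
    if "same_but {rok, ri} s0 s'" for s'
    using eval_RM[of s'] same_but_regs[OF that] v(2) r(2) by (simp del: eval_expr.simps(5) add: eval_expr.simps(5)[of w s' Less])
  have step: "det w divide_body s2 (\<lambda>t s'. \<exists>n'. J n' s' \<and> t + n' + 2 \<le> l)"
    if J: "J l s2" and g: "eval_expr w s2 (Reg ri <\<^sub>e Const (2 ^ \<rho>) *\<^sub>e Reg rM) \<noteq> 0" for l s2
  proof -
    from J obtain i where i: "2 \<le> i" "i \<le> 2 ^ \<rho> * M" "l = 5 * (2 ^ \<rho> * M - i)" "regs s2 ri = i"
     "regs s2 rok = of_bool (ok0 \<and> (\<forall>i'. 2 \<le> i' \<longrightarrow> i' < i \<longrightarrow> 0 < v mod i'))" "mem s2 = mem s"
      and sb: "same_but {rok, ri} s0 s2" unfolding J_def by blast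
    have il: "i < 2 ^ \<rho> * M" using g unfolding cond[OF sb] i(4) by (simp split: if_splits)
    have rv2: "regs s2 rv = v" using same_but_regs[OF sb] v(2) by simp
    have all: "(\<forall>i'. 2 \<le> i' \<longrightarrow> i' < Suc i \<longrightarrow> 0 < v mod i') \<longleftrightarrow>
        (\<forall>i'. 2 \<le> i' \<longrightarrow> i' < i \<longrightarrow> 0 < v mod i') \<and> 0 < v mod i"
      using i(1) by (auto simp: less_Suc_eq)
    have e2: "eval_expr w s2 (Reg rok *\<^sub>e (Const 0 <\<^sub>e Reg rv mod\<^sub>e Reg ri)) =
       of_bool (ok0 \<and> (\<forall>i'. 2 \<le> i' \<longrightarrow> i' < Suc i \<longrightarrow> 0 < v mod i'))" (is "_ = ?c")
      unfolding all using v(1) Q_less w1 rv2 i(4,5) by (simp add: eval_binop_exact)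
    have e3: "eval_expr w (set_reg rok ?c s2) (Reg ri +\<^sub>e Const 1) = Suc i"
      using il k_word(5) i(4) by (simp add: eval_binop_exact)
    show ?thesis
      unfolding divide_body_def
      apply (intro det_Seq det_Assign)
      unfolding e2 e3
      apply (rule exI[where x = "5 * (2 ^ \<rho> * M - Suc i)"])
      unfolding J_def
      apply (intro conjI exI[where x = "Suc i"])
      using il i sb by (simp_all add: same_but_def)
  qed
  have start: "J (5 * (2 ^ \<rho> * M)  - 10) s1"
    unfolding J_def using RM_bounds(2) v(3)
    by (intro exI[where x = 2]) (simp add: s1_def same_but_def diff_mult_distrib2)
  show ?thesis
    unfolding trial_prog_def
    apply (intro det_Seq det_Assign)
    unfolding e1 c2 s1_def[symmetric]
    apply (rule det_mono[OF det_While[of J, OF step start]])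
      apply assumption+
    subgoal premises p for t s2
    proof -
      from p obtain l where l: "J l s2" "eval_expr w s2 (Reg ri <\<^sub>e Const (2 ^ \<rho>) *\<^sub>e Reg rM) = 0"
        "t + l \<le> 5 * (2 ^ \<rho> * M) - 10 + 1" by blast
      from l(1) obtain i where i: "i \<le> 2 ^ \<rho> * M" "regs s2 ri = i"
        "regs s2 rok = of_bool (ok0 \<and> (\<forall>i'. 2 \<le> i' \<longrightarrow> i' < i \<longrightarrow> 0 < v mod i'))" "mem s2 = mem s"
        and sb: "same_but {rok, ri} s0 s2" unfolding J_def by blast
      have "i = 2 ^ \<rho> * M" using l(2) i unfolding cond[OF sb] by simp
      with i have "regs s2 rok = of_bool (ok0 \<and> (\<forall>i'. 2 \<le> i' \<longrightarrow> i' < 2 ^ \<rho> * M \<longrightarrow> 0 < v mod i'))" by simp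
      also have "(ok0 \<and> (\<forall>i'. 2 \<le> i' \<longrightarrow> i' < 2 ^ \<rho> * M \<longrightarrow> 0 < v mod i')) \<longleftrightarrow> accept cnt n0 v"
      proof (cases "T < v")
        case True
        show ?thesis
          unfolding ok0_def accept_def prime_trial[OF True v(1)] mod_greater_zero_iff_not_dvd by blast
      qed (simp add: ok0_def accept_def)
      finally have ok: "regs s2 rok = of_bool (accept cnt n0 v)" .
      note s2r = same_but_regs[OF sb]
      define n1 where "n1 = (if accept cnt n0 v then n0 * v else n0)"
      define A' where "A' = (if accept cnt n0 v then insert v A else A)"
      have vA: "v \<notin> A" if "accept cnt n0 v"
        using that A(5) dvd_prodI[OF A(1), of v "\<lambda>x. x"] by (auto simp: accept_def n0_def)
      have "finite A' \<and> (\<forall>p \<in> A'. prime p \<and> T < p \<and> p < Q) \<and>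
          card A' = cnt + of_bool (accept cnt n0 v) \<and> n1 = \<Prod>A' \<and> cnt + of_bool (accept cnt n0 v) \<le> k"
      proof (cases "accept cnt n0 v")
        case True
        then have "prime v" "T < v" "cnt < k" by (simp_all add: accept_def)
        with A True vA v(1) show ?thesis
          by (simp add: A'_def n1_def n0_def cnt_def mult.commute)
      next
        case False
        with A show ?thesis by (simp add: A'_def n1_def n0_def cnt_def)
      qed
      then have A': "finite A'" "\<forall>p \<in> A'. prime p \<and> T < p \<and> p < Q" "card A' = cnt + of_bool (accept cnt n0 v)"
        "n1 = \<Prod>A'" "cnt + of_bool (accept cnt n0 v) \<le> k"
        by blast+
      have n1w: "n1 < 2 ^ w"
      proof (cases "accept cnt n0 v")
        case True
        then have "n1 \<le> Q ^ cnt * Q" using n0 v(1) by (auto simp: n1_def intro!: mult_le_mono)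
        also have "\<dots> = Q ^ Suc cnt" by simp
        also have "\<dots> < 2 ^ w" using True by (intro Q_word) (simp add: accept_def)
        finally show ?thesis .
      qed (simp add: n1_def n0w)
      have e4: "eval_expr w s2 (Reg rN *\<^sub>e (Reg rok *\<^sub>e Reg rv +\<^sub>e (Const 1 -\<^sub>e Reg rok))) = n1"
      proof -
        have "regs s2 rN = n0" "regs s2 rv = v" using s2r v(2) by (simp_all add: n0_def)
        then show ?thesis
          using n1w n0w v(1) ok Q_less w1 by (cases "accept cnt n0 v") (simp_all add: eval_binop_exact n1_def)
      qed
      have e5: "eval_expr w (set_reg rN n1 s2) (Reg rcnt +\<^sub>e Reg rok) = cnt + of_bool (accept cnt n0 v)"
        using A'(5) k_word(1) v(2) s2r ok by (simp add: eval_binop_exact cnt_def[symmetric])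
      have e6: "eval_expr w (set_reg rcnt c (set_reg rN n1 s2)) (Reg rt -\<^sub>e Const 1) = n" for c
        using v(2) s2r r by (simp add: eval_binop_exact)
      have "search_inv xs n (set_reg rt n (set_reg rcnt (cnt + of_bool (accept cnt n0 v)) (set_reg rN n1 s2)))"
        (is "search_inv xs n ?s")
        unfolding search_inv_def
      proof (intro conjI exI)
        show "finite A'" "\<forall>p \<in> A'. prime p \<and> T < p \<and> p < Q" using A' by auto
        have "regs s2 rm = m" "regs s2 rM = M" "regs s2 rL = L" "tape s2 = xs" "mem s2 = (\<lambda>_. 0)"
          using s2r v(2,4) r(1-3,6,7) i(4) same_but_tape[OF sb] by simp_all
        then show "regs ?s rm = m" "regs ?s rM = M" "regs ?s rL = L" "tape ?s = xs" "mem ?s = (\<lambda>_. 0)"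
          by simp_all
        show "card A' = regs ?s rcnt" "regs ?s rcnt \<le> k" "regs ?s rN = \<Prod>A'"
          using A' by simp_all
        show "regs ?s rt = n" "n < 2 ^ w" using r(5) by simp_all
      qed
      then show ?thesis
        apply (intro det_Seq det_Assign)
        unfolding e4 e5 e6
        using l(3) RM_bounds(2) by (simp add: cnt_def n0_def)
    qed
    done
qed

end

section \<open>Success probability of the prime search\<close>

context prime_search
begin

text \<open>An upper bound for the binary logarithm 2 (\<rho> + L) of \<open>Q\<close>, taken as a
  multiple of \<open>L\<close>. At least (Q - 1) / D primes lie up to \<open>Q\<close>, and the
  threshold \<open>T\<close>, the integer part of Q / (4 D), costs about a quarter of them at
  most.\<close>

definition D :: nat where "D = 2 * (\<rho> + 1) * L"

lemma D_pos: "0 < D" using L by (simp add: D_def)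

lemma D_4: "4 * D = 8 * (\<rho> + 1) * L" by (simp add: D_def algebra_simps)

lemma T_D: "T * (4 * D) \<le> Q"
  unfolding T_def D_4 by (rule div_times_less_eq_dividend)

lemma Q_D: "Q < (T + 1) * (4 * D)"
  using dividend_less_div_times[of "8 * (\<rho> + 1) * L" Q] L by (simp add: T_def D_def algebra_simps)

text \<open>Leaves room in \<open>card_accept\<close> for the primes already chosen and for the
  rounding.\<close>

lemma Q_large: "4 * D * (k + 1) + 4 \<le> Q"
proof -
  define X where "X = 2 ^ \<rho> * M"
  have "k + 1 \<le> 2 ^ \<rho>" using less_exp[of \<rho>] \<rho>(2) by linarith
  then have "(k + 1) * 2 \<le> X" unfolding X_def using M2 by (rule mult_le_mono)
  then have kX: "k + 2 \<le> X" by simp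
  have "4 * 1 \<le> X"
    unfolding X_def using \<rho>(1) M2 power_increasing[of 2 \<rho> "2::nat"] by (intro mult_le_mono) auto
  moreover have "4 * D \<le> X" using RM_bounds(1) unfolding D_4 X_def .
  then have "4 * D * (k + 1) \<le> X * (k + 1)" by (rule mult_le_mono1)
  ultimately have "4 * D * (k + 1) + 4 \<le> X * (k + 2)" by simp
  also have "\<dots> \<le> X * X" using kX by (rule mult_le_mono2)
  finally show ?thesis by (simp add: Q_def X_def power2_eq_square)
qed

text \<open>Of at least (Q - 1) / D primes, at most Q / (4 D) are lost to the threshold and fewer
  than \<open>k\<close> to earlier choices; a share of 1 / (2 D) of all candidates remains.\<close>

lemma card_accept:
  assumes A: "finite A" "\<forall>p \<in> A. prime p" "card A < k"
  shows "Q \<le> 2 * D * card {v. v < Q \<and> accept (card A) (\<Prod>A) v}"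
proof -
  let ?G = "{v. v < Q \<and> accept (card A) (\<Prod>A) v}"
  have "2 * 1 \<le> \<rho> + L" using \<rho>(1) by simp
  then have c: "4 \<le> 2 * (\<rho> + L)" by simp
  \<comment> \<open>Prime counting includes the bound \<open>Q\<close>, whereas candidates are drawn
    strictly below it.\<close>
  have "\<not> prime Q"
  proof
    assume "prime Q"
    moreover have "2 dvd Q" unfolding Q_eq using \<rho>(1) by (intro dvd_power) simp
    ultimately have "2 = Q" by (intro primes_dvd_imp_eq two_is_prime_nat)
    with Q_large show False by simp
  qed
  then have pQ: "v < Q" if "v \<in> primes_upto Q" for v
    using that by (cases "v = Q") (auto simp: primes_upto_def)
  have "primes_upto Q \<subseteq> ?G \<union> {1..T} \<union> A"
  proof
    fix v assume v: "v \<in> primes_upto Q"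
    then have pv: "prime v" by (simp add: primes_upto_def)
    have "\<not> v dvd \<Prod>A" if "v \<notin> A"
    proof
      assume "v dvd \<Prod>A"
      then obtain p where "p \<in> A" "v dvd p" using prime_dvd_prod_iff[OF A(1) pv] by auto
      then show False using A(2) pv that primes_dvd_imp_eq by blast
    qed
    then show "v \<in> ?G \<union> {1..T} \<union> A"
      using pv pQ[OF v] A(3) prime_ge_1_nat[OF pv] by (auto simp: accept_def)
  qed
  then have "card (primes_upto Q) \<le> card (?G \<union> {1..T} \<union> A)"
    using A(1) by (intro card_mono) auto
  also have "\<dots> \<le> card ?G + T + card A"
    using card_Un_le[of "?G \<union> {1..T}" A] card_Un_le[of ?G "{1..T}"] by simp
  finally have "card (primes_upto Q) \<le> card ?G + T + k" using A(3) by simp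
  then have "D * card (primes_upto Q) \<le> D * (card ?G + T + k)" by (rule mult_le_mono2)
  moreover have "Q - 1 \<le> D * card (primes_upto Q)"
  proof -
    have "\<rho> * 1 \<le> \<rho> * L" using L by (intro mult_le_mono2) simp
    then have "2 * (\<rho> + L) \<le> D" by (simp add: D_def algebra_simps)
    then have "2 * (\<rho> + L) * card (primes_upto Q) \<le> D * card (primes_upto Q)" by (rule mult_le_mono1)
    moreover have "Q - 1 \<le> 2 * (\<rho> + L) * card (primes_upto Q)"
      unfolding Q_eq by (rule card_primes_lower_bound) (use c in linarith)
    ultimately show ?thesis by linarith
  qed
  ultimately have "Q - 1 \<le> D * (card ?G + T + k)" by (rule order_trans[rotated])
  moreover have "T * (4 * D) \<le> Q" "4 * D * (k + 1) + 4 \<le> Q" by (rule T_D, rule Q_large)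
  ultimately have "2 * Q \<le> 4 * (D * card ?G)"
    by (simp add: algebra_simps)
  then show ?thesis by simp
qed

text \<open>Each trial succeeds with probability at least \<open>1 / (2 * D)\<close> and then halves the potential, which
  bounds the probability of ending with fewer than \<open>k\<close> primes.\<close>

definition pot :: "nat \<Rightarrow> nat \<Rightarrow> real" where
  "pot cnt n = (if cnt < k then 2 ^ (k - cnt) * (1 - 1 / (4 * real D)) ^ n else 0)"

lemma q_nonneg: "0 \<le> 1 - 1 / (4 * real D)"
  using D_pos by (simp add: field_simps)

lemma pot_nonneg: "0 \<le> pot cnt n"
  using q_nonneg by (simp add: pot_def)

text \<open>A loss of at least one half with probability at least 1 / (2 D) gives the expected
  factor 1 - 1 / (4 D); the last success even brings the potential to 0. The constant
  \<open>e\<close> reserves the error of the later choice of \<open>b\<close>.\<close>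

lemma pot_step:
  assumes A: "finite A" "\<forall>p \<in> A. prime p" "card A \<le> k"
  shows "(\<Sum>v<Q. e + pot (card A + of_bool (accept (card A) (\<Prod>A) v)) n) \<le> real Q * (e + pot (card A) (Suc n))"
proof (cases "card A < k")
  case False
  then show ?thesis by (simp add: pot_def accept_def)
next
  case True
  define G where "G = {v. v < Q \<and> accept (card A) (\<Prod>A) v}"
  define H where "H = 2 ^ (k - card A) * (1 - 1 / (4 * real D)) ^ n"
  have H: "0 \<le> H" using q_nonneg by (simp add: H_def)
  have le: "pot (card A + of_bool P) n \<le> H - H / 2 * of_bool P" for P
  proof (cases P)
    case True
    have "pot (Suc (card A)) n \<le> H / 2"
    proof (cases "Suc (card A) < k")
      case True
      then have "k - card A = Suc (k - Suc (card A))" by simp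
      then have "H = 2 * pot (Suc (card A)) n" using True by (simp add: pot_def H_def)
      then show ?thesis by simp
    qed (use H in \<open>simp add: pot_def\<close>)
    with True show ?thesis by simp
  qed (use True in \<open>simp add: pot_def H_def\<close>)
  have "(\<Sum>v<Q. e + pot (card A + of_bool (accept (card A) (\<Prod>A) v)) n) \<le>
      (\<Sum>v<Q. (e + H) - H / 2 * of_bool (accept (card A) (\<Prod>A) v))"
    using le by (intro sum_mono) (smt (verit))
  also have "\<dots> = real Q * (e + H) - H / 2 * real (card G)"
  proof -
    have "{..<Q} \<inter> {v. accept (card A) (\<Prod>A) v} = G" by (auto simp: G_def)
    then have "(\<Sum>v<Q. of_bool (accept (card A) (\<Prod>A) v)) = real (card G)" by simp
    then show ?thesis
      unfolding sum_subtractf sum_distrib_left[symmetric] by simp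
  qed
  also have "\<dots> \<le> real Q * (e + H) - H / 2 * (real Q / (2 * real D))"
  proof -
    have "real Q \<le> 2 * real D * real (card G)"
      using card_accept[OF A(1,2) True] unfolding G_def[symmetric]
      by (metis of_nat_le_iff of_nat_mult of_nat_numeral)
    then have "real Q / (2 * real D) \<le> real (card G)" using D_pos by (simp add: field_simps)
    then have "H / 2 * (real Q / (2 * real D)) \<le> H / 2 * real (card G)"
      using H by (intro mult_left_mono) auto
    then show ?thesis by simp
  qed
  also have "\<dots> = real Q * (e + H * (1 - 1 / (4 * real D)))"
    using D_pos by (simp add: field_simps)
  also have "H * (1 - 1 / (4 * real D)) = pot (card A) (Suc n)"
    using True by (simp add: pot_def H_def)
  finally show ?thesis .
qed

definition potential :: "nat list \<Rightarrow> real \<Rightarrow> nat \<Rightarrow> state \<Rightarrow> ennreal" where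
  "potential xs e n s = (if search_inv xs n s then ennreal (e + pot (regs s rcnt) n) else \<infinity>)"

lemma prime_loop:
  assumes e: "0 \<le> e"
  shows "expect w (prime_loop k \<rho>) s (n * (5 * (2 ^ \<rho> * M) + 16) + 1) (potential xs e 0) (potential xs e n s)"
proof -
  let ?body = "Random rv (bound_expr \<rho> -\<^sub>e Const 1);; trial_prog k \<rho>"
  have "expect w ?body s (5 * (2 ^ \<rho> * M) + 14) (potential xs e n) (potential xs e (Suc n) s)"
    if I: "search_inv xs (Suc n) s" for n s
  proof -
    define G where "G s' = (if \<exists>v < Q. s' = set_reg rv v s then
      ennreal (e + pot (regs s rcnt + of_bool (accept (regs s rcnt) (regs s rN) (regs s' rv))) n) else \<infinity>)" for s'
    from I obtain A where A: "finite A" "\<forall>p \<in> A. prime p" "card A = regs s rcnt" "regs s rcnt \<le> k"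
      "regs s rN = \<Prod>A" and rM: "regs s rM = M" unfolding search_inv_def by blast
    have ev: "eval_expr w s (bound_expr \<rho> -\<^sub>e Const 1) = Q - 1"
      using eval_bound[OF rM] Q_pos Q_less by (simp add: eval_binop_exact(2) del: eval_expr.simps(5) add: eval_expr.simps(5)[of w s Sub])
    have range: "{0..Q - 1} = {..<Q}" using Q_pos by auto
    have 1: "expect w (Random rv (bound_expr \<rho> -\<^sub>e Const 1)) s 1 G (potential xs e (Suc n) s)"
    proof (rule expect_Random)
      have "(\<integral>\<^sup>+v. G (set_reg rv v s) \<partial>measure_pmf (pmf_of_set {..<Q})) = (\<Sum>v<Q. G (set_reg rv v s)) / of_nat Q"
        using Q_pos by (subst nn_integral_pmf_of_set) (auto simp: lessThan_empty_iff)
      also have "(\<Sum>v<Q. G (set_reg rv v s)) =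
        (\<Sum>v<Q. ennreal (e + pot (card A + of_bool (accept (card A) (\<Prod>A) v)) n))"
        unfolding A(3,5)[symmetric] by (intro sum.cong) (auto simp: G_def A)
      also have "\<dots> = ennreal (\<Sum>v<Q. e + pot (card A + of_bool (accept (card A) (\<Prod>A) v)) n)"
        using e pot_nonneg by (intro sum_ennreal) auto
      also have "\<dots> / of_nat Q \<le> ennreal (real Q * (e + pot (card A) (Suc n))) / of_nat Q"
        using A by (intro divide_right_mono_ennreal ennreal_leI pot_step) auto
      also have "\<dots> = ennreal (e + pot (card A) (Suc n))"
        unfolding ennreal_of_nat_eq_real_of_nat using Q_pos e pot_nonneg by (subst divide_ennreal) auto
      finally show "(\<integral>\<^sup>+v. G (set_reg rv v s) \<partial>measure_pmf (pmf_of_set {0..eval_expr w s (bound_expr \<rho> -\<^sub>e Const 1)})) \<le> potential xs e (Suc n) s"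
        unfolding ev range using I A(3) by (simp add: potential_def)
    qed
    have 2: "expect w (trial_prog k \<rho>) s' (5 * (2 ^ \<rho> * M) + 12) (potential xs e n) (G s')" for s'
    proof (rule expect_det)
      assume "G s' < \<infinity>"
      then obtain v where v: "v < Q" "s' = set_reg rv v s" by (auto simp: G_def split: if_splits)
      show "det w (trial_prog k \<rho>) s' (\<lambda>t s''. t \<le> 5 * (2 ^ \<rho> * M) + 12 \<and> potential xs e n s'' \<le> G s')"
        by (rule det_mono[OF trial_prog[OF I v(1)]]) (use v in \<open>auto simp: potential_def G_def\<close>)
    qed
    show ?thesis by (rule expect_Seq[OF 1 2]) simp
  qed
  then have step: "eval_expr w s (Const 0 <\<^sub>e Reg rt) \<noteq> 0 \<and>
     expect w ?body s (5 * (2 ^ \<rho> * M) + 14) (potential xs e n) (potential xs e (Suc n) s)"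
    if "potential xs e (Suc n) s < \<infinity>" for n s
    using that by (auto simp: potential_def search_inv_def split: if_splits)
  have stop: "eval_expr w s (Const 0 <\<^sub>e Reg rt) = 0" if "potential xs e 0 s < \<infinity>" for s
    using that by (auto simp: potential_def search_inv_def split: if_splits)
  show ?thesis
    unfolding prime_loop_def
    using expect_While[of "potential xs e", OF step stop, where n = n and s = s]
    by (simp only: add.assoc numeral_plus_numeral add_num_simps)
qed

end

section \<open>Error probability\<close>

definition test_poly :: "nat \<Rightarrow> nat set \<Rightarrow> nat \<Rightarrow> nat \<Rightarrow> nat \<Rightarrow> int poly" where
  "test_poly m S x a c = (\<Sum>i\<in>{a..<c}. monom (of_bool (i \<in> S) - of_bool ((i + x) mod m \<in> S)) (i + x))"

lemma degree_test_poly: "x < m \<Longrightarrow> c \<le> m \<Longrightarrow> degree (test_poly m S x a c) \<le> 2 * m"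
  unfolding test_poly_def by (intro degree_sum_le) (auto intro: order_trans[OF degree_monom_le])

text \<open>The exponents \<open>i + x\<close> are distinct, so no two terms combine: at a
  difference the coefficient is 1 or -1, which no prime divides.\<close>

lemma test_poly_nonzero_mod:
  assumes "a \<le> i" "i < c" "(i \<in> S) \<noteq> ((i + x) mod m \<in> S)" "prime (p::nat)"
  shows "\<not> (\<forall>j. int p dvd coeff (test_poly m S x a c) j)"
proof
  assume "\<forall>j. int p dvd coeff (test_poly m S x a c) j"
  then have "int p dvd coeff (test_poly m S x a c) (i + x)" by blast
  also have "coeff (test_poly m S x a c) (i + x) =
      (\<Sum>i'\<in>{a..<c}. if i' = i then of_bool (i \<in> S) - of_bool ((i + x) mod m \<in> S) else 0)"
    unfolding test_poly_def coeff_sum by (intro sum.cong) auto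
  also have "\<dots> = of_bool (i \<in> S) - of_bool ((i + x) mod m \<in> S)"
    using assms(1,2) by simp
  finally have "int p dvd 1" using assms(3) by (auto split: if_splits)
  with assms(4) show False by (auto simp: prime_nat_iff)
qed

definition reachable_sets :: "nat \<Rightarrow> nat list \<Rightarrow> nat set set" where
  "reachable_sets m xs = (\<lambda>j. subset_sums m (mset (take j xs))) ` {..length xs}"

text \<open>The sets computed along the way form a chain, so there are at most \<open>m\<close> of them,
  however long the input is.\<close>

lemma card_reachable_sets:
  assumes "0 < m"
  shows "card (reachable_sets m xs) \<le> m"
proof -
  let ?S = "\<lambda>j. subset_sums m (mset (take j xs))"
  have mono: "?S i \<subseteq> ?S j" if "i \<le> j" for i j
  proof -
    have "mset (take i xs) \<subseteq># mset (take j xs)"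
      using that by (metis mset_subset_eq_add_left mset_append take_add le_add_diff_inverse)
    then show ?thesis unfolding subset_sums_def by (auto intro: subset_mset.order_trans)
  qed
  have "inj_on card (reachable_sets m xs)"
  proof (rule inj_onI)
    fix A B assume "A \<in> reachable_sets m xs" "B \<in> reachable_sets m xs" and c: "card A = card B"
    then obtain i j where AB: "A = ?S i" "B = ?S j" unfolding reachable_sets_def by blast
    then have "A \<subseteq> B \<or> B \<subseteq> A" using mono by (metis nat_le_linear)
    moreover have "finite A" "finite B" using AB finite_subset_sums by simp_all
    ultimately show "A = B" using c by (metis card_subset_eq)
  qed
  moreover have "card ` reachable_sets m xs \<subseteq> {1..m}"
  proof -
    have "1 \<le> card (?S j)" "card (?S j) \<le> m" for j
    proof -
      have "0 \<in> ?S j" unfolding subset_sums_def by (auto intro!: exI[where x = "{#}"])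
      then show "1 \<le> card (?S j)" using finite_subset_sums[of m "mset (take j xs)"]
        by (metis One_nat_def Suc_leI card_gt_0_iff empty_iff)
      show "card (?S j) \<le> m" using card_mono[OF _ subset_sums_less[OF assms]] by simp
    qed
    then show ?thesis unfolding reachable_sets_def by auto
  qed
  ultimately show ?thesis using card_inj_on_le[of card "reachable_sets m xs" "{1..m}"] by simp
qed

text \<open>Stated outside the locale that fixes \<open>b\<close>, so that the harmful values of
  \<open>b\<close> can be counted for a given \<open>N\<close>.\<close>

definition bad_bases :: "nat \<Rightarrow> nat \<Rightarrow> nat list \<Rightarrow> nat set" where
  "bad_bases m N xs = {b. b < N \<and> (\<exists>S \<in> reachable_sets m xs. \<exists>x \<in> {..<m}. \<exists>a \<in> {..m}. \<exists>c \<in> {..m}.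
     (\<exists>i. a \<le> i \<and> i < c \<and> (i \<in> S) \<noteq> ((i + x) mod m \<in> S)) \<and> int N dvd poly (test_poly m S x a c) (int b))}"

lemma card_bad_bases:
  assumes m: "0 < m" and A: "finite A" "\<forall>p \<in> A. prime p" "N = \<Prod>A"
  shows "card (bad_bases m N xs) \<le> m * m * ((m + 1) * (m + 1)) * (2 * m) ^ card A"
proof -
  let ?I = "reachable_sets m xs \<times> {..<m} \<times> {..m} \<times> {..m}"
  let ?R = "\<lambda>(S, x, a, c). {b. b < N \<and> (\<exists>i. a \<le> i \<and> i < c \<and> (i \<in> S) \<noteq> ((i + x) mod m \<in> S)) \<and>
     int N dvd poly (test_poly m S x a c) (int b)}"
  have fin: "finite (reachable_sets m xs)" by (simp add: reachable_sets_def)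
  have sub: "bad_bases m N xs \<subseteq> (\<Union>t\<in>?I. ?R t)"
  proof
    fix b assume "b \<in> bad_bases m N xs"
    then obtain S x a c where "S \<in> reachable_sets m xs" "x \<in> {..<m}" "a \<in> {..m}" "c \<in> {..m}" "b \<in> ?R (S, x, a, c)"
      unfolding bad_bases_def mem_Collect_eq prod.case by (elim conjE bexE) (rule that; simp)
    then show "b \<in> (\<Union>t\<in>?I. ?R t)" by (intro UN_I[where a = "(S, x, a, c)"] SigmaI)
  qed
  have "finite (?R t)" for t by (simp split: prod.split)
  then have "card (bad_bases m N xs) \<le> card (\<Union>t\<in>?I. ?R t)"
    using fin by (intro card_mono[OF _ sub] finite_UN_I) auto
  also have "\<dots> \<le> (\<Sum>t\<in>?I. card (?R t))"
    using fin by (intro card_UN_le) auto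
  finally have "card (bad_bases m N xs) \<le> (\<Sum>t\<in>?I. card (?R t))" .
  also have "\<dots> \<le> (\<Sum>t\<in>?I. (2 * m) ^ card A)"
  proof (rule sum_mono)
    fix t assume "t \<in> ?I"
    then obtain S x a c where t: "t = (S, x, a, c)" "x < m" "c \<le> m" by auto
    let ?d = "\<exists>i. a \<le> i \<and> i < c \<and> (i \<in> S) \<noteq> ((i + x) mod m \<in> S)"
    show "card (?R t) \<le> (2 * m) ^ card A"
    proof (cases ?d)
      case True
      then obtain i where i: "a \<le> i" "i < c" "(i \<in> S) \<noteq> ((i + x) mod m \<in> S)" by blast
      have nz: "\<forall>p \<in> A. \<not> (\<forall>j. int p dvd coeff (test_poly m S x a c) j)"
        by (rule ballI, rule test_poly_nonzero_mod[OF i]) (use A(2) in blast)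
      have "?R t \<subseteq> {b. b < \<Prod>A \<and> int (\<Prod>A) dvd poly (test_poly m S x a c) (int b)}"
        unfolding t A(3) prod.case by (rule Collect_mono) (intro impI, elim conjE, intro conjI)
      then have "card (?R t) \<le> card {b. b < \<Prod>A \<and> int (\<Prod>A) dvd poly (test_poly m S x a c) (int b)}"
        by (rule card_mono[rotated]) simp
      also have "\<dots> \<le> degree (test_poly m S x a c) ^ card A"
        by (rule card_poly_roots_mod_prod[OF A(1,2) nz])
      also have "\<dots> \<le> (2 * m) ^ card A" by (intro power_mono degree_test_poly t) auto
      finally show ?thesis .
    next
      case False
      then have "?R t = {}" unfolding t by auto
      then show ?thesis by simp
    qed
  qed
  also have "\<dots> = card (reachable_sets m xs) * m * ((m + 1) * (m + 1)) * (2 * m) ^ card A"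
    by (simp only: sum_constant of_nat_id card_cartesian_product card_lessThan card_atMost Suc_eq_plus1 mult.assoc)
  also have "\<dots> \<le> m * m * ((m + 1) * (m + 1)) * (2 * m) ^ card A"
    using card_reachable_sets[OF m] by (intro mult_le_mono) auto
  finally show ?thesis .
qed

context segment_tree
begin

lemma all_good_if_not_bad:
  assumes "b < N" "b \<notin> bad_bases m N xs"
  shows "all_good xs"
  unfolding all_good_def good_def
proof (intro allI impI notI)
  fix j x a c i
  assume *: "j \<le> length xs" "x < m" "a \<le> c" "c \<le> m" "E (subset_sums m (mset (take j xs))) x a = E (subset_sums m (mset (take j xs))) x c"
    "a \<le> i" "i < c" "diff (subset_sums m (mset (take j xs))) x i"
  define S where "S = subset_sums m (mset (take j xs))"
  have S: "S \<in> reachable_sets m xs" using *(1) by (auto simp: S_def reachable_sets_def)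
  have dvd: "int N dvd poly (test_poly m S x a c) (int b)"
    using *(5) unfolding S_def[symmetric] E_eq_iff[OF *(3,4,2)]
    by (simp add: test_poly_def poly_sum poly_monom shift_def)
  have diff: "(i \<in> S) \<noteq> ((i + x) mod m \<in> S)"
    using *(8) by (simp add: S_def[symmetric] diff_def shift_def)
  have in_range: "x \<in> {..<m}" "a \<in> {..m}" "c \<in> {..m}" using *(2-4) by auto
  have "b \<in> bad_bases m N xs"
    unfolding bad_bases_def mem_Collect_eq
    by (rule conjI[OF assms(1)], rule bexI[OF _ S], rule bexI[OF _ in_range(1)],
        rule bexI[OF _ in_range(2)], rule bexI[OF _ in_range(3)], rule conjI[OF _ dvd])
      (use *(6,7) diff in blast)
  with assms(2) show False by contradiction
qed

end

section \<open>The complete program and the choice of its constants\<close>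

definition init_prog :: "nat \<Rightarrow> com" where
  "init_prog \<kappa> = (size_prog;; rN ::= Const 1;; rcnt ::= Const 0;; rt ::= Const \<kappa> *\<^sub>e Reg rL *\<^sub>e Reg rL)"

definition subset_sum_prog :: "nat \<Rightarrow> nat \<Rightarrow> nat \<Rightarrow> com" where
  "subset_sum_prog k \<rho> \<kappa> =
     (init_prog \<kappa>;; prime_loop k \<rho>;; Random rb (Reg rN -\<^sub>e Const 1);; main_prog)"

text \<open>Serves to absorb a squared logarithm into one factor \<open>M\<close> in
  \<open>D_bound\<close>.\<close>

lemma square_le_two_power: "(L::nat) * L \<le> 2 * 2 ^ L"
proof (cases "L < 3")
  case True
  then have "L \<in> {0, 1, 2}" by auto
  then show ?thesis by auto
next
  case False
  then have "3 \<le> L" by simp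
  then show ?thesis
  proof (induction L rule: nat_induct_at_least)
    case (Suc n)
    have "2 * n + 1 \<le> 3 * n" using Suc.hyps by simp
    also have "\<dots> \<le> n * n" using Suc.hyps by simp
    finally show ?case using Suc.IH by simp
  qed simp
qed

text \<open>The constants come from the error budget. The \<open>k\<close> primes form
  \<open>d + 5\<close> pairs, each worth a factor 1 / (2 M), and M^4 is spent on the union bound.
  The choice of \<open>\<kappa>\<close> gives M^(-(k + d + 1)) for the prime search, where M^k
  outweighs the initial \<open>2 ^ k\<close> of \<open>pot\<close> and one more M \<ge> 2 supplies a
  factor 1/2.\<close>

locale subset_sum_params = prime_search +
  fixes d :: nat
  assumes k: "k = 2 * (d + 5)" and \<kappa>: "\<kappa> = 8 * (\<rho> + 1) * (k + d + 1)"
    and word2: "Q ^ (2 * k) < 2 ^ w" "4 * M * Q ^ k < 2 ^ w" "16 * M < 2 ^ w" "\<kappa> < 2 ^ w"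
begin

text \<open>A single prime gains only a factor of order L / M. Squaring allows one of the two
  factors \<open>M\<close> to absorb the logarithms, which is why primes are counted in pairs and
  \<open>k\<close> is even.\<close>

lemma D_bound: "2 * M * (8 * D * M) ^ 2 \<le> Q ^ 2"
proof -
  have "8 * (\<rho> + 1) \<le> 2 ^ \<rho>" using \<rho>(1) by (induction \<rho> rule: nat_induct_at_least) simp_all
  then have "(8 * (\<rho> + 1)) ^ 2 \<le> (2 ^ \<rho>) ^ 2" by (rule power_mono) simp
  moreover have "L ^ 2 \<le> 2 * M" using square_le_two_power[of L] by (simp add: M power2_eq_square)
  ultimately have "(8 * (\<rho> + 1)) ^ 2 * L ^ 2 \<le> (2 ^ \<rho>) ^ 2 * (2 * M)" by (rule mult_le_mono)
  then have 1: "8 * (4 * D) ^ 2 \<le> 16 * ((2 ^ \<rho>) ^ 2 * M)" unfolding D_4 power_mult_distrib by simp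
  have "(16::nat) \<le> (2 ^ \<rho>) ^ 2"
    using \<rho>(1) power_increasing[of 4 "\<rho> * 2" "2::nat"] by (simp add: power_mult)
  then have "16 * ((2 ^ \<rho>) ^ 2 * M) \<le> (2 ^ \<rho>) ^ 2 * ((2 ^ \<rho>) ^ 2 * M)" by (rule mult_le_mono1)
  with 1 have 2: "8 * (4 * D) ^ 2 \<le> (2 ^ \<rho>) ^ 2 * ((2 ^ \<rho>) ^ 2 * M)" by (rule order_trans)
  have "2 * M * (8 * D * M) ^ 2 = 8 * (4 * D) ^ 2 * M ^ 3"
    by (simp add: power2_eq_square power3_eq_cube)
  also have "\<dots> \<le> (2 ^ \<rho>) ^ 2 * ((2 ^ \<rho>) ^ 2 * M) * M ^ 3" using 2 by (rule mult_le_mono1)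
  also have "\<dots> = Q ^ 2" unfolding Q_def by (simp add: power2_eq_square power3_eq_cube)
  finally show ?thesis .
qed

text \<open>Each prime contributes at most \<open>2 * M\<close> roots among more than Q / (4 D)
  residues, a ratio of 8 D M / Q; M^4 bounds the number of choices of set, item and
  interval.\<close>

lemma bad_bases_fraction:
  assumes A: "finite A" "\<forall>p \<in> A. prime p \<and> T < p" "card A = k" "N = \<Prod>A"
  shows "real (card (bad_bases m N xs)) / real N \<le> 1 / (2 * real M ^ d)"
proof -
  have Dp: "0 < real D" and Mp: "2 \<le> real M" and Qp: "0 < real Q" using D_pos M2 Q_pos by auto
  have "(real Q / (4 * real D)) ^ k \<le> (\<Prod>p\<in>A. real p)"
  proof -
    have "real Q / (4 * real D) \<le> real p" if "p \<in> A" for p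
    proof -
      have "T + 1 \<le> p" using A(2) that by fastforce
      then have "(T + 1) * (4 * D) \<le> p * (4 * D)" by (rule mult_le_mono1)
      with Q_D have "real Q \<le> real (p * (4 * D))" by (simp only: of_nat_le_iff)
      then show ?thesis using Dp by (simp add: field_simps)
    qed
    then have "(\<Prod>p\<in>A. real Q / (4 * real D)) \<le> (\<Prod>p\<in>A. real p)"
      by (intro prod_mono) auto
    then show ?thesis using A(3) by simp
  qed
  also have "\<dots> = real N" by (simp add: A(4))
  finally have N: "(real Q / (4 * real D)) ^ k \<le> real N" .
  have "card (bad_bases m N xs) \<le> m * m * ((m + 1) * (m + 1)) * (2 * m) ^ k"
    using card_bad_bases[OF m(1) A(1) _ A(4), of xs] A(2,3) by simp
  also have "\<dots> \<le> M * M * (M * M) * (2 * M) ^ k"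
    using m by (intro mult_le_mono power_mono) auto
  finally have "real (card (bad_bases m N xs)) \<le> real (M * M * (M * M) * (2 * M) ^ k)"
    by (simp only: of_nat_le_iff)
  then have "real (card (bad_bases m N xs)) \<le> real M ^ 4 * (2 * real M) ^ k"
    by (simp add: power4_eq_xxxx mult.assoc)
  then have "real (card (bad_bases m N xs)) / real N \<le>
      (real M ^ 4 * (2 * real M) ^ k) / (real Q / (4 * real D)) ^ k"
    using N Dp Qp Mp by (intro frac_le) auto
  also have "\<dots> = real M ^ 4 * (((8 * real D * real M) / real Q) ^ 2) ^ (d + 5)"
  proof -
    have "2 * real M / (real Q / (4 * real D)) = (8 * real D * real M) / real Q"
      using Dp Qp by (simp add: field_simps)
    then have "(2 * real M) ^ k / (real Q / (4 * real D)) ^ k = ((8 * real D * real M) / real Q) ^ k"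
      by (simp only: power_divide[symmetric])
    then show ?thesis
      unfolding power_mult[symmetric] k[symmetric] times_divide_eq_right[symmetric]
      by (simp only:)
  qed
  also have "\<dots> \<le> real M ^ 4 * (1 / (2 * real M)) ^ (d + 5)"
  proof -
    have "2 * real M * (8 * real D * real M) ^ 2 \<le> real Q ^ 2"
      using of_nat_mono[OF D_bound, where 'a = real] by simp
    then have "((8 * real D * real M) / real Q) ^ 2 \<le> 1 / (2 * real M)"
      using Qp Mp by (simp add: power_divide field_simps)
    then show ?thesis by (intro mult_left_mono power_mono) auto
  qed
  also have "\<dots> = 1 / (2 ^ (d + 5) * real M * real M ^ d)"
  proof -
    have "real M ^ 5 = real M * real M ^ 4" by (simp add: eval_nat_numeral)
    then have "(1 / (2 * real M)) ^ (d + 5) = 1 / (2 ^ (d + 5) * (real M ^ d * (real M * real M ^ 4)))"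
      by (simp add: power_divide power_mult_distrib power_add)
    then show ?thesis using Mp by simp
  qed
  also have "\<dots> \<le> 1 / (2 * real M ^ d)"
  proof -
    have "2 * 1 * real M ^ d \<le> 2 ^ (d + 5) * real M * real M ^ d"
    proof (intro mult_mono)
      show "(2::real) \<le> 2 ^ (d + 5)" using power_increasing[of 1 "d + 5" "2::real"] by simp
    qed (use Mp in auto)
    then show ?thesis using Mp by (intro divide_left_mono mult_pos_pos) auto
  qed
  finally show ?thesis .
qed

lemma pot_bound: "pot 0 (\<kappa> * L * L) \<le> 1 / (2 * real M ^ d)"
proof -
  have Dp: "0 < real D" and Mp: "2 \<le> real M" using D_pos M2 by auto
  have Mr: "real M = 2 ^ L" by (simp add: M)
  have "1 - 1 / (4 * real D) \<le> exp (- (1 / (4 * real D)))"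
    using exp_ge_add_one_self[of "- (1 / (4 * real D))"] by simp
  then have "(1 - 1 / (4 * real D)) ^ (\<kappa> * L * L) \<le> exp (- (1 / (4 * real D))) ^ (\<kappa> * L * L)"
    using q_nonneg by (rule power_mono)
  also have "\<dots> = exp (real (\<kappa> * L * L) * - (1 / (4 * real D)))"
    by (rule exp_of_nat_mult[symmetric])
  \<comment> \<open>The number of trials is \<open>(k + d + 1) * L\<close> times
    \<open>4 * D\<close> by the choice of \<open>\<kappa>\<close>. With exp (-1) \<le> 1/2 this
    becomes a power of 2^L = M.\<close>
  also have "real (\<kappa> * L * L) * - (1 / (4 * real D)) = real ((k + d + 1) * L) * (- 1)"
  proof -
    have "\<kappa> * L * L = (k + d + 1) * L * (4 * D)" unfolding D_4 \<kappa> by (simp only: mult_ac)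
    then have "real (\<kappa> * L * L) = real ((k + d + 1) * L) * (4 * real D)"
      by (metis of_nat_mult of_nat_numeral)
    then show ?thesis using Dp by (simp add: field_simps)
  qed
  also have "exp (real ((k + d + 1) * L) * (- 1 :: real)) = exp (- 1) ^ ((k + d + 1) * L)"
    by (rule exp_of_nat_mult)
  also have "\<dots> \<le> (1 / 2) ^ ((k + d + 1) * L)"
  proof (rule power_mono)
    have "2 \<le> exp (1::real)" using exp_ge_add_one_self[of 1] by simp
    then show "exp (- 1) \<le> (1 / 2 :: real)" by (simp add: exp_minus field_simps)
  qed simp
  also have "\<dots> = 1 / real M ^ (k + d + 1)"
    unfolding Mr power_one_over by (simp only: power_mult[symmetric] mult.commute)
  finally have q: "(1 - 1 / (4 * real D)) ^ (\<kappa> * L * L) \<le> 1 / real M ^ (k + d + 1)" .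
  have "pot 0 (\<kappa> * L * L) \<le> 2 ^ k * (1 - 1 / (4 * real D)) ^ (\<kappa> * L * L)"
    using q_nonneg by (simp add: pot_def)
  also have "\<dots> \<le> real M ^ k * (1 / real M ^ (k + d + 1))"
    using q q_nonneg Mp by (intro mult_mono power_mono) auto
  also have "\<dots> = 1 / (real M * real M ^ d)" using Mp by (simp add: power_add field_simps)
  also have "\<dots> \<le> 1 / (2 * real M ^ d)"
    using Mp by (intro divide_left_mono mult_right_mono mult_pos_pos) auto
  finally show ?thesis .
qed

definition fail :: "nat list \<Rightarrow> state \<Rightarrow> ennreal" where
  "fail xs s = (if output_set m s = subset_sums m (mset xs) then 0 else 1)"

definition main_cost :: "nat \<Rightarrow> nat" where
  "main_cost n = (L * (10 * L + 40) + 10 * L + 92 + 10 * L + 50) * (2 * m) + (20 * L + 130) * (3 * m) + 10 * n + 14 * m + 10 * L + 60"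

lemma random_main:
  assumes xs: "\<forall>x \<in> set xs. x < m"
  shows "expect w (Random rb (Reg rN -\<^sub>e Const 1);; main_prog) s (main_cost (length xs) + 2) (fail xs)
     (potential xs (1 / (2 * real M ^ d)) 0 s)"
proof (cases "search_inv xs 0 s")
  case False
  then show ?thesis by (simp add: potential_def expect_def)
next
  case I: True
  define e where "e = 1 / (2 * real M ^ d)"
  have e: "0 \<le> e" by (simp add: e_def)
  from I obtain A where A: "finite A" "\<forall>p \<in> A. prime p \<and> T < p \<and> p < Q" "card A = regs s rcnt" "regs s rcnt \<le> k"
      "regs s rN = \<Prod>A" and r: "regs s rm = m" "regs s rM = M" "tape s = xs" "mem s = (\<lambda>_. 0)"
    unfolding search_inv_def by blast
  define N where "N = \<Prod>A"
  \<comment> \<open>If no prime was found, \<open>N = 1\<close>; the main program must then still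
    keep to its time bound.\<close>
  have N0: "0 < N" using A by (auto simp: N_def prime_gt_0_nat intro!: prod_pos)
  have NQ: "N \<le> Q ^ k"
  proof -
    have "N \<le> Q ^ card A"
      using prod_mono[of A "\<lambda>x. x" "\<lambda>_. Q"] A(2) by (auto simp: N_def less_imp_le)
    also have "\<dots> \<le> Q ^ k" using A(3,4) Q_pos by (intro power_increasing) auto
    finally show ?thesis .
  qed
  have st: "segment_tree w m M L N"
  proof
    have "N * N \<le> Q ^ k * Q ^ k" using NQ by (intro mult_le_mono)
    also have "\<dots> = Q ^ (2 * k)" by (simp add: mult_2 power_add)
    finally show "N * N < 2 ^ w" using word2(1) by simp
    have "4 * M * N \<le> 4 * M * Q ^ k" using NQ by (rule mult_le_mono2)
    then show "4 * M * N < 2 ^ w" using word2(2) by (rule le_less_trans)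
  qed (use M m N0 word2(3) in auto)
  define G where "G s' = (if \<exists>b < N. s' = set_reg rb b s then
     (if regs s' rb \<in> bad_bases m N xs then 1 else 0) else (\<infinity>::ennreal))" for s'
  have 1: "expect w (Random rb (Reg rN -\<^sub>e Const 1)) s 1 G (potential xs e 0 s)"
  proof (rule expect_Random)
    have "N < 2 ^ w"
    proof -
      have "N \<le> N * N" by (rule le_square)
      then show ?thesis using st unfolding segment_tree_def by linarith
    qed
    then have ev: "eval_expr w s (Reg rN -\<^sub>e Const 1) = N - 1"
      using A(5) N0 by (simp add: eval_binop_exact N_def[symmetric])
    have range: "{0..N - 1} = {..<N}" using N0 by auto
    have "bad_bases m N xs \<subseteq> {..<N}" unfolding bad_bases_def by blast
    then have bad: "{..<N} \<inter> {b. b \<in> bad_bases m N xs} = bad_bases m N xs" by blast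
    have "(\<integral>\<^sup>+b. G (set_reg rb b s) \<partial>measure_pmf (pmf_of_set {..<N})) = (\<Sum>b<N. G (set_reg rb b s)) / of_nat N"
      using N0 by (subst nn_integral_pmf_of_set) (auto simp: lessThan_empty_iff)
    also have "(\<Sum>b<N. G (set_reg rb b s)) = (\<Sum>b<N. of_bool (b \<in> bad_bases m N xs))"
      by (intro sum.cong) (auto simp: G_def)
    also have "\<dots> = of_nat (card (bad_bases m N xs))" using bad by simp
    also have "\<dots> / of_nat N = ennreal (real (card (bad_bases m N xs)) / real N)"
      unfolding ennreal_of_nat_eq_real_of_nat using N0 by (subst divide_ennreal) auto
    also have "\<dots> \<le> potential xs e 0 s"
    proof (cases "card A = k")
      case True
      then have "real (card (bad_bases m N xs)) / real N \<le> e"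
        unfolding e_def using A(1,2) by (intro bad_bases_fraction[OF _ _ True N_def]) auto
      then show ?thesis using I True A(3) by (auto simp: potential_def pot_def intro!: ennreal_leI)
    next
      case False
      have "bad_bases m N xs \<subseteq> {..<N}" unfolding bad_bases_def by blast
      then have "card (bad_bases m N xs) \<le> N" using card_mono[of "{..<N}"] by fastforce
      then have "real (card (bad_bases m N xs)) / real N \<le> 1" using N0 by (simp add: field_simps)
      also have "1 \<le> e + pot (regs s rcnt) 0"
      proof -
        have "regs s rcnt < k" using False A(3,4) by simp
        then have "pot (regs s rcnt) 0 = 2 ^ (k - regs s rcnt)" by (simp add: pot_def)
        moreover have "(1::real) \<le> 2 ^ (k - regs s rcnt)" by (rule one_le_power) simp
        ultimately show ?thesis using e by linarith
      qed
      finally show ?thesis using I by (auto simp: potential_def intro!: ennreal_leI)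
    qed
    finally show "(\<integral>\<^sup>+b. G (set_reg rb b s) \<partial>measure_pmf (pmf_of_set {0..eval_expr w s (Reg rN -\<^sub>e Const 1)})) \<le> potential xs e 0 s"
      unfolding ev range .
  qed
  have 2: "expect w main_prog s' (main_cost (length xs)) (fail xs) (G s')" for s'
  proof (rule expect_det)
    assume "G s' < \<infinity>"
    then obtain b where b: "b < N" "s' = set_reg rb b s" by (auto simp: G_def split: if_splits)
    interpret segment_tree w m M L N b by (rule st)
    have base: "base s'" using r A(5)[folded N_def] by (simp add: base_def b(2))
    have cost: "round_cost * (2 * m) + (20 * L + 130) * (3 * m) + 10 * length xs + 14 * m + 10 * L + 60 = main_cost (length xs)"
      by (simp add: main_cost_def round_cost_def find_cost_def)
    show "det w main_prog s' (\<lambda>t' s''. t' \<le> main_cost (length xs) \<and> fail xs s'' \<le> G s')"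
    proof (rule det_mono[OF main_prog[OF base _ b(1) _ _ xs]])
      fix t s''
      assume *: "t \<le> round_cost * (2 * m) + (20 * L + 130) * (3 * m) + 10 * length xs + 14 * m + 10 * L + 60 \<and>
         (all_good xs \<longrightarrow> output_set m s'' = subset_sums m (mset xs))"
      have "fail xs s'' \<le> G s'"
      proof (cases "b \<in> bad_bases m N xs")
        case True
        then show ?thesis using b by (auto simp: G_def fail_def)
      next
        case False
        then show ?thesis using * all_good_if_not_bad[OF b(1) False] by (simp add: fail_def)
      qed
      with * show "t \<le> main_cost (length xs) \<and> fail xs s'' \<le> G s'" unfolding cost by simp
    qed (use b r in simp_all)
  qed
  show ?thesis unfolding e_def[symmetric] by (rule expect_Seq[OF 1 2]) simp
qed

lemma init_prog:
  assumes s: "tape s = m # xs" "regs s = (\<lambda>_. 0)" "mem s = (\<lambda>_. 0)"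
  shows "det w (init_prog \<kappa>) s (\<lambda>t s'. t \<le> 5 * L + 20 \<and> search_inv xs (\<kappa> * L * L) s' \<and> regs s' rcnt = 0)"
  unfolding init_prog_def
  apply (rule det_Seq_post[OF size_prog[OF s(1,2)]])
  subgoal premises p for t s'
  proof -
    have ev: "eval_expr w (set_reg rcnt a (set_reg rN b s')) (Const \<kappa> *\<^sub>e Reg rL *\<^sub>e Reg rL) = \<kappa> * L * L" for a b
    proof -
      have "\<kappa> * L \<le> \<kappa> * L * L" using L by simp
      then have "\<kappa> * L < 2 ^ w" using word(2) by (rule le_less_trans)
      then show ?thesis using p word(2) word2(4) by (simp add: eval_binop_exact)
    qed
    show ?thesis
      apply (intro det_Seq det_Assign)
      unfolding ev
      using p s(3) word(2) by (auto simp: search_inv_def intro!: exI[where x = "{}"])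
  qed
  done

definition total_cost :: "nat \<Rightarrow> nat" where
  "total_cost n = (5 * L + 20) + ((\<kappa> * L * L * (5 * (2 ^ \<rho> * M) + 16) + 1) + (main_cost n + 2) + 1) + 1"

lemma subset_sum_prog:
  assumes xs: "\<forall>x \<in> set xs. x < m"
  shows "expect w (subset_sum_prog k \<rho> \<kappa>) (init_state (m # xs)) (total_cost (length xs)) (fail xs)
     (ennreal (1 / real m ^ d))"
proof -
  define e where "e = 1 / (2 * real M ^ d)"
  let ?s = "init_state (m # xs)"
  have 1: "expect w (init_prog \<kappa>) ?s (5 * L + 20) (potential xs e (\<kappa> * L * L)) (ennreal (1 / real m ^ d))"
  proof (rule expect_det, rule det_mono[OF init_prog])
    fix t s' assume *: "t \<le> 5 * L + 20 \<and> search_inv xs (\<kappa> * L * L) s' \<and> regs s' rcnt = 0"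
    \<comment> \<open>One half of the error is reserved for bad bases, the other for an unsuccessful
      prime search.\<close>
    have "e + pot 0 (\<kappa> * L * L) \<le> 1 / real M ^ d" using pot_bound by (simp add: e_def)
    also have "\<dots> \<le> 1 / real m ^ d"
      using m by (intro divide_left_mono power_mono mult_pos_pos zero_less_power) auto
    finally have "ennreal (e + pot 0 (\<kappa> * L * L)) \<le> ennreal (1 / real m ^ d)" by (rule ennreal_leI)
    with * show "t \<le> 5 * L + 20 \<and> potential xs e (\<kappa> * L * L) s' \<le> ennreal (1 / real m ^ d)"
      by (simp add: potential_def)
  qed (simp_all add: init_state_def)
  have "0 \<le> e" by (simp add: e_def)
  show ?thesis
    unfolding subset_sum_prog_def
    by (rule expect_Seq[OF 1 expect_Seq[OF prime_loop[OF \<open>0 \<le> e\<close>] random_main[OF xs, folded e_def] refl]])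
      (simp add: total_cost_def)
qed

lemma total_cost_bound: "total_cost n \<le> (\<kappa> * (10 * 2 ^ \<rho> + 16) + 1200) * (m * (L * L)) + 10 * n"
proof -
  define u where "u = m * (L * L)"
  have "1 * (1 * 1) \<le> u" "m * (1 * 1) \<le> u" "1 * (L * 1) \<le> u" "m * (L * 1) \<le> u" "1 * (L * L) \<le> u"
    unfolding u_def using m L by (intro mult_le_mono; simp)+
  then have u: "1 \<le> u" "m \<le> u" "L \<le> u" "m * L \<le> u" "L * L \<le> u" by simp_all
  have "\<kappa> * L * L * (5 * (2 ^ \<rho> * M) + 16) \<le> \<kappa> * L * L * (5 * (2 ^ \<rho> * (2 * m)) + 16)"
    using m(3) by (intro mult_le_mono add_mono) auto
  also have "\<dots> = \<kappa> * 10 * 2 ^ \<rho> * u + \<kappa> * 16 * (L * L)" by (simp add: u_def algebra_simps)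
  also have "\<dots> \<le> \<kappa> * 10 * 2 ^ \<rho> * u + \<kappa> * 16 * u" using u(5) by simp
  finally have 1: "\<kappa> * L * L * (5 * (2 ^ \<rho> * M) + 16) \<le> \<kappa> * (10 * 2 ^ \<rho> + 16) * u" by (simp add: algebra_simps)
  \<comment> \<open>Together with the 5 L + 25 steps added in \<open>total_cost\<close> outside the
    prime loop, the coefficients other than that of \<open>n\<close> sum to 988, which 1200
    covers.\<close>
  have "main_cost n = 20 * u + 180 * (m * L) + 688 * m + 10 * L + 60 + 10 * n"
    by (simp add: main_cost_def u_def algebra_simps)
  then show ?thesis unfolding total_cost_def u_def[symmetric] distrib_right[of _ 1200]
    using 1 u by linarith
qed

end

section \<open>Word length and time in terms of the input\<close>

lemma mem_subset_sums_iff: "t < m \<Longrightarrow> t \<in> subset_sums m X \<longleftrightarrow> modular_subset_sum m X t"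
  unfolding subset_sums_def modular_subset_sum_def cong_def by auto

text \<open>Every quantity that has to fit into a word is below or equal to a power of 2 with
  exponent at most \<open>c * L\<close> for some \<open>c < K\<close>; additive constants are
  multiplied by \<open>L\<close>, which is at least 1. The value of \<open>K\<close> simply adds up
  more than all these \<open>c\<close>.\<close>

lemma subset_sum_params_word_bits:
  assumes m: "0 < m" and L: "L = floorlog 2 m" and k: "k = 2 * (d + 5)" and \<rho>: "\<rho> = k + 6"
    and \<kappa>: "\<kappa> = 8 * (\<rho> + 1) * (k + d + 1)" and K: "K = 4 * (\<rho> + 1) * (k + 1) + \<kappa> + 8"
  shows "subset_sum_params (word_bits K m) m (2 ^ L) L k \<rho> \<kappa> d"
proof -
  have b: "2 ^ (L - 1) \<le> m" "m < 2 ^ L" using floorlog_bounds[of m 2] m L by auto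
  have L0: "0 < L" using b(2) m by (cases L) auto
  have M2: "2 ^ L \<le> 2 * m" using b(1) L0 by (cases L) auto
  have lt: "(2::nat) ^ e < 2 ^ word_bits K m" if "e \<le> c * L" "c < K" for e c
  proof -
    have "c * L < K * L" using that(2) L0 by simp
    with that(1) have "e < K * L" by linarith
    then show ?thesis unfolding word_bits_def L[symmetric] by (intro power_strict_increasing) auto
  qed
  have \<rho>L: "\<rho> + L \<le> (\<rho> + 1) * L" using mult_le_mono2[of 1 L \<rho>] L0 by simp
  have Qp: "((2 ^ \<rho> * 2 ^ L) ^ 2) ^ j = (2::nat) ^ (2 * (\<rho> + L) * j)" for j
    by (simp only: power_add[symmetric] power_mult[symmetric] mult_ac add_ac)
  have Qj: "2 * (\<rho> + L) * j \<le> (2 * (\<rho> + 1) * j) * L" for j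
    using mult_le_mono1[OF \<rho>L, of "2 * j"] by (simp add: algebra_simps)
  interpret prime_search "word_bits K m" m "2 ^ L" L k \<rho> \<kappa>
  proof
    show "((2 ^ \<rho> * 2 ^ L) ^ 2) ^ (k + 1) < (2::nat) ^ word_bits K m"
      unfolding Qp by (rule lt[OF Qj]) (simp add: K algebra_simps)
    have "\<kappa> * L * L \<le> 2 ^ \<kappa> * 2 ^ L * 2 ^ L"
      by (intro mult_le_mono less_imp_le less_exp)
    also have "\<dots> = 2 ^ (\<kappa> + L + L)" by (simp only: power_add)
    also have "\<dots> < 2 ^ word_bits K m"
    proof (rule lt)
      show "\<kappa> + L + L \<le> (\<kappa> + 2) * L" using mult_le_mono2[of 1 L \<kappa>] L0 by (simp add: algebra_simps)
    qed (simp add: K algebra_simps)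
    finally show "\<kappa> * L * L < 2 ^ word_bits K m" .
    have "(2::nat) ^ 4 < 2 ^ word_bits K m" by (rule lt[of 4 4]) (use L0 in \<open>simp_all add: K algebra_simps\<close>)
    then show "16 < (2::nat) ^ word_bits K m" by simp
  qed (use m b M2 L0 \<rho> in auto)
  have Q: "Q ^ j = 2 ^ (2 * (\<rho> + L) * j)" for j unfolding Q_def by (rule Qp)
  show ?thesis
  proof
    show "Q ^ (2 * k) < 2 ^ word_bits K m"
      unfolding Q by (rule lt[OF Qj]) (simp add: K algebra_simps)
    have "4 * 2 ^ L * Q ^ k = 2 ^ (2 + L + 2 * (\<rho> + L) * k)" unfolding Q by (simp add: power_add)
    also have "\<dots> < 2 ^ word_bits K m"
    proof (rule lt)
      show "2 + L + 2 * (\<rho> + L) * k \<le> (3 + 2 * (\<rho> + 1) * k) * L"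
        unfolding add_mult_distrib using L0 by (intro add_mono Qj) simp
    qed (simp add: K algebra_simps)
    finally show "4 * 2 ^ L * Q ^ k < 2 ^ word_bits K m" .
    have "(2::nat) ^ (4 + L) < 2 ^ word_bits K m"
      by (rule lt[of _ 5]) (use L0 in \<open>simp_all add: K algebra_simps\<close>)
    then show "16 * 2 ^ L < (2::nat) ^ word_bits K m" by (simp add: power_add)
    have "\<kappa> < 2 ^ \<kappa>" by (rule less_exp)
    also have "\<dots> < 2 ^ word_bits K m" by (rule lt[of _ \<kappa>]) (use L0 in \<open>simp_all add: K algebra_simps\<close>)
    finally show "\<kappa> < 2 ^ word_bits K m" .
  qed (use k \<kappa> in simp_all)
qed

text \<open>For \<open>m \<ge> 2\<close> the length is at most log m + 1 \<le> 2 log m. The summand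
  1 is for \<open>m = 1\<close>, where the logarithm vanishes and the length does not.\<close>

lemma floorlog_square_le:
  assumes "0 < m"
  shows "(real (floorlog 2 m))\<^sup>2 \<le> 4 * (log 2 (real m))\<^sup>2 + 1"
proof -
  define l where "l = log 2 (real m)"
  define L where "L = floorlog 2 m"
  have "2 ^ (L - 1) \<le> m" using floorlog_bounds[of m 2] assms by (simp add: L_def)
  then have "2 ^ (L - 1) \<le> real m" by (metis of_nat_le_iff of_nat_numeral of_nat_power)
  then have "real (L - 1) \<le> l" unfolding l_def using assms by (simp add: le_log_iff powr_realpow)
  then have Ll: "real L \<le> l + 1" by linarith
  show ?thesis
  proof (cases "m = 1")
    case True
    then have "l = 0" by (simp add: l_def)
    with Ll have "(real L)\<^sup>2 \<le> 1\<^sup>2" by (intro power_mono) auto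
    with \<open>l = 0\<close> show ?thesis unfolding L_def[symmetric] l_def[symmetric] by simp
  next
    case False
    then have "2 \<le> real m" using assms by simp
    then have "1 \<le> l" unfolding l_def by simp
    then have "(real L)\<^sup>2 \<le> (2 * l)\<^sup>2" using Ll by (intro power_mono) auto
    then show ?thesis unfolding L_def[symmetric] l_def[symmetric] by (simp add: power_mult_distrib)
  qed
qed

theorem theorem3p1:
  fixes d :: nat
  shows "\<exists>(P :: com) (K :: nat) (C :: real).
    \<forall>(m :: nat) (X :: nat multiset) (xs :: nat list).
      m > 0 \<longrightarrow> (\<forall>x \<in># X. x < m) \<longrightarrow> mset xs = X \<longrightarrow>
      (\<exists>T :: nat.
        real T \<le> C * (real m * (log 2 (real m))\<^sup>2) + C * (real (size X) + real m) \<and>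
        halts_within (word_bits K m) T (P, init_state (m # xs)) \<and>
        measure_pmf.prob (run (word_bits K m) T (P, init_state (m # xs)))
          {(c, s). output_set m s = subset_sums m X \<and>
                   (\<forall>t < m. t \<in> output_set m s \<longleftrightarrow> modular_subset_sum m X t)}
          \<ge> 1 - 1 / real m ^ d)"
proof -
  \<comment> \<open>All constants depend on \<open>d\<close> alone, so one program and one
    word-length factor serve every \<open>m\<close> and every input.\<close>
  define k where "k = 2 * (d + 5)"
  define \<rho> where "\<rho> = k + 6"
  define \<kappa> where "\<kappa> = 8 * (\<rho> + 1) * (k + d + 1)"
  define K where "K = 4 * (\<rho> + 1) * (k + 1) + \<kappa> + 8"
  define B where "B = \<kappa> * (10 * 2 ^ \<rho> + 16) + 1200"
  define C where "C = 4 * real B + 10"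
  define P where "P = subset_sum_prog k \<rho> \<kappa>"
  show ?thesis
  proof (rule exI[where x = P], rule exI[where x = K], rule exI[where x = C], intro allI impI)
    fix m :: nat and X xs
    assume m: "0 < m" and X: "\<forall>x \<in># X. x < m" and xs: "mset xs = X"
    define L where "L = floorlog 2 m"
    define w where "w = word_bits K m"
    interpret subset_sum_params w m "2 ^ L" L k \<rho> \<kappa> d
      unfolding w_def by (rule subset_sum_params_word_bits[OF m L_def k_def \<rho>_def \<kappa>_def K_def])
    define T' where "T' = total_cost (length xs)"
    let ?cfg = "(P, init_state (m # xs))"
    let ?R = "run w T' ?cfg"
    let ?good = "{(c, s). output_set m s = subset_sums m X \<and>
                   (\<forall>t < m. t \<in> output_set m s \<longleftrightarrow> modular_subset_sum m X t)}"
    have "\<forall>x \<in> set xs. x < m" using X xs by auto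
    from subset_sum_prog[OF this] have halts: "halts_within w T' ?cfg"
      and int: "(\<integral>\<^sup>+cfg. fail xs (snd cfg) \<partial>measure_pmf ?R) \<le> ennreal (1 / real m ^ d)"
      unfolding expect_def P_def T'_def by auto
    have good: "?good = {cfg. output_set m (snd cfg) = subset_sums m X}"
      using mem_subset_sums_iff by auto
    have "emeasure (measure_pmf ?R) (- ?good) = (\<integral>\<^sup>+cfg. indicator (- ?good) cfg \<partial>measure_pmf ?R)"
      by simp
    also have "\<dots> = (\<integral>\<^sup>+cfg. fail xs (snd cfg) \<partial>measure_pmf ?R)"
      unfolding good by (intro nn_integral_cong) (simp add: fail_def xs indicator_def)
    also have "\<dots> \<le> ennreal (1 / real m ^ d)" by (rule int)
    finally have "measure_pmf.prob ?R (- ?good) \<le> 1 / real m ^ d"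
      by (simp add: measure_pmf.emeasure_eq_measure)
    then have prob: "1 - 1 / real m ^ d \<le> measure_pmf.prob ?R ?good"
      using measure_pmf.prob_compl[of ?good ?R] by (simp add: Compl_eq_Diff_UNIV)
    have "real T' \<le> C * (real m * (log 2 (real m))\<^sup>2) + C * (real (size X) + real m)"
    proof -
      have "real T' \<le> real (B * (m * (L * L)) + 10 * length xs)"
        using total_cost_bound unfolding T'_def B_def by (simp only: of_nat_le_iff)
      also have "\<dots> = real B * (real m * (real L)\<^sup>2) + 10 * real (length xs)"
        by (simp add: power2_eq_square)
      also have "\<dots> \<le> real B * (real m * (4 * (log 2 (real m))\<^sup>2 + 1)) + 10 * real (length xs)"
        unfolding L_def by (intro add_mono mult_left_mono floorlog_square_le m) auto
      also have "\<dots> = 4 * real B * (real m * (log 2 (real m))\<^sup>2) + real B * real m + 10 * real (length xs)"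
        by (simp add: algebra_simps)
      also have "\<dots> \<le> C * (real m * (log 2 (real m))\<^sup>2) + C * real m + C * real (length xs)"
        unfolding C_def by (intro add_mono mult_right_mono) auto
      also have "length xs = size X" using xs by auto
      finally show ?thesis by (simp add: algebra_simps)
    qed
    with halts prob show "\<exists>T :: nat.
        real T \<le> C * (real m * (log 2 (real m))\<^sup>2) + C * (real (size X) + real m) \<and>
        halts_within (word_bits K m) T ?cfg \<and>
        1 - 1 / real m ^ d \<le> measure_pmf.prob (run (word_bits K m) T ?cfg) ?good"
      unfolding w_def by blast
  qed
qed

end
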